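(* Let $A\subseteq\mathbb{R}^d$ be open with $\mathrm{Leb}(\partial A)=0$, let $\Gamma$ be a connected graph with $k\in\mathbb{N}$ vertices and $m$ edges, and suppose $nr_n^d\to\rho\in(0,\infty)$. Then: (i) If $p_n\equiv p$ is constant, then $$\lim_{n\to\infty}\frac{E(J'_{n,A}(\Gamma))}{n\,p_n^m}\ \ge\ k^{-1}\int_A p_\Gamma(\rho f(x))f(x)\,dx+k^{-1}(1-p)^{\binom{k}{2}-m}\int_A p'_\Gamma(\rho f(x))f(x)\,dx.$$ (ii) If $n^2p_n\to\alpha\in(0,\infty)$, then $$\lim_{n\to\infty}\frac{E(J'_{n,A}(\Gamma))}{n\,p_n^m}\ \ge\ k^{-1}\int_A p_\Gamma(\rho f(x))f(x)\,dx+k^{-1}e^{-\alpha/2}\int_A p'_\Gamma(\rho f(x))f(x)\,dx.$$ (iii) If $n^2p_n\to 0$, then $$\lim_{n\to\infty}\frac{E(J'_{n,A}(\Gamma))}{n\,p_n^m}\ \ge\ k^{-1}\int_A p_\Gamma(\rho f(x))f(x)\,dx+k^{-1}\int_A p'_\Gamma(\rho f(x))f(x)\,dx.$$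
   Context: Let $f:\mathbb{R}^d\to[0,\infty)$ be a bounded measurable probability density, and let $X_1,X_2,\dots$ be i.i.d. random points in $\mathbb{R}^d$ with density $f$. Put $\mathcal{X}_n=\{X_1,\dots,X_n\}$. Let $r_n>0$ and $p_n\in(0,1]$ be sequences. For a finite set $\mathcal{Y}\subset\mathbb{R}^d$ and $r>0$, $G(\mathcal{Y};r)$ is the graph with vertex set $\mathcal{Y}$ in which two distinct points are joined by an edge iff their Euclidean distance is at most $r$. The percolated random geometric graph $G(\mathcal{X}_n;p_n,r_n)$ is obtained from $G(\mathcal{X}_n;r_n)$ by keeping each edge with probability $p_n$ and deleting it otherwise, independently for all edges (and independently of the points). $J'_{n,A}(\Gamma)$ is the number of connected components of $G(\mathcal{X}_n;p_n,r_n)$ that are isomorphic to $\Gamma$ and whose vertex set has its left-most point (the point with smallest first coordinate) in $A$. For a finite set $\mathcal{Y}\subset\mathbb{R}^d$ with $k$ elements, $h_\Gamma(\mathcal{Y})=1$ if $G(\mathcal{Y};1)\cong\Gamma$ and $0$ otherwise; $g_\Gamma(\mathcal{Y})=1$ if $G(\mathcal{Y};1)$ strictly contains $\Gamma$ (i.e. has a subgraph isomorphic to $\Gamma$ but is not itself isomorphic to $\Gamma$), and $0$ otherwise. Both are $0$ if $\mathcal{Y}$ does not have exactly $k$ elements. Let $V(y_1,\dots,y_j)$ be the Lebesgue measure of the union of the balls of unit radius centered at $y_1,\dots,y_j$. For $k\ge2$ and $\lambda>0$ define $$p_\Gamma(\lambda)=\frac{\lambda^{k-1}}{(k-1)!}\int_{(\mathbb{R}^d)^{k-1}}h_\Gamma(\{0,x_1,\dots,x_{k-1}\})\exp(-\lambda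 V(0,x_1,\dots,x_{k-1}))\,d(x_1,\dots,x_{k-1}),$$ $$p'_\Gamma(\lambda)=\frac{\lambda^{k-1}}{(k-1)!}\int_{(\mathbb{R}^d)^{k-1}}g_\Gamma(\{0,x_1,\dots,x_{k-1}\})\exp(-\lambda V(0,x_1,\dots,x_{k-1}))\,d(x_1,\dots,x_{k-1}).$$ If $k=1$, set $p_\Gamma(\lambda)=p'_\Gamma(\lambda)=\exp(-\lambda\theta)$, where $\theta$ is the volume of the unit ball in $\mathbb{R}^d$.
   Formalization: For k=1 the convention p'_Γ(λ)=exp(−λθ) makes the claim false (e.g. f=1_[0,1], p_n=1), so p'_Γ is instead given by its general integral formula, which is 0 when k=1; all k≥2 are unchanged. *)

theory Defs
  imports "HOL-Probability.Probability"
begin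

section \<open>Finite simple graphs\<close>

type_synonym 'v graph = "'v set \<times> 'v set set"

abbreviation verts :: "'v graph \<Rightarrow> 'v set" where
  "verts G \<equiv> fst G"

abbreviation edges :: "'v graph \<Rightarrow> 'v set set" where
  "edges G \<equiv> snd G"

definition simple_graph :: "'v graph \<Rightarrow> bool" where
  "simple_graph G \<longleftrightarrow> finite (verts G) \<and> (\<forall>e\<in>edges G. e \<subseteq> verts G \<and> card e = 2)"

definition reachable :: "'v graph \<Rightarrow> 'v \<Rightarrow> 'v \<Rightarrow> bool" where
  "reachable G u v \<longleftrightarrow> (u, v) \<in> {(x, y). {x, y} \<in> edges G}\<^sup>*"

definition connected_graph :: "'v graph \<Rightarrow> bool" where
  "connected_graph G \<longleftrightarrow> verts G \<noteq> {} \<and> (\<forall>u\<in>verts G. \<forall>v\<in>verts G. reachable G u v)"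

definition graph_iso :: "'v graph \<Rightarrow> 'w graph \<Rightarrow> bool" where
  "graph_iso G H \<longleftrightarrow> (\<exists>\<phi>. bij_betw \<phi> (verts G) (verts H) \<and>
     (\<forall>u\<in>verts G. \<forall>v\<in>verts G. {u, v} \<in> edges G \<longleftrightarrow> {\<phi> u, \<phi> v} \<in> edges H))"

definition subgraph :: "'v graph \<Rightarrow> 'v graph \<Rightarrow> bool" where
  "subgraph H G \<longleftrightarrow> simple_graph H \<and> verts H \<subseteq> verts G \<and> edges H \<subseteq> edges G"

definition strictly_contains :: "'v graph \<Rightarrow> 'w graph \<Rightarrow> bool" where
  "strictly_contains G \<Gamma> \<longleftrightarrow> (\<exists>H. subgraph H G \<and> graph_iso H \<Gamma>) \<and> \<not> graph_iso G \<Gamma>"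

definition induced_subgraph :: "'v graph \<Rightarrow> 'v set \<Rightarrow> 'v graph" where
  "induced_subgraph G C = (C, {e \<in> edges G. e \<subseteq> C})"

definition component_sets :: "'v graph \<Rightarrow> 'v set set" where
  "component_sets G = (\<lambda>u. {v \<in> verts G. reachable G u v}) ` verts G"

section \<open>Percolated random geometric graphs\<close>

definition geometric_graph :: "(real^'d) set \<Rightarrow> real \<Rightarrow> (real^'d) graph" where
  "geometric_graph Y r = (Y, {{x, y} | x y. x \<in> Y \<and> y \<in> Y \<and> x \<noteq> y \<and> dist x y \<le> r})"

definition index_pairs :: "nat \<Rightarrow> nat set set" where
  "index_pairs n = {e. e \<subseteq> {1..n} \<and> card e = 2}"

text \<open>The edge between the points \<open>x i\<close> and \<open>x j\<close> is retained iff the mark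
  \<open>keep {i, j}\<close> is set. For pairwise distinct points, which is the almost sure situation,
  every edge has exactly one mark.\<close>

definition percolated_graph ::
    "nat \<Rightarrow> (nat \<Rightarrow> real^'d) \<Rightarrow> (nat set \<Rightarrow> bool) \<Rightarrow> real \<Rightarrow> (real^'d) graph" where
  "percolated_graph n x keep r =
     (x ` {1..n},
      {{x i, x j} | i j. i \<in> {1..n} \<and> j \<in> {1..n} \<and>
         {x i, x j} \<in> edges (geometric_graph (x ` {1..n}) r) \<and> keep {i, j}})"

text \<open>The coordinate playing the role of the first one is the parameter \<open>i1\<close>, since the index
  type \<open>'d\<close> carries no order. Left-most points are unique almost surely; in case of a tie,
  one of them has to lie in \<open>A\<close>.\<close>

definition component_count ::
    "'d \<Rightarrow> (real^'d) set \<Rightarrow> 'v graph \<Rightarrow> (real^'d) graph \<Rightarrow> nat" where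
  "component_count i1 A \<Gamma> G =
     card {C \<in> component_sets G. graph_iso (induced_subgraph G C) \<Gamma> \<and>
       (\<exists>x\<in>C. (\<forall>y\<in>C. x $ i1 \<le> y $ i1) \<and> x \<in> A)}"

text \<open>\<open>X 1, X 2, \<dots>\<close> are i.i.d. with density \<open>f\<close>. For each \<open>n\<close>, the marks \<open>K n e\<close>, with \<open>e\<close> a
  two-element subset of \<open>{1..n}\<close>, are i.i.d. Bernoulli with parameter \<open>p n\<close> and independent of
  the points; the latter is stated for the generated sigma-algebras, as \<open>indep_var\<close> needs both
  variables to have the same type. Nothing is assumed about the joint law of the marks for different \<open>n\<close>.\<close>

locale percolation_model = prob_space M
  for M :: "'w measure" +
  fixes f :: "real^'d::finite \<Rightarrow> real"
    and p :: "nat \<Rightarrow> real"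
    and X :: "nat \<Rightarrow> 'w \<Rightarrow> real^'d"
    and K :: "nat \<Rightarrow> nat set \<Rightarrow> 'w \<Rightarrow> bool"
  assumes points_density: "\<And>i. i \<ge> 1 \<Longrightarrow> distributed M lborel (X i) (\<lambda>x. ennreal (f x))"
    and points_indep: "indep_vars (\<lambda>_. borel) X {1..}"
    and marks_prob: "\<And>n e. n \<ge> 1 \<Longrightarrow> e \<in> index_pairs n \<Longrightarrow> prob {\<omega> \<in> space M. K n e \<omega>} = p n"
    and marks_indep: "\<And>n. n \<ge> 1 \<Longrightarrow> indep_vars (\<lambda>_. count_space UNIV) (K n) (index_pairs n)"
    and marks_points_indep: "\<And>n. n \<ge> 1 \<Longrightarrow>
      indep_set
        (sets (vimage_algebra (space M) (\<lambda>\<omega>. \<lambda>i\<in>{1..n}. X i \<omega>)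
           (Pi\<^sub>M {1..n} (\<lambda>_. borel))))
        (sets (vimage_algebra (space M) (\<lambda>\<omega>. \<lambda>e\<in>index_pairs n. K n e \<omega>)
           (Pi\<^sub>M (index_pairs n) (\<lambda>_. count_space UNIV))))"

section \<open>The limiting functionals\<close>

definition h_ind :: "'v graph \<Rightarrow> (real^'d) set \<Rightarrow> real" where
  "h_ind \<Gamma> Y = of_bool (finite Y \<and> card Y = card (verts \<Gamma>) \<and>
     graph_iso (geometric_graph Y 1) \<Gamma>)"

definition g_ind :: "'v graph \<Rightarrow> (real^'d) set \<Rightarrow> real" where
  "g_ind \<Gamma> Y = of_bool (finite Y \<and> card Y = card (verts \<Gamma>) \<and>
     strictly_contains (geometric_graph Y 1) \<Gamma>)"

definition ball_union_volume :: "(real^'d::finite) set \<Rightarrow> real" where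
  "ball_union_volume Y = measure lborel (\<Union>y\<in>Y. cball y 1)"

definition p_iso :: "'d::finite itself \<Rightarrow> 'v graph \<Rightarrow> real \<Rightarrow> real" where
  "p_iso _ \<Gamma> lam = (let k = card (verts \<Gamma>) in
     if k = 1 then exp (- lam * measure lborel (cball (0 :: real^'d) 1))
     else lam ^ (k - 1) / fact (k - 1) *
       (\<integral>x. h_ind \<Gamma> (insert 0 (x ` {1..k-1})) * exp (- lam * ball_union_volume (insert 0 (x ` {1..k-1})))
          \<partial>Pi\<^sub>M {1..k-1} (\<lambda>_. lborel :: (real^'d) measure)))"

text \<open>The integral formula is used for every number \<open>k\<close> of vertices. For \<open>k = 1\<close> it gives \<open>0\<close>,
  because no one-vertex graph strictly contains \<open>\<Gamma>\<close>. The convention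
  \<open>exp (- lam * \<theta>)\<close> of the source, with \<open>\<theta>\<close> the volume of the unit ball, would count isolated points twice in
  the lower bounds below and make these false for \<open>k = 1\<close>: if \<open>p n = 1\<close> for all \<open>n\<close>, the limit
  equals the first term of the bound, and the second term would repeat it.\<close>

definition p_strict :: "'d::finite itself \<Rightarrow> 'v graph \<Rightarrow> real \<Rightarrow> real" where
  "p_strict _ \<Gamma> lam = (let k = card (verts \<Gamma>) in
     lam ^ (k - 1) / fact (k - 1) *
       (\<integral>x. g_ind \<Gamma> (insert 0 (x ` {1..k-1})) * exp (- lam * ball_union_volume (insert 0 (x ` {1..k-1})))
          \<partial>Pi\<^sub>M {1..k-1} (\<lambda>_. lborel :: (real^'d) measure)))"

lemma p_strict_one_vertex:
  assumes "simple_graph \<Gamma>" "card (verts \<Gamma>) = 1"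
  shows "p_strict TYPE('d::finite) \<Gamma> lam = 0"
proof -
  obtain v where v: "verts \<Gamma> = {v}"
    using assms(2) by (auto simp: card_1_singleton_iff)
  have "edges \<Gamma> = {}"
  proof (rule ccontr)
    assume "edges \<Gamma> \<noteq> {}"
    then obtain e where "e \<subseteq> {v}" "card e = 2"
      using assms(1) v by (auto simp: simple_graph_def)
    then show False
      by (metis card_mono card.empty card_insert_disjoint finite.emptyI finite_insert empty_iff
          One_nat_def not_less_eq_eq numeral_2_eq_2 le_refl)
  qed
  then have "graph_iso (geometric_graph {0 :: real^'d} 1) \<Gamma>"
    unfolding graph_iso_def geometric_graph_def
    by (intro exI[of _ "\<lambda>_. v"]) (auto simp: v bij_betw_def)
  then have "g_ind \<Gamma> {0 :: real^'d} = 0"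
    by (simp add: g_ind_def strictly_contains_def)
  then show ?thesis
    using assms(2) by (simp add: p_strict_def)
qed

end

theory Submission
  imports Defs
begin

text \<open>Almost surely the points are pairwise distinct, so a component isomorphic to \<open>\<Gamma>\<close> is the image of a
unique set \<open>S\<close> of \<open>k\<close> indices. Such an \<open>S\<close> counts iff the retained edges inside it form a copy of \<open>\<Gamma>\<close>
and no retained edge leaves it. Given the points, the first event has probability \<open>p n ^ m\<close> times
\<open>weight \<Gamma> (p n) G\<close>, where \<open>G\<close> is the geometric graph on \<open>S\<close>: the number of copies of \<open>\<Gamma>\<close> in \<open>G\<close>
on all its vertices, times \<open>1 - p n\<close> to the number of edges of \<open>G\<close> that have to be deleted. Each of the
\<open>n - k\<close> other points then avoids \<open>S\<close> independently with a probability that is a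
power of \<open>1 - p n\<close> averaged over the position of the point. By exchangeability this gives the exact
formula \<open>expected_component_count\<close>: the expected count is \<open>n choose k\<close> times \<open>p n ^ m\<close> times one integral
over \<open>k\<close> points.

In that integral, write the points as \<open>t + r n *\<^sub>R z i\<close> with \<open>z 0 = 0\<close>. The Jacobian \<open>(r n ^ d) ^ (k - 1)\<close>
(with \<open>d\<close> the dimension) balances \<open>(n choose k) / n\<close>: their product tends to \<open>\<rho> ^ (k - 1) / fact k\<close>. The
weight depends on \<open>z\<close> only and vanishes outside a fixed box, because a connected graph with edges of
length at most 1 has bounded diameter. Locally \<open>f\<close> may be replaced by its value at \<open>t\<close>; as \<open>f\<close> is only
measurable, this is justified by continuity of translations in \<open>L\<^sup>1\<close>, not pointwise. The void
probability then tends to \<open>exp (- \<rho> f(t) W)\<close>, where \<open>W\<close> is the integral over \<open>w\<close> of the probability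
\<open>1 - (1 - q) ^ j\<close> that a point at \<open>w\<close>, within distance 1 of \<open>j\<close> of the \<open>z i\<close>, is joined to one of them.
So whenever \<open>p n\<close> converges to some \<open>q\<close>, the normalised expected count converges (\<open>expected_count_limit\<close>).
All three regimes are instances, the last two with \<open>q = 0\<close>.

For the lower bound, \<open>W\<close> is at most the volume of the union of the unit balls. The weight is at
least 1 if the geometric graph is isomorphic to \<open>\<Gamma>\<close>, and if it strictly contains \<open>\<Gamma>\<close> then at least one
copy exists and at most \<open>(k choose 2) - m\<close> edges must be deleted. The factor \<open>exp (- \<alpha> / 2)\<close> in the
second regime is at most 1.\<close>

section \<open>Copies of a graph and relabelling of vertices\<close>

definition relabel :: "('v \<Rightarrow> 'w) \<Rightarrow> 'v graph \<Rightarrow> 'w graph" where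
  "relabel \<phi> G = (\<phi> ` verts G, (`) \<phi> ` edges G)"

text \<open>Copies are counted as edge sets on all vertices of the host graph: percolation deletes edges but no
vertices.\<close>

definition copies :: "'v graph \<Rightarrow> 'w graph \<Rightarrow> nat" where
  "copies \<Gamma> G = card {E. E \<subseteq> edges G \<and> graph_iso (verts G, E) \<Gamma>}"

text \<open>If every edge of \<open>G\<close> is kept independently with probability \<open>q\<close>, the remaining graph is isomorphic
to \<open>\<Gamma>\<close> with probability \<open>q ^ card (edges \<Gamma>)\<close> times this weight. In this form the quantity stays
meaningful in the limit \<open>q = 0\<close>, where it is the number of copies.\<close>

definition weight :: "'v graph \<Rightarrow> real \<Rightarrow> 'w graph \<Rightarrow> real" where
  "weight \<Gamma> q G = real (copies \<Gamma> G) * (1 - q) ^ (card (edges G) - card (edges \<Gamma>))"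

lemma verts_relabel [simp]: "verts (relabel \<phi> G) = \<phi> ` verts G"
  and edges_relabel [simp]: "edges (relabel \<phi> G) = (`) \<phi> ` edges G"
  by (simp_all add: relabel_def)

lemma graph_iso_sym:
  assumes "graph_iso G H" shows "graph_iso H G"
proof -
  obtain \<phi> where b: "bij_betw \<phi> (verts G) (verts H)"
    and e: "\<And>u v. u \<in> verts G \<Longrightarrow> v \<in> verts G \<Longrightarrow> {u, v} \<in> edges G \<longleftrightarrow> {\<phi> u, \<phi> v} \<in> edges H"
    using assms by (auto simp: graph_iso_def)
  let ?\<psi> = "inv_into (verts G) \<phi>"
  have "bij_betw ?\<psi> (verts H) (verts G)" using b by (rule bij_betw_inv_into)
  moreover have "{u, v} \<in> edges H \<longleftrightarrow> {?\<psi> u, ?\<psi> v} \<in> edges G"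
    if "u \<in> verts H" "v \<in> verts H" for u v
  proof -
    have "?\<psi> u \<in> verts G" "?\<psi> v \<in> verts G" "\<phi> (?\<psi> u) = u" "\<phi> (?\<psi> v) = v"
      using b that by (auto simp: bij_betw_def inv_into_into f_inv_into_f)
    then show ?thesis using e by metis
  qed
  ultimately show ?thesis unfolding graph_iso_def by blast
qed

lemma graph_iso_trans:
  assumes "graph_iso G H" "graph_iso H K" shows "graph_iso G K"
proof -
  obtain \<phi> where b: "bij_betw \<phi> (verts G) (verts H)"
    and e: "\<And>u v. u \<in> verts G \<Longrightarrow> v \<in> verts G \<Longrightarrow> {u, v} \<in> edges G \<longleftrightarrow> {\<phi> u, \<phi> v} \<in> edges H"
    using assms by (auto simp: graph_iso_def)
  obtain \<psi> where b': "bij_betw \<psi> (verts H) (verts K)"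
    and e': "\<And>u v. u \<in> verts H \<Longrightarrow> v \<in> verts H \<Longrightarrow> {u, v} \<in> edges H \<longleftrightarrow> {\<psi> u, \<psi> v} \<in> edges K"
    using assms by (auto simp: graph_iso_def)
  have "bij_betw (\<psi> \<circ> \<phi>) (verts G) (verts K)" using b b' by (rule bij_betw_trans)
  moreover have "{u, v} \<in> edges G \<longleftrightarrow> {(\<psi> \<circ> \<phi>) u, (\<psi> \<circ> \<phi>) v} \<in> edges K"
    if "u \<in> verts G" "v \<in> verts G" for u v
    using e[OF that] e'[of "\<phi> u" "\<phi> v"] that b by (auto simp: bij_betw_def)
  ultimately show ?thesis unfolding graph_iso_def by blast
qed

lemma inj_image_subset_Pow:
  assumes "inj_on \<phi> V" shows "inj_on ((`) \<phi>) (Pow V)"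
  using assms by (simp add: inj_on_image_Pow)

lemma graph_iso_relabel_self:
  assumes "inj_on \<phi> (verts G)" "edges G \<subseteq> Pow (verts G)"
  shows "graph_iso G (relabel \<phi> G)"
  unfolding graph_iso_def
proof (intro exI[of _ \<phi>] conjI ballI)
  show "bij_betw \<phi> (verts G) (verts (relabel \<phi> G))"
    using assms by (simp add: bij_betw_def)
  fix u v assume uv: "u \<in> verts G" "v \<in> verts G"
  have "\<phi> ` {u, v} \<in> (`) \<phi> ` edges G \<longleftrightarrow> {u, v} \<in> edges G"
    by (rule inj_on_image_mem_iff[OF inj_image_subset_Pow[OF assms(1)]]) (use assms(2) uv in auto)
  then show "{u, v} \<in> edges G \<longleftrightarrow> {\<phi> u, \<phi> v} \<in> edges (relabel \<phi> G)" by simp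
qed

lemma graph_iso_relabel:
  assumes "inj_on \<phi> (verts G)" "edges G \<subseteq> Pow (verts G)"
  shows "graph_iso (relabel \<phi> G) \<Gamma> \<longleftrightarrow> graph_iso G \<Gamma>"
  using graph_iso_trans[OF graph_iso_relabel_self[OF assms]]
    graph_iso_trans[OF graph_iso_sym[OF graph_iso_relabel_self[OF assms]]] by (rule iffI)

lemma simple_graphD:
  assumes "simple_graph G"
  shows "finite (verts G)" "edges G \<subseteq> Pow (verts G)" "finite (edges G)"
proof -
  show "finite (verts G)" "edges G \<subseteq> Pow (verts G)"
    using assms by (auto simp: simple_graph_def)
  then show "finite (edges G)" using finite_subset by blast
qed

lemma card2E:
  assumes "card e = 2" obtains u v where "e = {u, v}" "u \<noteq> v"
  using assms by (auto simp: card_2_iff)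

lemma graph_iso_card:
  assumes "graph_iso G H" "simple_graph G" "simple_graph H"
  shows "card (verts G) = card (verts H)" "card (edges G) = card (edges H)"
proof -
  obtain \<phi> where b: "bij_betw \<phi> (verts G) (verts H)"
    and e: "\<And>u v. u \<in> verts G \<Longrightarrow> v \<in> verts G \<Longrightarrow> {u, v} \<in> edges G \<longleftrightarrow> {\<phi> u, \<phi> v} \<in> edges H"
    using assms by (auto simp: graph_iso_def)
  show "card (verts G) = card (verts H)" using b by (rule bij_betw_same_card)
  have "(`) \<phi> ` edges G = edges H"
  proof (intro equalityI subsetI)
    fix a assume "a \<in> (`) \<phi> ` edges G"
    then obtain e' where e': "e' \<in> edges G" "a = \<phi> ` e'" by auto
    then obtain u v where "e' = {u, v}" "u \<in> verts G" "v \<in> verts G"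
      using assms(2) unfolding simple_graph_def by (metis card2E insert_subset)
    then show "a \<in> edges H" using e e' by auto
  next
    fix a assume a: "a \<in> edges H"
    then obtain u v where uv: "a = {u, v}" "u \<in> verts H" "v \<in> verts H"
      using assms(3) unfolding simple_graph_def by (metis card2E insert_subset)
    moreover have "\<phi> ` verts G = verts H" using b by (simp add: bij_betw_def)
    ultimately have "u \<in> \<phi> ` verts G" "v \<in> \<phi> ` verts G" by auto
    then obtain u' v' where uv': "u = \<phi> u'" "v = \<phi> v'" "u' \<in> verts G" "v' \<in> verts G"
      by blast
    have "{u', v'} \<in> edges G" using e[OF uv'(3,4)] uv(1) uv'(1,2) a by simp
    moreover have "a = \<phi> ` {u', v'}" using uv(1) uv'(1,2) by simp
    ultimately show "a \<in> (`) \<phi> ` edges G" by blast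
  qed
  moreover have "inj_on ((`) \<phi>) (edges G)"
    using inj_image_subset_Pow[of \<phi> "verts G"] b simple_graphD(2)[OF assms(2)]
    by (auto simp: bij_betw_def intro: inj_on_subset)
  ultimately show "card (edges G) = card (edges H)" by (metis card_image)
qed

lemma reachable_map:
  assumes "edges G \<subseteq> Pow (verts G)" "reachable G u v" "u \<in> verts G"
    and "\<And>a b. a \<in> verts G \<Longrightarrow> b \<in> verts G \<Longrightarrow> {a, b} \<in> edges G \<Longrightarrow> {\<phi> a, \<phi> b} \<in> edges H"
  shows "reachable H (\<phi> u) (\<phi> v)"
  using assms(2,3) unfolding reachable_def
proof (induction rule: rtrancl_induct)
  case (step y z)
  then have "{\<phi> y, \<phi> z} \<in> edges H" using assms(1,4) by auto
  then show ?case using step by (auto intro: rtrancl_into_rtrancl)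
qed simp

lemma reachable_graph_iso:
  assumes "edges G \<subseteq> Pow (verts G)" "edges H \<subseteq> Pow (verts H)"
    and b: "bij_betw \<phi> (verts G) (verts H)"
    and e: "\<And>u v. u \<in> verts G \<Longrightarrow> v \<in> verts G \<Longrightarrow> {u, v} \<in> edges G \<longleftrightarrow> {\<phi> u, \<phi> v} \<in> edges H"
    and uv: "u \<in> verts G" "v \<in> verts G"
  shows "reachable H (\<phi> u) (\<phi> v) \<longleftrightarrow> reachable G u v"
proof
  show "reachable H (\<phi> u) (\<phi> v)" if "reachable G u v"
    using reachable_map[OF assms(1) that uv(1), of \<phi> H] e by blast
  let ?\<psi> = "inv_into (verts G) \<phi>"
  have inv: "?\<psi> (\<phi> w) = w" if "w \<in> verts G" for w
    using that b by (auto simp: bij_betw_def)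
  assume r: "reachable H (\<phi> u) (\<phi> v)"
  have "reachable G (?\<psi> (\<phi> u)) (?\<psi> (\<phi> v))"
  proof (rule reachable_map[OF assms(2) r])
    show "\<phi> u \<in> verts H" using b uv by (auto simp: bij_betw_def)
    show "{?\<psi> x, ?\<psi> y} \<in> edges G" if "x \<in> verts H" "y \<in> verts H" "{x, y} \<in> edges H" for x y
    proof -
      have "?\<psi> x \<in> verts G" "?\<psi> y \<in> verts G" "\<phi> (?\<psi> x) = x" "\<phi> (?\<psi> y) = y"
        using b that by (auto simp: bij_betw_def inv_into_into f_inv_into_f)
      then show ?thesis using e that(3) by metis
    qed
  qed
  then show "reachable G u v" using inv uv by simp
qed

text \<open>Not immediate from the definition, because \<open>graph_iso\<close> compares only pairs of vertices: the edges have
to stay inside the vertex sets, so that paths do as well.\<close>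

lemma connected_graph_iso:
  assumes "graph_iso G H" "connected_graph H" "edges G \<subseteq> Pow (verts G)" "edges H \<subseteq> Pow (verts H)"
  shows "connected_graph G"
proof -
  obtain \<phi> where b: "bij_betw \<phi> (verts G) (verts H)"
    and e: "\<And>u v. u \<in> verts G \<Longrightarrow> v \<in> verts G \<Longrightarrow> {u, v} \<in> edges G \<longleftrightarrow> {\<phi> u, \<phi> v} \<in> edges H"
    using assms by (auto simp: graph_iso_def)
  have "reachable G u v" if "u \<in> verts G" "v \<in> verts G" for u v
    using reachable_graph_iso[OF assms(3,4) b e that] that b assms(2)
    by (auto simp: connected_graph_def bij_betw_def)
  moreover have "verts G \<noteq> {}" using b assms(2) by (auto simp: connected_graph_def bij_betw_def)
  ultimately show ?thesis by (auto simp: connected_graph_def)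
qed

lemma component_sets_relabel:
  assumes "inj_on \<phi> (verts G)" "edges G \<subseteq> Pow (verts G)"
  shows "component_sets (relabel \<phi> G) = (`) \<phi> ` component_sets G"
proof -
  have e: "edges (relabel \<phi> G) \<subseteq> Pow (verts (relabel \<phi> G))"
    using assms(2) by auto
  have b: "bij_betw \<phi> (verts G) (verts (relabel \<phi> G))" using assms by (simp add: bij_betw_def)
  have pres: "{u, v} \<in> edges G \<longleftrightarrow> {\<phi> u, \<phi> v} \<in> edges (relabel \<phi> G)"
    if "u \<in> verts G" "v \<in> verts G" for u v
  proof -
    have "\<phi> ` {u, v} \<in> (`) \<phi> ` edges G \<longleftrightarrow> {u, v} \<in> edges G"
      by (rule inj_on_image_mem_iff[OF inj_image_subset_Pow[OF assms(1)]]) (use assms(2) that in auto)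
    then show ?thesis by simp
  qed
  have "{v \<in> \<phi> ` verts G. reachable (relabel \<phi> G) (\<phi> u) v} = \<phi> ` {v \<in> verts G. reachable G u v}"
    if "u \<in> verts G" for u
    using reachable_graph_iso[OF assms(2) e b pres that] by auto
  then show ?thesis unfolding component_sets_def by (auto simp: image_image intro!: image_cong)
qed

lemma induced_subgraph_relabel:
  assumes "inj_on \<phi> (verts G)" "edges G \<subseteq> Pow (verts G)" "C \<subseteq> verts G"
  shows "induced_subgraph (relabel \<phi> G) (\<phi> ` C) = relabel \<phi> (induced_subgraph G C)"
proof -
  have "\<phi> ` e \<subseteq> \<phi> ` C \<longleftrightarrow> e \<subseteq> C" if "e \<in> edges G" for e
    using that assms by (meson inj_on_image_subset_iff Pow_iff subsetD)
  then show ?thesis by (auto simp: induced_subgraph_def relabel_def)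
qed

definition leftmost_in :: "'d \<Rightarrow> (real^'d) set \<Rightarrow> ('i \<Rightarrow> real^'d) \<Rightarrow> 'i set \<Rightarrow> bool" where
  "leftmost_in i1 A x C \<longleftrightarrow> (\<exists>i\<in>C. (\<forall>j\<in>C. x i $ i1 \<le> x j $ i1) \<and> x i \<in> A)"

lemma component_sets_subset:
  "C \<in> component_sets G \<Longrightarrow> C \<subseteq> verts G"
  by (auto simp: component_sets_def)

text \<open>Graphs on points are images of graphs on indices. Components, isomorphism types and left-most points
can all be read off on the index side.\<close>

lemma component_count_relabel:
  fixes x :: "'i \<Rightarrow> real^'d"
  assumes "inj_on x (verts G)" "edges G \<subseteq> Pow (verts G)"
  shows "component_count i1 A \<Gamma> (relabel x G) =
    card {C \<in> component_sets G. graph_iso (induced_subgraph G C) \<Gamma> \<and> leftmost_in i1 A x C}"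
proof -
  let ?P = "\<lambda>C. graph_iso (induced_subgraph G C) \<Gamma> \<and> leftmost_in i1 A x C"
  let ?Q = "\<lambda>C. graph_iso (induced_subgraph (relabel x G) C) \<Gamma> \<and>
       (\<exists>x\<in>C. (\<forall>y\<in>C. x $ i1 \<le> y $ i1) \<and> x \<in> A)"
  have "?Q (x ` C) \<longleftrightarrow> ?P C" if "C \<in> component_sets G" for C
  proof -
    have C: "C \<subseteq> verts G" using that by (rule component_sets_subset)
    have "graph_iso (induced_subgraph (relabel x G) (x ` C)) \<Gamma> \<longleftrightarrow> graph_iso (induced_subgraph G C) \<Gamma>"
      unfolding induced_subgraph_relabel[OF assms C]
      by (rule graph_iso_relabel) (use C assms in \<open>auto simp: induced_subgraph_def intro: inj_on_subset\<close>)
    then show ?thesis by (simp add: leftmost_in_def)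
  qed
  then have "{C \<in> (`) x ` component_sets G. ?Q C} = (`) x ` {C \<in> component_sets G. ?P C}"
    by blast
  then have eq: "{C \<in> component_sets (relabel x G). ?Q C} = (`) x ` {C \<in> component_sets G. ?P C}"
    unfolding component_sets_relabel[OF assms] .
  have "inj_on ((`) x) {C \<in> component_sets G. ?P C}"
    by (rule inj_on_subset[OF inj_image_subset_Pow[OF assms(1)]]) (auto dest: component_sets_subset)
  then have "card ((`) x ` {C \<in> component_sets G. ?P C}) = card {C \<in> component_sets G. ?P C}"
    by (rule card_image)
  then show ?thesis unfolding component_count_def eq .
qed

text \<open>Being a component is a global condition on paths. For a set that is already connected it reduces to
the absence of single edges leaving the set, which are independent events.\<close>

lemma component_sets_iff_no_boundary_edge:
  assumes G: "\<And>e. e \<in> edges G \<Longrightarrow> e \<subseteq> verts G \<and> card e = 2"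
    and C: "C \<subseteq> verts G" and conn: "connected_graph (induced_subgraph G C)"
  shows "C \<in> component_sets G \<longleftrightarrow> (\<forall>e\<in>edges G. e \<inter> C \<noteq> {} \<longrightarrow> e \<subseteq> C)"
proof
  assume "C \<in> component_sets G"
  then obtain u where u: "u \<in> verts G" "C = {v \<in> verts G. reachable G u v}"
    by (auto simp: component_sets_def)
  show "\<forall>e\<in>edges G. e \<inter> C \<noteq> {} \<longrightarrow> e \<subseteq> C"
  proof (intro ballI impI)
    fix e assume e: "e \<in> edges G" "e \<inter> C \<noteq> {}"
    obtain a b where ab: "e = {a, b}" using G[OF e(1)] by (metis card2E)
    have "reachable G a b" "reachable G b a"
      using e ab by (auto simp: reachable_def insert_commute intro!: r_into_rtrancl)
    moreover have "reachable G u a \<or> reachable G u b" using e(2) ab u by auto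
    ultimately have "reachable G u a" "reachable G u b"
      unfolding reachable_def by (auto intro: rtrancl_trans)
    then show "e \<subseteq> C" using G[OF e(1)] ab u by auto
  qed
next
  assume closed: "\<forall>e\<in>edges G. e \<inter> C \<noteq> {} \<longrightarrow> e \<subseteq> C"
  obtain u where u: "u \<in> C" using conn by (auto simp: connected_graph_def induced_subgraph_def)
  have "reachable G u v" if "v \<in> C" for v
  proof -
    have "reachable (induced_subgraph G C) u v"
      using conn u that by (auto simp: connected_graph_def induced_subgraph_def)
    then show ?thesis unfolding reachable_def
      by (rule rtrancl_mono[THEN subsetD, rotated]) (auto simp: induced_subgraph_def)
  qed
  moreover have "v \<in> C" if "reachable G u v" for v
    using that unfolding reachable_def
    by (induction rule: rtrancl_induct) (use u closed in auto)
  ultimately have "C = {v \<in> verts G. reachable G u v}" using C by auto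
  then show "C \<in> component_sets G" using u C by (auto simp: component_sets_def)
qed

lemma copies_relabel:
  assumes "inj_on \<phi> (verts G)" "edges G \<subseteq> Pow (verts G)"
  shows "copies \<Gamma> (relabel \<phi> G) = copies \<Gamma> G"
proof -
  have inj: "inj_on ((`) ((`) \<phi>)) (Pow (edges G))"
    by (intro inj_image_subset_Pow inj_on_subset[OF inj_image_subset_Pow[OF assms(1)] assms(2)])
  have iso: "graph_iso (\<phi> ` verts G, (`) \<phi> ` E) \<Gamma> \<longleftrightarrow> graph_iso (verts G, E) \<Gamma>"
    if "E \<subseteq> edges G" for E
    using graph_iso_relabel[of \<phi> "(verts G, E)" \<Gamma>] assms that by (auto simp: relabel_def)
  have eq: "{E. E \<subseteq> edges (relabel \<phi> G) \<and> graph_iso (verts (relabel \<phi> G), E) \<Gamma>} =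
      (`) ((`) \<phi>) ` {E. E \<subseteq> edges G \<and> graph_iso (verts G, E) \<Gamma>}"
    using iso by (auto simp: subset_image_iff)
  have "inj_on ((`) ((`) \<phi>)) {E. E \<subseteq> edges G \<and> graph_iso (verts G, E) \<Gamma>}"
    using inj by (rule inj_on_subset) auto
  then show ?thesis unfolding copies_def eq by (rule card_image)
qed

lemma weight_relabel:
  assumes "inj_on \<phi> (verts G)" "edges G \<subseteq> Pow (verts G)"
  shows "weight \<Gamma> q (relabel \<phi> G) = weight \<Gamma> q G"
proof -
  have "inj_on ((`) \<phi>) (edges G)"
    using inj_image_subset_Pow[OF assms(1)] assms(2) by (rule inj_on_subset)
  then have "card (edges (relabel \<phi> G)) = card (edges G)" unfolding edges_relabel by (rule card_image)
  then show ?thesis unfolding weight_def copies_relabel[OF assms] by simp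
qed

lemma copies_le: "finite (edges G) \<Longrightarrow> copies \<Gamma> G \<le> 2 ^ card (edges G)"
  using card_mono[of "Pow (edges G)" "{E. E \<subseteq> edges G \<and> graph_iso (verts G, E) \<Gamma>}"]
  by (auto simp: copies_def card_Pow)

lemma copies_ge_1:
  assumes "finite (edges G)" "E \<subseteq> edges G" "graph_iso (verts G, E) \<Gamma>"
  shows "1 \<le> copies \<Gamma> G"
proof -
  have "card {E} \<le> copies \<Gamma> G"
    unfolding copies_def by (rule card_mono) (use assms in auto)
  then show ?thesis by simp
qed

lemma weight_nonneg: "q \<le> 1 \<Longrightarrow> 0 \<le> weight \<Gamma> q G"
  by (simp add: weight_def)

lemma weight_le:
  assumes "0 \<le> q" "q \<le> 1" "finite (edges G)"
  shows "weight \<Gamma> q G \<le> 2 ^ card (edges G)"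
proof -
  have "real (copies \<Gamma> G) \<le> 2 ^ card (edges G)"
    using copies_le[OF assms(3)] by (metis of_nat_le_iff of_nat_numeral of_nat_power)
  moreover have "(1 - q) ^ (card (edges G) - card (edges \<Gamma>)) \<le> 1"
    using assms by (intro power_le_one) auto
  ultimately show ?thesis unfolding weight_def
    using mult_mono[of "real (copies \<Gamma> G)" "2 ^ card (edges G)"
      "(1 - q) ^ (card (edges G) - card (edges \<Gamma>))" 1] assms by auto
qed

lemma weight_iso:
  assumes G: "simple_graph G" "simple_graph \<Gamma>" "graph_iso G \<Gamma>" and q: "0 \<le> q" "q \<le> 1"
  shows "1 \<le> weight \<Gamma> q G"
proof -
  have "copies \<Gamma> G \<ge> 1"
    by (rule copies_ge_1[where E = "edges G"]) (use G simple_graphD(3)[OF G(1)] in auto)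
  then show ?thesis using graph_iso_card(2)[OF G(3,1,2)] by (simp add: weight_def)
qed

text \<open>A strict containment provides one copy of \<open>\<Gamma>\<close> on the same number of vertices, hence on all of them,
and the number of superfluous edges is largest when \<open>G\<close> is complete.\<close>

lemma weight_strictly_contains:
  assumes G: "simple_graph G" "simple_graph \<Gamma>" and S: "strictly_contains G \<Gamma>"
    and k: "card (verts G) = card (verts \<Gamma>)" and q: "0 \<le> q" "q \<le> 1"
  shows "(1 - q) ^ ((card (verts \<Gamma>) choose 2) - card (edges \<Gamma>)) \<le> weight \<Gamma> q G"
proof -
  obtain H where H: "subgraph H G" "graph_iso H \<Gamma>" using S by (auto simp: strictly_contains_def)
  have "simple_graph H" using H by (simp add: subgraph_def)
  then have "card (verts H) = card (verts G)" using graph_iso_card(1)[OF H(2)] G k by simp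
  then have "verts H = verts G"
    by (intro card_subset_eq) (use H(1) simple_graphD(1)[OF G(1)] in \<open>auto simp: subgraph_def\<close>)
  then have "graph_iso (verts G, edges H) \<Gamma>" using H(2) by (metis prod.collapse)
  then have c: "copies \<Gamma> G \<ge> 1"
    by (rule copies_ge_1[rotated 2]) (use H simple_graphD(3)[OF G(1)] in \<open>auto simp: subgraph_def\<close>)
  have "edges G \<subseteq> {e. e \<subseteq> verts G \<and> card e = 2}" using G(1) by (auto simp: simple_graph_def)
  moreover have "finite {e. e \<subseteq> verts G \<and> card e = 2}" using simple_graphD(1)[OF G(1)] by simp
  ultimately have "card (edges G) \<le> card {e. e \<subseteq> verts G \<and> card e = 2}" by (intro card_mono)
  then have "card (edges G) \<le> card (verts G) choose 2"
    using n_subsets[OF simple_graphD(1)[OF G(1)], of 2] by simp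
  then have "(1 - q) ^ ((card (verts \<Gamma>) choose 2) - card (edges \<Gamma>))
      \<le> (1 - q) ^ (card (edges G) - card (edges \<Gamma>))"
    using q k by (intro power_decreasing) auto
  also have "\<dots> \<le> real (copies \<Gamma> G) * (1 - q) ^ (card (edges G) - card (edges \<Gamma>))"
    using c q mult_right_mono[of 1 "real (copies \<Gamma> G)" "(1 - q) ^ (card (edges G) - card (edges \<Gamma>))"]
    by simp
  finally show ?thesis by (simp add: weight_def)
qed

section \<open>Geometric graphs on indices\<close>

text \<open>The edges of the geometric graph, read on indices. Independence and measurability are statements about
indices, and the set is well behaved also where points coincide.\<close>

definition close_pairs :: "real \<Rightarrow> ('i \<Rightarrow> real^'d) \<Rightarrow> 'i set \<Rightarrow> 'i set set" where
  "close_pairs r x S = {{i, j} | i j. i \<in> S \<and> j \<in> S \<and> i \<noteq> j \<and> dist (x i) (x j) \<le> r}"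

definition cross_pairs :: "real \<Rightarrow> ('i \<Rightarrow> real^'d) \<Rightarrow> 'i set \<Rightarrow> 'i set \<Rightarrow> 'i set set" where
  "cross_pairs r x S V = {{i, j} | i j. i \<in> S \<and> j \<in> V - S \<and> dist (x i) (x j) \<le> r}"

definition near :: "real \<Rightarrow> ('i \<Rightarrow> real^'d) \<Rightarrow> 'i set \<Rightarrow> real^'d \<Rightarrow> nat" where
  "near r x S y = card {i \<in> S. dist (x i) y \<le> r}"

lemma doubleton_mem_close_pairs:
  "{i, j} \<in> close_pairs r x S \<longleftrightarrow> i \<in> S \<and> j \<in> S \<and> i \<noteq> j \<and> dist (x i) (x j) \<le> r"
  unfolding close_pairs_def by (auto simp: doubleton_eq_iff dist_commute)

lemma close_pairsE:
  assumes "e \<in> close_pairs r x S"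
  obtains i j where "e = {i, j}" "i \<in> S" "j \<in> S" "i \<noteq> j" "dist (x i) (x j) \<le> r"
  using assms unfolding close_pairs_def by blast

lemma close_pairs_subset: "close_pairs r x S \<subseteq> Pow S"
  and card_close_pairs: "e \<in> close_pairs r x S \<Longrightarrow> card e = 2"
  by (auto simp: close_pairs_def)

lemma finite_close_pairs: "finite S \<Longrightarrow> finite (close_pairs r x S)"
  using close_pairs_subset by (rule finite_subset) simp

lemma simple_graph_close_pairs: "finite S \<Longrightarrow> simple_graph (S, close_pairs r x S)"
  using close_pairs_subset[of r x S] card_close_pairs[of _ r x S] by (auto simp: simple_graph_def)

lemma doubleton_mem_cross_pairs:
  assumes "i \<in> S" "j \<in> V - S"
  shows "{i, j} \<in> cross_pairs r x S V \<longleftrightarrow> dist (x i) (x j) \<le> r"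
  using assms unfolding cross_pairs_def by (auto simp: doubleton_eq_iff dist_commute)

lemma cross_pairs_subset: "S \<subseteq> V \<Longrightarrow> cross_pairs r x S V \<subseteq> Pow V"
  by (auto simp: cross_pairs_def)

lemma card_cross_pairs_elem: "e \<in> cross_pairs r x S V \<Longrightarrow> card e = 2"
  by (auto simp: cross_pairs_def card_2_iff)

lemma close_cross_disjoint: "close_pairs r x S \<inter> cross_pairs r x S V = {}"
  by (auto simp: close_pairs_def cross_pairs_def doubleton_eq_iff)

text \<open>Grouping the edges that leave \<open>S\<close> by their outer end point makes \<open>(1 - p) ^ card\<close> of this set a product
over the points outside \<open>S\<close>, with one factor for each of them.\<close>

lemma card_cross_pairs:
  assumes "finite S" "finite V"
  shows "card (cross_pairs r x S V) = (\<Sum>j\<in>V - S. near r x S (x j))"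
proof -
  have "cross_pairs r x S V = (\<lambda>(j, i). {i, j}) ` (SIGMA j:V - S. {i \<in> S. dist (x i) (x j) \<le> r})"
    by (force simp: cross_pairs_def)
  moreover have "inj_on (\<lambda>(j, i). {i, j}) (SIGMA j:V - S. {i \<in> S. dist (x i) (x j) \<le> r})"
    by (auto simp: inj_on_def doubleton_eq_iff)
  ultimately have "card (cross_pairs r x S V) = card (SIGMA j:V - S. {i \<in> S. dist (x i) (x j) \<le> r})"
    by (simp add: card_image)
  also have "\<dots> = (\<Sum>j\<in>V - S. near r x S (x j))"
    unfolding near_def by (rule card_SigmaI) (use assms in auto)
  finally show ?thesis .
qed

lemma close_pairs_cong: "(\<And>i. i \<in> S \<Longrightarrow> x i = y i) \<Longrightarrow> close_pairs r x S = close_pairs r y S"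
  unfolding close_pairs_def by (intro Collect_cong) metis

lemma near_cong: "(\<And>i. i \<in> S \<Longrightarrow> x i = y i) \<Longrightarrow> near r x S = near r y S"
  unfolding near_def by (intro ext arg_cong[of _ _ card]) auto

lemma leftmost_in_cong:
  "(\<And>i. i \<in> S \<Longrightarrow> x i = y i) \<Longrightarrow> leftmost_in i1 A x S = leftmost_in i1 A y S"
  unfolding leftmost_in_def by auto

text \<open>One representative for each class of coinciding points. Coincidences have probability 0, but the
component count has to be measurable as a function on the whole sample space.\<close>

definition first_index :: "nat \<Rightarrow> (nat \<Rightarrow> 'a) \<Rightarrow> nat set" where
  "first_index n x = {i \<in> {1..n}. \<forall>j\<in>{1..n}. x j = x i \<longrightarrow> i \<le> j}"

text \<open>An edge between two points is present as soon as one pair of indices with these positions is marked,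
hence the quantification over all such pairs.\<close>

definition kept_pairs ::
    "nat \<Rightarrow> (nat \<Rightarrow> real^'d) \<Rightarrow> (nat set \<Rightarrow> bool) \<Rightarrow> real \<Rightarrow> nat set set" where
  "kept_pairs n x keep r =
     {e \<in> close_pairs r x (first_index n x).
        \<exists>i\<in>{1..n}. \<exists>j\<in>{1..n}. i \<noteq> j \<and> x ` e = {x i, x j} \<and> keep {i, j}}"

lemma first_index_inj: "inj_on x (first_index n x)"
proof (rule inj_onI)
  fix i j assume ij: "i \<in> first_index n x" "j \<in> first_index n x" and eq: "x i = x j"
  have le: "i' \<le> j'" if "i' \<in> first_index n x" "j' \<in> first_index n x" "x j' = x i'" for i' j'
    using that unfolding first_index_def by simp
  have "i \<le> j" using le[OF ij(1) ij(2) eq[symmetric]] .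
  moreover have "j \<le> i" using le[OF ij(2) ij(1) eq] .
  ultimately show "i = j" by simp
qed

lemma first_index_exists:
  assumes "i \<in> {1..n}" obtains j where "j \<in> first_index n x" "x j = x i"
proof -
  let ?P = "\<lambda>j. j \<in> {1..n} \<and> x j = x i"
  have "?P (LEAST j. ?P j)" by (rule LeastI[of ?P i]) (use assms in auto)
  moreover have "(LEAST j. ?P j) \<le> j" if "?P j" for j using that by (rule Least_le)
  ultimately have "(LEAST j. ?P j) \<in> first_index n x" by (auto simp: first_index_def)
  then show ?thesis using \<open>?P (LEAST j. ?P j)\<close> that by blast
qed

lemma doubleton_mem_geometric:
  "{a, b} \<in> edges (geometric_graph Y r) \<longleftrightarrow> a \<in> Y \<and> b \<in> Y \<and> a \<noteq> b \<and> dist a b \<le> r"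
  unfolding geometric_graph_def by (auto simp: doubleton_eq_iff dist_commute)

lemma percolated_graph_eq_relabel:
  "percolated_graph n x keep r = relabel x (first_index n x, kept_pairs n x keep r)"
proof -
  let ?T = "first_index n x"
  have V: "x ` {1..n} = x ` ?T"
  proof
    show "x ` {1..n} \<subseteq> x ` ?T"
    proof
      fix y assume "y \<in> x ` {1..n}"
      then obtain i where i: "i \<in> {1..n}" "y = x i" by auto
      obtain j where "j \<in> ?T" "x j = x i" using i(1) by (rule first_index_exists)
      then show "y \<in> x ` ?T" using i(2) by (metis imageI)
    qed
  qed (auto simp: first_index_def)
  have "edges (percolated_graph n x keep r) = (`) x ` kept_pairs n x keep r"
  proof (intro equalityI subsetI)
    fix e assume "e \<in> edges (percolated_graph n x keep r)"
    then obtain i j where ij: "e = {x i, x j}" "i \<in> {1..n}" "j \<in> {1..n}" "keep {i, j}"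
        "x i \<noteq> x j" "dist (x i) (x j) \<le> r"
      by (auto simp: percolated_graph_def doubleton_mem_geometric)
    obtain i' where i': "i' \<in> ?T" "x i' = x i" using ij(2) by (rule first_index_exists)
    obtain j' where j': "j' \<in> ?T" "x j' = x j" using ij(3) by (rule first_index_exists)
    note ij' = i' j'
    have "i \<noteq> j \<and> x ` {i', j'} = {x i, x j} \<and> keep {i, j}" using ij ij' by auto
    then have "\<exists>a\<in>{1..n}. \<exists>b\<in>{1..n}. a \<noteq> b \<and> x ` {i', j'} = {x a, x b} \<and> keep {a, b}"
      using ij(2,3) by blast
    moreover have "{i', j'} \<in> close_pairs r x ?T"
      using ij ij' by (auto simp: doubleton_mem_close_pairs)
    ultimately have "{i', j'} \<in> kept_pairs n x keep r" unfolding kept_pairs_def by blast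
    moreover have "e = x ` {i', j'}" using ij' ij by simp
    ultimately show "e \<in> (`) x ` kept_pairs n x keep r" by blast
  next
    fix e assume "e \<in> (`) x ` kept_pairs n x keep r"
    then obtain e' where e': "e' \<in> kept_pairs n x keep r" "e = x ` e'" by auto
    then obtain i j where ij: "e' = {i, j}" "i \<in> ?T" "j \<in> ?T" "i \<noteq> j" "dist (x i) (x j) \<le> r"
      by (auto simp: kept_pairs_def elim: close_pairsE)
    obtain i' j' where ij': "i' \<in> {1..n}" "j' \<in> {1..n}" "x ` e' = {x i', x j'}" "keep {i', j'}"
      using e' by (auto simp: kept_pairs_def)
    have "x i \<noteq> x j" using first_index_inj ij by (metis inj_onD)
    moreover have "{x i, x j} = {x i', x j'}" using ij' ij by simp
    ultimately have "x i' \<noteq> x j'" "dist (x i') (x j') \<le> r"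
      using ij by (auto simp: doubleton_eq_iff dist_commute)
    then have "{x i', x j'} \<in> edges (geometric_graph (x ` {1..n}) r)"
      using ij' by (simp add: doubleton_mem_geometric)
    moreover have "e = {x i', x j'}" using e' ij' by simp
    ultimately show "e \<in> edges (percolated_graph n x keep r)"
      using ij' unfolding percolated_graph_def snd_conv mem_Collect_eq by blast
  qed
  moreover have "verts (percolated_graph n x keep r) = x ` ?T"
    unfolding V[symmetric] by (simp add: percolated_graph_def)
  ultimately show ?thesis by (intro prod_eqI) simp_all
qed

lemma kept_pairs_subset: "kept_pairs n x keep r \<subseteq> Pow (first_index n x)"
  using close_pairs_subset[of r x "first_index n x"] unfolding kept_pairs_def by blast

lemma component_count_percolated:
  "component_count i1 A \<Gamma> (percolated_graph n x keep r) =
    card {C \<in> component_sets (first_index n x, kept_pairs n x keep r).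
      graph_iso (induced_subgraph (first_index n x, kept_pairs n x keep r) C) \<Gamma> \<and> leftmost_in i1 A x C}"
  unfolding percolated_graph_eq_relabel
  by (rule component_count_relabel) (simp_all add: first_index_inj kept_pairs_subset)

lemma kept_pairs_inj:
  assumes "inj_on x {1..n}"
  shows "first_index n x = {1..n}" "kept_pairs n x keep r = {e \<in> close_pairs r x {1..n}. keep e}"
proof -
  show *: "first_index n x = {1..n}"
  proof -
    have "i \<le> j" if "i \<in> {1..n}" "j \<in> {1..n}" "x j = x i" for i j
      using inj_onD[OF assms that(3) that(2) that(1)] by simp
    then show ?thesis unfolding first_index_def by blast
  qed
  have "(\<exists>i\<in>{1..n}. \<exists>j\<in>{1..n}. i \<noteq> j \<and> x ` e = {x i, x j} \<and> keep {i, j}) \<longleftrightarrow> keep e"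
    if e: "e \<in> close_pairs r x {1..n}" for e
  proof -
    obtain i j where ij: "e = {i, j}" "i \<in> {1..n}" "j \<in> {1..n}" "i \<noteq> j"
      using e by (rule close_pairsE)
    show ?thesis
    proof
      assume "\<exists>i\<in>{1..n}. \<exists>j\<in>{1..n}. i \<noteq> j \<and> x ` e = {x i, x j} \<and> keep {i, j}"
      then obtain i' j' where ij': "i' \<in> {1..n}" "j' \<in> {1..n}" "x ` e = {x i', x j'}" "keep {i', j'}"
        by (elim bexE conjE)
      then have "x ` e = x ` {i', j'}" "e \<subseteq> {1..n}" "{i', j'} \<subseteq> {1..n}"
        using ij(1-3) by (simp_all only: image_insert image_empty insert_subset empty_subsetI simp_thms)
      then have "e = {i', j'}" using inj_on_image_eq_iff[OF assms] by blast
      then show "keep e" using ij' by simp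
    next
      assume "keep e"
      then have "i \<noteq> j \<and> x ` e = {x i, x j} \<and> keep {i, j}" using ij by simp
      then show "\<exists>i\<in>{1..n}. \<exists>j\<in>{1..n}. i \<noteq> j \<and> x ` e = {x i, x j} \<and> keep {i, j}"
        using ij(2,3) by (intro bexI)
    qed
  qed
  then show "kept_pairs n x keep r = {e \<in> close_pairs r x {1..n}. keep e}"
    unfolding kept_pairs_def * by blast
qed

section \<open>The component count as a sum over index sets\<close>

text \<open>The condition for \<open>S\<close> to be a component isomorphic to \<open>\<Gamma>\<close>, in a form that involves disjoint
sets of marks: those of the close pairs inside \<open>S\<close> and those of the close pairs leaving \<open>S\<close>.\<close>

definition isolated_copy ::
    "'v graph \<Rightarrow> real \<Rightarrow> nat \<Rightarrow> (nat \<Rightarrow> real^'d) \<Rightarrow> (nat set \<Rightarrow> bool) \<Rightarrow> nat set \<Rightarrow> bool" where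
  "isolated_copy \<Gamma> r n x keep S \<longleftrightarrow>
     graph_iso (S, {e \<in> close_pairs r x S. keep e}) \<Gamma> \<and> (\<forall>e\<in>cross_pairs r x S {1..n}. \<not> keep e)"

lemma component_count_eq_isolated_copies:
  assumes \<Gamma>: "simple_graph \<Gamma>" "connected_graph \<Gamma>" and inj: "inj_on x {1..n}"
  shows "component_count i1 A \<Gamma> (percolated_graph n x keep r) =
    card {S. S \<subseteq> {1..n} \<and> isolated_copy \<Gamma> r n x keep S \<and> leftmost_in i1 A x S}"
proof -
  let ?G = "({1..n}, {e \<in> close_pairs r x {1..n}. keep e})"
  have wf: "e \<subseteq> verts ?G \<and> card e = 2" if "e \<in> edges ?G" for e
    using that close_pairs_subset card_close_pairs by fastforce
  have "S \<in> component_sets ?G \<and> graph_iso (induced_subgraph ?G S) \<Gamma> \<longleftrightarrow>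
      S \<subseteq> {1..n} \<and> isolated_copy \<Gamma> r n x keep S" for S
  proof (cases "S \<subseteq> {1..n}")
    case True
    have ind: "induced_subgraph ?G S = (S, {e \<in> close_pairs r x S. keep e})"
    proof -
      have "e \<in> close_pairs r x {1..n} \<and> e \<subseteq> S \<longleftrightarrow> e \<in> close_pairs r x S" for e
        using True unfolding close_pairs_def by blast
      then show ?thesis unfolding induced_subgraph_def by auto
    qed
    show ?thesis
    proof (cases "graph_iso (S, {e \<in> close_pairs r x S. keep e}) \<Gamma>")
      case iso: True
      have conn: "connected_graph (induced_subgraph ?G S)"
        unfolding ind by (rule connected_graph_iso[OF iso \<Gamma>(2)])
          (use close_pairs_subset[of r x S] simple_graphD(2)[OF \<Gamma>(1)] in auto)
      have "S \<in> component_sets ?G \<longleftrightarrow> (\<forall>e\<in>edges ?G. e \<inter> S \<noteq> {} \<longrightarrow> e \<subseteq> S)"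
        by (rule component_sets_iff_no_boundary_edge[OF wf _ conn]) (use True in auto)
      also have "\<dots> \<longleftrightarrow> (\<forall>e\<in>cross_pairs r x S {1..n}. \<not> keep e)"
      proof
        assume L: "\<forall>e\<in>edges ?G. e \<inter> S \<noteq> {} \<longrightarrow> e \<subseteq> S"
        show "\<forall>e\<in>cross_pairs r x S {1..n}. \<not> keep e"
        proof (intro ballI notI)
          fix e assume e: "e \<in> cross_pairs r x S {1..n}" "keep e"
          then obtain i j where ij: "e = {i, j}" "i \<in> S" "j \<in> {1..n}" "j \<notin> S" "dist (x i) (x j) \<le> r"
            by (auto simp: cross_pairs_def)
          moreover have "i \<noteq> j" "i \<in> {1..n}" using ij True by auto
          ultimately have "e \<in> edges ?G" using e by (simp add: doubleton_mem_close_pairs)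
          then show False using L ij by auto
        qed
      next
        assume R: "\<forall>e\<in>cross_pairs r x S {1..n}. \<not> keep e"
        show "\<forall>e\<in>edges ?G. e \<inter> S \<noteq> {} \<longrightarrow> e \<subseteq> S"
        proof (intro ballI impI, rule ccontr)
          fix e assume e: "e \<in> edges ?G" "e \<inter> S \<noteq> {}" "\<not> e \<subseteq> S"
          have "e \<in> close_pairs r x {1..n}" using e by simp
          then obtain i j where ij: "e = {i, j}" "i \<in> {1..n}" "j \<in> {1..n}" "dist (x i) (x j) \<le> r"
            by (rule close_pairsE)
          then have "{i, j} \<in> cross_pairs r x S {1..n}"
          proof (cases "i \<in> S")
            case True
            then show ?thesis using ij e by (subst doubleton_mem_cross_pairs) auto
          next
            case False
            then have "{j, i} \<in> cross_pairs r x S {1..n}"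
              using ij e by (subst doubleton_mem_cross_pairs) (auto simp: dist_commute)
            then show ?thesis by (simp add: insert_commute)
          qed
          then have "e \<in> cross_pairs r x S {1..n}" using ij by simp
          then show False using R e by simp
        qed
      qed
      finally show ?thesis using True iso unfolding ind isolated_copy_def by simp
    next
      case False
      then show ?thesis unfolding ind isolated_copy_def by blast
    qed
  next
    case False
    then show ?thesis using component_sets_subset[of S ?G] by auto
  qed
  then have eq: "{C \<in> component_sets ?G. graph_iso (induced_subgraph ?G C) \<Gamma> \<and> leftmost_in i1 A x C} =
     {S. S \<subseteq> {1..n} \<and> isolated_copy \<Gamma> r n x keep S \<and> leftmost_in i1 A x S}"
    by (intro Collect_cong) blast
  show ?thesis unfolding component_count_percolated kept_pairs_inj[OF inj] eq by (rule refl)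
qed

section \<open>Measurability of the component count\<close>

text \<open>A random subset of a finite set takes finitely many values, so measurability may be tested elementwise.
This turns measurability of graph-theoretic conditions into that of single edges.\<close>

lemma measurable_finite_set_valued:
  assumes "finite U" and "\<And>u. u \<in> U \<Longrightarrow> Measurable.pred M (\<lambda>\<omega>. u \<in> g \<omega>)"
    and "\<And>\<omega>. \<omega> \<in> space M \<Longrightarrow> g \<omega> \<subseteq> U"
  shows "g \<in> measurable M (count_space (Pow U))"
proof -
  have "g -` {a} \<inter> space M \<in> sets M" if "a \<in> Pow U" for a
  proof -
    have "Measurable.pred M (\<lambda>\<omega>. \<forall>u\<in>U. u \<in> g \<omega> \<longleftrightarrow> u \<in> a)"
      using assms(1,2) by (intro pred_intros_finite) (auto intro!: pred_intros_logic)
    moreover have "g -` {a} \<inter> space M = {\<omega> \<in> space M. \<forall>u\<in>U. u \<in> g \<omega> \<longleftrightarrow> u \<in> a}"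
      using assms(3) that by fastforce
    ultimately show ?thesis by (simp add: pred_def)
  qed
  moreover have "countable (Pow U)" using assms(1) by (simp add: countable_finite)
  ultimately show ?thesis
    using assms(3) by (subst measurable_count_space_eq_countable) auto
qed

lemma pred_finite_set_valued2:
  assumes U: "finite U" "\<And>u. u \<in> U \<Longrightarrow> Measurable.pred M (\<lambda>\<omega>. u \<in> g \<omega>)"
      "\<And>\<omega>. \<omega> \<in> space M \<Longrightarrow> g \<omega> \<subseteq> U"
    and V: "finite V" "\<And>u. u \<in> V \<Longrightarrow> Measurable.pred M (\<lambda>\<omega>. u \<in> h \<omega>)"
      "\<And>\<omega>. \<omega> \<in> space M \<Longrightarrow> h \<omega> \<subseteq> V"
  shows "(\<lambda>\<omega>. Q (g \<omega>) (h \<omega>)) \<in> measurable M (count_space UNIV)"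
proof (rule measurable_compose_countable'[OF _ measurable_finite_set_valued[OF U]])
  show "countable (Pow U)" using U(1) by (simp add: countable_finite)
  show "(\<lambda>\<omega>. Q i (h \<omega>)) \<in> measurable M (count_space UNIV)" for i
    by (rule measurable_compose[OF measurable_finite_set_valued[OF V]]) auto
qed

lemma pred_finite_bex:
  assumes "finite I" "\<And>i. i \<in> I \<Longrightarrow> Measurable.pred M (P i)"
  shows "Measurable.pred M (\<lambda>\<omega>. \<exists>i\<in>I. P i \<omega>)"
  using assms by (intro pred_intros_finite) auto

lemma pred_close_pairs:
  assumes "finite S" "\<And>i. i \<in> S \<Longrightarrow> (\<lambda>\<omega>. x \<omega> i) \<in> borel_measurable M"
  shows "Measurable.pred M (\<lambda>\<omega>. e \<in> close_pairs r (x \<omega>) S)"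
proof -
  have *: "e \<in> close_pairs r (x \<omega>) S \<longleftrightarrow>
      (\<exists>i\<in>S. \<exists>j\<in>S. (i \<noteq> j \<and> e = {i, j}) \<and> dist (x \<omega> i) (x \<omega> j) \<le> r)" for \<omega>
    unfolding close_pairs_def by blast
  show ?thesis unfolding * using assms by measurable
qed

lemma pred_cross_pairs:
  assumes "finite V" "S \<subseteq> V" "\<And>i. i \<in> V \<Longrightarrow> (\<lambda>\<omega>. x \<omega> i) \<in> borel_measurable M"
  shows "Measurable.pred M (\<lambda>\<omega>. e \<in> cross_pairs r (x \<omega>) S V)"
proof -
  have *: "e \<in> cross_pairs r (x \<omega>) S V \<longleftrightarrow>
      (\<exists>i\<in>S. \<exists>j\<in>V - S. e = {i, j} \<and> dist (x \<omega> i) (x \<omega> j) \<le> r)" for \<omega>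
    unfolding cross_pairs_def by blast
  have "Measurable.pred M (\<lambda>\<omega>. e = {i, j} \<and> dist (x \<omega> i) (x \<omega> j) \<le> r)"
    if "i \<in> S" "j \<in> V - S" for i j
  proof -
    have [measurable]: "(\<lambda>\<omega>. x \<omega> i) \<in> borel_measurable M" "(\<lambda>\<omega>. x \<omega> j) \<in> borel_measurable M"
      using assms that by auto
    show ?thesis by measurable
  qed
  moreover have "finite S" "finite (V - S)" using assms finite_subset by auto
  ultimately show ?thesis unfolding * by (intro pred_intros_finite) auto
qed

lemma pred_leftmost_in:
  fixes x :: "'w \<Rightarrow> 'i \<Rightarrow> real^'d::finite"
  assumes "finite S" "\<And>i. i \<in> S \<Longrightarrow> (\<lambda>\<omega>. x \<omega> i) \<in> borel_measurable M" "A \<in> sets borel"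
  shows "Measurable.pred M (\<lambda>\<omega>. leftmost_in i1 A (x \<omega>) S)"
proof -
  have "(\<lambda>\<omega>. x \<omega> i $ i1) \<in> borel_measurable M" if "i \<in> S" for i
    by (rule borel_measurable_continuous_on[OF _ assms(2)[OF that], of "\<lambda>v. v $ i1"])
      (intro continuous_intros)
  then show ?thesis unfolding leftmost_in_def using assms by measurable
qed

text \<open>The Bochner integral of a function that fails to be measurable is 0, so this is what gives the
expectation its intended value. The count is determined by finitely many
measurable relations between the points and the marks: coincidence, closeness, order of the chosen
coordinate, membership in \<open>A\<close>, and the marks themselves.\<close>

lemma component_count_measurable:
  fixes x :: "'w \<Rightarrow> nat \<Rightarrow> real^'d::finite"
  assumes x: "\<And>i. i \<in> {1..n} \<Longrightarrow> (\<lambda>\<omega>. x \<omega> i) \<in> borel_measurable M"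
    and keep: "\<And>e. e \<in> index_pairs n \<Longrightarrow> Measurable.pred M (\<lambda>\<omega>. keep \<omega> e)"
    and A: "A \<in> sets borel"
  shows "(\<lambda>\<omega>. real (component_count i1 A \<Gamma> (percolated_graph n (x \<omega>) (keep \<omega>) r))) \<in> borel_measurable M"
proof -
  let ?T = "\<lambda>\<omega>. first_index n (x \<omega>)" and ?E = "\<lambda>\<omega>. kept_pairs n (x \<omega>) (keep \<omega>) r"
  let ?P = "\<lambda>\<omega> C. (C \<in> component_sets (?T \<omega>, ?E \<omega>) \<and>
      graph_iso (induced_subgraph (?T \<omega>, ?E \<omega>) C) \<Gamma>) \<and> leftmost_in i1 A (x \<omega>) C"
  have T: "first_index n (x \<omega>) \<subseteq> {1..n}" for \<omega> by (auto simp: first_index_def)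
  have eq: "real (component_count i1 A \<Gamma> (percolated_graph n (x \<omega>) (keep \<omega>) r)) =
      (\<Sum>C\<in>Pow {1..n}. of_bool (?P \<omega> C))" for \<omega>
  proof -
    have "{C \<in> component_sets (?T \<omega>, ?E \<omega>). graph_iso (induced_subgraph (?T \<omega>, ?E \<omega>) C) \<Gamma> \<and>
        leftmost_in i1 A (x \<omega>) C} = {C \<in> Pow {1..n}. ?P \<omega> C}"
      using component_sets_subset[of _ "(?T \<omega>, ?E \<omega>)"] T by auto
    then show ?thesis unfolding component_count_percolated
      by (simp add: of_bool_def sum.If_cases Int_def)
  qed
  have idx: "Measurable.pred M (\<lambda>\<omega>. u \<in> ?T \<omega>)" if "u \<in> {1..n}" for u
    using x that unfolding first_index_def by measurable
  let ?same = "\<lambda>\<omega> i j i' j'. i' \<noteq> j' \<and>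
      ((x \<omega> i = x \<omega> i' \<and> x \<omega> j = x \<omega> j') \<or> (x \<omega> i = x \<omega> j' \<and> x \<omega> j = x \<omega> i')) \<and> keep \<omega> {i', j'}"
  let ?edge = "\<lambda>\<omega> u i j. (i \<noteq> j \<and> u = {i, j}) \<and> (i \<in> ?T \<omega> \<and> j \<in> ?T \<omega> \<and>
      dist (x \<omega> i) (x \<omega> j) \<le> r \<and> (\<exists>i'\<in>{1..n}. \<exists>j'\<in>{1..n}. ?same \<omega> i j i' j'))"
  have "Measurable.pred M (\<lambda>\<omega>. u \<in> ?E \<omega>)" for u
  proof -
    have *: "u \<in> ?E \<omega> \<longleftrightarrow> (\<exists>i\<in>{1..n}. \<exists>j\<in>{1..n}. ?edge \<omega> u i j)" for \<omega>
    proof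
      assume "u \<in> ?E \<omega>"
      then show "\<exists>i\<in>{1..n}. \<exists>j\<in>{1..n}. ?edge \<omega> u i j"
        unfolding kept_pairs_def mem_Collect_eq
      proof (elim conjE close_pairsE)
        fix i j
        assume h: "\<exists>i'\<in>{1..n}. \<exists>j'\<in>{1..n}. i' \<noteq> j' \<and> x \<omega> ` u = {x \<omega> i', x \<omega> j'} \<and> keep \<omega> {i', j'}"
          "u = {i, j}" "i \<in> ?T \<omega>" "j \<in> ?T \<omega>" "i \<noteq> j" "dist (x \<omega> i) (x \<omega> j) \<le> r"
        have "i \<in> {1..n}" "j \<in> {1..n}" using h by (auto simp: first_index_def)
        moreover have "\<exists>i'\<in>{1..n}. \<exists>j'\<in>{1..n}. ?same \<omega> i j i' j'"
          using h(1) unfolding h(2) image_insert image_empty doubleton_eq_iff .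
        ultimately show ?thesis using h by blast
      qed
    next
      assume "\<exists>i\<in>{1..n}. \<exists>j\<in>{1..n}. ?edge \<omega> u i j"
      then obtain i j where "?edge \<omega> u i j" by blast
      then show "u \<in> ?E \<omega>"
        unfolding kept_pairs_def mem_Collect_eq
        by (simp only: doubleton_mem_close_pairs image_insert image_empty doubleton_eq_iff) blast
    qed
    have k: "Measurable.pred M (\<lambda>\<omega>. ?same \<omega> i j i' j')"
      if "i' \<in> {1..n}" "j' \<in> {1..n}" "i \<in> {1..n}" "j \<in> {1..n}" for i' j' i j
    proof (cases "i' = j'")
      case False
      then have "{i', j'} \<in> index_pairs n" using that by (auto simp: index_pairs_def)
      then have [measurable]: "Measurable.pred M (\<lambda>\<omega>. keep \<omega> {i', j'})" by (rule keep)
      show ?thesis using x[OF that(1)] x[OF that(2)] x[OF that(3)] x[OF that(4)] by measurable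
    qed simp
    have edge: "Measurable.pred M (\<lambda>\<omega>. ?edge \<omega> u i j)" if ij: "i \<in> {1..n}" "j \<in> {1..n}" for i j
    proof -
      have 1: "Measurable.pred M (\<lambda>\<omega>. \<exists>i'\<in>{1..n}. \<exists>j'\<in>{1..n}. ?same \<omega> i j i' j')"
        by (rule pred_finite_bex, simp, rule pred_finite_bex, simp, rule k) (use ij in auto)
      have 2: "Measurable.pred M (\<lambda>\<omega>. dist (x \<omega> i) (x \<omega> j) \<le> r)"
        using x[OF ij(1)] x[OF ij(2)] by measurable
      have 3: "Measurable.pred M (\<lambda>\<omega>. i \<noteq> j \<and> u = {i, j})" by simp
      show ?thesis
        by (rule pred_intros_logic(3)[OF 3 pred_intros_logic(3)[OF idx[OF ij(1)]
            pred_intros_logic(3)[OF idx[OF ij(2)] pred_intros_logic(3)[OF 2 1]]]])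
    qed
    show ?thesis unfolding * by (rule pred_finite_bex[OF _ pred_finite_bex[OF _ edge]]) simp_all
  qed
  note E = this
  have E': "?E \<omega> \<subseteq> Pow {1..n}" for \<omega>
    using kept_pairs_subset[of n "x \<omega>" "keep \<omega>" r] T[of \<omega>] by blast
  have comp: "Measurable.pred M (\<lambda>\<omega>. C \<in> component_sets (?T \<omega>, ?E \<omega>) \<and>
      graph_iso (induced_subgraph (?T \<omega>, ?E \<omega>) C) \<Gamma>)" for C
    by (rule pred_finite_set_valued2[where U = "{1..n}" and V = "Pow {1..n}" and g = ?T and h = ?E and
        Q = "\<lambda>T E. C \<in> component_sets (T, E) \<and> graph_iso (induced_subgraph (T, E) C) \<Gamma>",
        OF _ idx T _ E E']) simp_all
  have left: "Measurable.pred M (\<lambda>\<omega>. leftmost_in i1 A (x \<omega>) C)" if "C \<in> Pow {1..n}" for C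
    by (rule pred_leftmost_in[OF _ _ A]) (use that x finite_subset in auto)
  have P: "Measurable.pred M (\<lambda>\<omega>. ?P \<omega> C)" if "C \<in> Pow {1..n}" for C
    by (rule pred_intros_logic(3)[OF comp left[OF that]])
  have "(\<lambda>\<omega>. of_bool (?P \<omega> C) :: real) \<in> borel_measurable M" if "C \<in> Pow {1..n}" for C
    by (rule measurable_compose[OF P[OF that]]) auto
  then show ?thesis unfolding eq by (rule borel_measurable_sum)
qed

section \<open>Change of index set\<close>

lemma index_graph_reindex:
  assumes "inj_on \<pi> I"
  shows "(\<pi> ` I, close_pairs r x (\<pi> ` I)) = relabel \<pi> (I, close_pairs r (x \<circ> \<pi>) I)"
proof -
  have "close_pairs r x (\<pi> ` I) = (`) \<pi> ` close_pairs r (x \<circ> \<pi>) I"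
  proof (intro equalityI subsetI)
    fix e assume "e \<in> close_pairs r x (\<pi> ` I)"
    then obtain i j where ij: "i \<in> I" "j \<in> I" "e = {\<pi> i, \<pi> j}" "\<pi> i \<noteq> \<pi> j" "dist (x (\<pi> i)) (x (\<pi> j)) \<le> r"
      by (elim close_pairsE imageE) simp
    then have "{i, j} \<in> close_pairs r (x \<circ> \<pi>) I" by (auto simp: doubleton_mem_close_pairs)
    moreover have "e = \<pi> ` {i, j}" using ij by simp
    ultimately show "e \<in> (`) \<pi> ` close_pairs r (x \<circ> \<pi>) I" by blast
  next
    fix e assume "e \<in> (`) \<pi> ` close_pairs r (x \<circ> \<pi>) I"
    then obtain i j where ij: "i \<in> I" "j \<in> I" "i \<noteq> j" "e = {\<pi> i, \<pi> j}" "dist (x (\<pi> i)) (x (\<pi> j)) \<le> r"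
      by (elim close_pairsE imageE) simp
    then have "\<pi> i \<noteq> \<pi> j" using assms by (auto dest: inj_onD)
    then show "e \<in> close_pairs r x (\<pi> ` I)" using ij by (simp add: doubleton_mem_close_pairs)
  qed
  then show ?thesis by (simp add: relabel_def)
qed

lemma weight_reindex:
  assumes "inj_on \<pi> I"
  shows "weight \<Gamma> q (\<pi> ` I, close_pairs r x (\<pi> ` I)) = weight \<Gamma> q (I, close_pairs r (x \<circ> \<pi>) I)"
  unfolding index_graph_reindex[OF assms]
  by (rule weight_relabel) (use assms close_pairs_subset[of r "x \<circ> \<pi>" I] in auto)

lemma near_reindex:
  assumes "inj_on \<pi> I"
  shows "near r x (\<pi> ` I) y = near r (x \<circ> \<pi>) I y"
proof -
  have "{i \<in> \<pi> ` I. dist (x i) y \<le> r} = \<pi> ` {i \<in> I. dist ((x \<circ> \<pi>) i) y \<le> r}" by auto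
  moreover have "inj_on \<pi> {i \<in> I. dist ((x \<circ> \<pi>) i) y \<le> r}" using assms by (rule inj_on_subset) auto
  ultimately show ?thesis unfolding near_def by (simp add: card_image)
qed

lemma leftmost_in_reindex: "leftmost_in i1 A x (\<pi> ` I) = leftmost_in i1 A (x \<circ> \<pi>) I"
  unfolding leftmost_in_def by simp

text \<open>The weight of an index set together with the condition on its left-most point; the part of the
integrand that depends on the \<open>k\<close> points of the component only.\<close>

definition copy_weight ::
    "'v graph \<Rightarrow> real \<Rightarrow> 'd \<Rightarrow> (real^'d) set \<Rightarrow> real \<Rightarrow> ('i \<Rightarrow> real^'d) \<Rightarrow> 'i set \<Rightarrow> real" where
  "copy_weight \<Gamma> q i1 A r x S =
     of_bool (leftmost_in i1 A x S) * weight \<Gamma> q (S, close_pairs r x S)"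

lemma copy_weight_cong:
  "(\<And>i. i \<in> S \<Longrightarrow> x i = y i) \<Longrightarrow> copy_weight \<Gamma> q i1 A r x S = copy_weight \<Gamma> q i1 A r y S"
  unfolding copy_weight_def using leftmost_in_cong[of S x y] close_pairs_cong[of S x y] by simp

lemma copy_weight_reindex:
  assumes "inj_on \<pi> I"
  shows "copy_weight \<Gamma> q i1 A r x (\<pi> ` I) = copy_weight \<Gamma> q i1 A r (x \<circ> \<pi>) I"
  unfolding copy_weight_def weight_reindex[OF assms] leftmost_in_reindex ..

lemma copy_weight_nonneg: "q \<le> 1 \<Longrightarrow> 0 \<le> copy_weight \<Gamma> q i1 A r x S"
  by (simp add: copy_weight_def weight_nonneg)

text \<open>The crude bound counts all sets of subsets of \<open>S\<close>; any bound that depends only on the number of points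
suffices as a dominating constant.\<close>

lemma weight_close_pairs_le:
  assumes "0 \<le> q" "q \<le> 1" "finite S"
  shows "weight \<Gamma> q (S, close_pairs r x S) \<le> 2 ^ 2 ^ card S"
proof -
  have "card (close_pairs r x S) \<le> 2 ^ card S"
    using card_mono[OF _ close_pairs_subset, of S r x] assms(3) by (simp add: card_Pow)
  then have "(2::real) ^ card (close_pairs r x S) \<le> 2 ^ 2 ^ card S" by (intro power_increasing) auto
  moreover have "weight \<Gamma> q (S, close_pairs r x S) \<le> 2 ^ card (close_pairs r x S)"
    using weight_le[of q "(S, close_pairs r x S)" \<Gamma>] assms finite_close_pairs[of S r x] by simp
  ultimately show ?thesis by (rule order_trans[rotated])
qed

lemma copy_weight_le:
  assumes "0 \<le> q" "q \<le> 1" "finite S"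
  shows "copy_weight \<Gamma> q i1 A r x S \<le> 2 ^ 2 ^ card S"
  using weight_close_pairs_le[OF assms, of \<Gamma> r x] by (simp add: copy_weight_def)

lemma measurable_close_pairs:
  assumes "finite S" "\<And>i. i \<in> S \<Longrightarrow> (\<lambda>\<omega>. x \<omega> i) \<in> borel_measurable M"
  shows "(\<lambda>\<omega>. close_pairs r (x \<omega>) S) \<in> measurable M (count_space (Pow (Pow S)))"
  by (rule measurable_finite_set_valued[OF _ pred_close_pairs[OF assms] close_pairs_subset])
    (use assms in auto)

lemma measurable_weight:
  assumes "finite S" "\<And>i. i \<in> S \<Longrightarrow> (\<lambda>\<omega>. x \<omega> i) \<in> borel_measurable M"
  shows "(\<lambda>\<omega>. weight \<Gamma> q (S, close_pairs r (x \<omega>) S)) \<in> borel_measurable M"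
  by (rule measurable_compose[OF measurable_close_pairs[OF assms]]) auto

lemma measurable_copy_weight:
  fixes x :: "'w \<Rightarrow> 'i \<Rightarrow> real^'d::finite"
  assumes "finite S" "\<And>i. i \<in> S \<Longrightarrow> (\<lambda>\<omega>. x \<omega> i) \<in> borel_measurable M" "A \<in> sets borel"
  shows "(\<lambda>\<omega>. copy_weight \<Gamma> q i1 A r (x \<omega>) S) \<in> borel_measurable M"
proof -
  have "(\<lambda>\<omega>. of_bool (leftmost_in i1 A (x \<omega>) S) :: real) \<in> borel_measurable M"
    by (rule measurable_compose[OF pred_leftmost_in[OF assms]]) auto
  then show ?thesis unfolding copy_weight_def
    by (rule borel_measurable_times[OF _ measurable_weight[OF assms(1,2)]])
qed

lemma measurable_near_power:
  fixes x :: "'w \<Rightarrow> 'i \<Rightarrow> real^'d::finite"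
  assumes "finite S" "\<And>i. i \<in> S \<Longrightarrow> (\<lambda>\<omega>. x \<omega> i) \<in> borel_measurable M"
    and y: "y \<in> borel_measurable M"
  shows "(\<lambda>\<omega>. c ^ near r (x \<omega>) S (y \<omega>) :: real) \<in> borel_measurable M"
proof -
  have "c ^ near r (x \<omega>) S (y \<omega>) = (\<Prod>i\<in>S. if dist (x \<omega> i) (y \<omega>) \<le> r then c else 1)" for \<omega>
    using assms(1) by (simp add: near_def prod.If_cases Int_def)
  moreover have "(\<lambda>\<omega>. if dist (x \<omega> i) (y \<omega>) \<le> r then c else 1) \<in> borel_measurable M" if "i \<in> S" for i
  proof -
    have [measurable]: "(\<lambda>\<omega>. x \<omega> i) \<in> borel_measurable M" using assms(2) that .
    show ?thesis using y by measurable
  qed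
  ultimately show ?thesis by (simp add: borel_measurable_prod)
qed

section \<open>The exact expected component count\<close>

context percolation_model begin

abbreviation "mu \<equiv> density lborel (\<lambda>x. ennreal (f x))"

lemma f_meas: "(\<lambda>x. ennreal (f x)) \<in> borel_measurable lborel"
  using points_density[of 1] by (simp add: distributed_def)

lemma X_meas: "i \<ge> 1 \<Longrightarrow> X i \<in> borel_measurable M"
  using points_density[of i] by (simp add: distributed_def)

lemma X_distr: "i \<ge> 1 \<Longrightarrow> distr M borel (X i) = mu"
  using points_density[of i] unfolding distributed_def by (metis distr_cong sets_lborel)

lemma mu_prob: "prob_space mu"
  using X_distr[of 1] prob_space_distr[OF X_meas[of 1]] by simp

lemma points_distr:
  assumes "I \<noteq> {}" "I \<subseteq> {1..}"
  shows "distr M (Pi\<^sub>M I (\<lambda>_. borel)) (\<lambda>\<omega>. \<lambda>i\<in>I. X i \<omega>) = Pi\<^sub>M I (\<lambda>_. mu)"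
proof -
  have "indep_vars (\<lambda>_. borel) X I" using points_indep assms(2) by (rule indep_vars_subset)
  then have "distr M (Pi\<^sub>M I (\<lambda>_. borel)) (\<lambda>\<omega>. \<lambda>i\<in>I. X i \<omega>) = (\<Pi>\<^sub>M i\<in>I. distr M borel (X i))"
    using assms X_meas by (subst (asm) indep_vars_iff_distr_eq_PiM') auto
  also have "\<dots> = Pi\<^sub>M I (\<lambda>_. mu)" using assms X_distr by (intro PiM_cong) auto
  finally show ?thesis .
qed

lemma mu_singleton: "emeasure mu {a} = 0"
proof -
  have "AE x in lborel. x \<in> {a} \<longrightarrow> ennreal (f x) = 0"
    by (rule AE_mp[OF AE_lborel_singleton[of a]]) simp
  then have "{a} \<in> null_sets mu" using f_meas by (subst null_sets_density_iff) auto
  then show ?thesis by (rule null_setsD1)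
qed

text \<open>The joint law of two points is a product of measures without atoms, so the diagonal is a null set.\<close>

lemma AE_points_distinct: "AE \<omega> in M. inj_on (\<lambda>i. X i \<omega>) {1..n}"
proof -
  (* The null set is computed under the joint law of the two points and then pulled back. *)
  have "AE \<omega> in M. X i \<omega> \<noteq> X j \<omega>" if ij: "i \<ge> 1" "j \<ge> 1" "i \<noteq> j" for i j
  proof -
    interpret mu: prob_space mu by (rule mu_prob)
    interpret P: product_sigma_finite "\<lambda>_::nat. mu" by standard
    let ?P = "Pi\<^sub>M {i, j} (\<lambda>_. mu)"
    let ?D = "\<lambda>(a::real^'d) b. indicator {(a, b). a = b} (a, b) :: ennreal"
    have D: "{(a::real^'d, b). a = b} \<in> sets (borel \<Otimes>\<^sub>M borel)"
      unfolding borel_prod case_prod_beta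
      by (intro borel_closed closed_Collect_eq continuous_on_fst continuous_on_snd continuous_on_id)
    have "indicator {(a, b). a = b} \<in> borel_measurable (mu \<Otimes>\<^sub>M mu)"
    proof (rule borel_measurable_indicator)
      have "sets (mu \<Otimes>\<^sub>M mu) = sets (borel \<Otimes>\<^sub>M borel)" by (rule sets_pair_measure_cong) simp_all
      then show "{(a, b). a = b} \<in> sets (mu \<Otimes>\<^sub>M mu)" using D by (rule ssubst)
    qed
    then have Dm: "case_prod ?D \<in> borel_measurable (mu \<Otimes>\<^sub>M mu)"
      by (rule back_subst[of "\<lambda>g. g \<in> borel_measurable (mu \<Otimes>\<^sub>M mu)"]) (simp add: fun_eq_iff)
    have "(\<integral>\<^sup>+\<sigma>. ?D (\<sigma> i) (\<sigma> j) \<partial>?P) = (\<integral>\<^sup>+z. ?D (fst z) (snd z) \<partial>(mu \<Otimes>\<^sub>M mu))"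
      by (rule P.product_nn_integral_pair[OF Dm ij(3)])
    also have "\<dots> = (\<integral>\<^sup>+a. \<integral>\<^sup>+b. ?D a b \<partial>mu \<partial>mu)"
      using mu.nn_integral_fst[OF Dm] by (simp add: case_prod_beta)
    also have "\<dots> = (\<integral>\<^sup>+a. emeasure mu {a} \<partial>mu)"
    proof (rule nn_integral_cong)
      fix a :: "real^'d"
      have "(\<integral>\<^sup>+b. ?D a b \<partial>mu) = (\<integral>\<^sup>+b. indicator {a} b \<partial>mu)"
        by (intro nn_integral_cong) (auto simp: indicator_def)
      then show "(\<integral>\<^sup>+b. ?D a b \<partial>mu) = emeasure mu {a}" by simp
    qed
    also have "\<dots> = 0" by (simp add: mu_singleton)
    finally have "(\<integral>\<^sup>+\<sigma>. ?D (\<sigma> i) (\<sigma> j) \<partial>distr M (Pi\<^sub>M {i, j} (\<lambda>_. borel)) (\<lambda>\<omega>. \<lambda>l\<in>{i, j}. X l \<omega>)) = 0"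
      using points_distr[of "{i, j}"] ij by simp
    moreover have "(\<lambda>\<omega>. \<lambda>l\<in>{i, j}. X l \<omega>) \<in> measurable M (Pi\<^sub>M {i, j} (\<lambda>_. borel))"
      by (rule measurable_restrict) (use X_meas ij in auto)
    moreover have "(\<lambda>\<sigma>. ?D (\<sigma> i) (\<sigma> j)) \<in> borel_measurable (Pi\<^sub>M {i, j} (\<lambda>_. borel))"
      by (rule measurable_compose[of "\<lambda>\<sigma>. (\<sigma> i, \<sigma> j)", OF _ borel_measurable_indicator[OF D]]) measurable
    ultimately have "(\<integral>\<^sup>+\<omega>. ?D (X i \<omega>) (X j \<omega>) \<partial>M) = 0"
      by (subst (asm) nn_integral_distr) auto
    then have "AE \<omega> in M. ?D (X i \<omega>) (X j \<omega>) = 0"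
    proof (subst (asm) nn_integral_0_iff_AE)
      have "(\<lambda>\<omega>. (X i \<omega>, X j \<omega>)) \<in> measurable M (borel \<Otimes>\<^sub>M borel)"
        using X_meas ij by measurable
      then show "(\<lambda>\<omega>. ?D (X i \<omega>) (X j \<omega>)) \<in> borel_measurable M"
        by (rule measurable_compose[OF _ borel_measurable_indicator[OF D]])
    qed
    then show ?thesis by (rule AE_mp) (auto simp: indicator_def)
  qed
  then have "AE \<omega> in M. \<forall>i\<in>{1..n}. \<forall>j\<in>{1..n}. i \<noteq> j \<longrightarrow> X i \<omega> \<noteq> X j \<omega>"
    by (intro AE_finite_allI) (auto intro: AE_impI)
  then show ?thesis by (rule AE_mp) (auto simp: inj_on_def)
qed

lemma finite_index_pairs: "finite (index_pairs n)"
  by (rule finite_subset[of _ "Pow {1..n}"]) (auto simp: index_pairs_def)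

lemma K_meas: "n \<ge> 1 \<Longrightarrow> e \<in> index_pairs n \<Longrightarrow> K n e \<in> measurable M (count_space UNIV)"
  using marks_indep[of n] unfolding indep_vars_def by auto

lemma prob_marks_pattern:
  assumes n: "n \<ge> 1" and ab: "a \<subseteq> index_pairs n" "b \<subseteq> index_pairs n" "a \<inter> b = {}" and E: "E \<subseteq> a"
  shows "{\<omega> \<in> space M. (\<forall>e\<in>a. K n e \<omega> \<longleftrightarrow> e \<in> E) \<and> (\<forall>e\<in>b. \<not> K n e \<omega>)} \<in> events" (is "?ev \<in> _")
    and "prob {\<omega> \<in> space M. (\<forall>e\<in>a. K n e \<omega> \<longleftrightarrow> e \<in> E) \<and> (\<forall>e\<in>b. \<not> K n e \<omega>)} =
      p n ^ card E * (1 - p n) ^ (card a - card E + card b)"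
proof -
  have fin: "finite a" "finite b" "finite E"
    using ab E finite_index_pairs[of n] finite_subset by metis+
  have Km: "K n e \<in> measurable M (count_space UNIV)" if "e \<in> a \<union> b" for e
    using K_meas[OF n] ab that by auto
  have ev: "?ev = {\<omega> \<in> space M. \<forall>e\<in>a \<union> b. K n e \<omega> \<in> {e \<in> E}}" using ab E by auto
  show "?ev \<in> events"
    unfolding ev by (rule sets.sets_Collect_finite_All) (use Km fin in auto)
  have pr: "prob (K n e -` {e \<in> E} \<inter> space M) = (if e \<in> E then p n else 1 - p n)" if "e \<in> a \<union> b" for e
  proof -
    have e: "e \<in> index_pairs n" using ab that by auto
    have T: "{\<omega> \<in> space M. K n e \<omega>} \<in> events" using Km[OF that] by measurable
    show ?thesis
    proof (cases "e \<in> E")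
      case True
      then have "K n e -` {e \<in> E} \<inter> space M = {\<omega> \<in> space M. K n e \<omega>}" by auto
      then show ?thesis using marks_prob[OF n e] True by simp
    next
      case False
      then have "K n e -` {e \<in> E} \<inter> space M = space M - {\<omega> \<in> space M. K n e \<omega>}" by auto
      then show ?thesis using marks_prob[OF n e] False prob_compl[OF T] by simp
    qed
  qed
  have "prob ?ev = (\<Prod>e\<in>a \<union> b. if e \<in> E then p n else 1 - p n)"
  proof (cases "a \<union> b = {}")
    case True
    then show ?thesis using ev by (simp add: prob_space)
  next
    case False
    have "?ev = (\<Inter>e\<in>a \<union> b. K n e -` {e \<in> E} \<inter> space M)" unfolding ev using False by auto
    also have "prob \<dots> = (\<Prod>e\<in>a \<union> b. prob (K n e -` {e \<in> E} \<inter> space M))"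
      by (rule indep_varsD[OF marks_indep[OF n] False]) (use fin ab in auto)
    also have "\<dots> = (\<Prod>e\<in>a \<union> b. if e \<in> E then p n else 1 - p n)" by (rule prod.cong) (use pr in auto)
    finally show ?thesis .
  qed
  also have "\<dots> = p n ^ card E * (1 - p n) ^ card ((a - E) \<union> b)"
  proof -
    have "(a \<union> b) \<inter> {e. e \<in> E} = E" "(a \<union> b) \<inter> - {e. e \<in> E} = (a - E) \<union> b" using ab E by auto
    then show ?thesis using fin by (simp add: prod.If_cases)
  qed
  also have "card ((a - E) \<union> b) = card a - card E + card b"
    using fin ab E by (subst card_Un_disjoint) (auto simp: card_Diff_subset)
  finally show "prob ?ev = p n ^ card E * (1 - p n) ^ (card a - card E + card b)" .
qed

text \<open>The outcomes of the marks inside \<open>S\<close> that leave a copy of \<open>\<Gamma>\<close> are the copies themselves; each of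
these disjoint events fixes all marks of close pairs.\<close>

lemma prob_marks_copy:
  assumes n: "n \<ge> 1" and ab: "a \<subseteq> index_pairs n" "b \<subseteq> index_pairs n" "a \<inter> b = {}"
    and S: "finite S" "a \<subseteq> Pow S" and \<Gamma>: "simple_graph \<Gamma>"
  shows "prob {\<omega> \<in> space M. graph_iso (S, {e \<in> a. K n e \<omega>}) \<Gamma> \<and> (\<forall>e\<in>b. \<not> K n e \<omega>)} =
      p n ^ card (edges \<Gamma>) * weight \<Gamma> (p n) (S, a) * (1 - p n) ^ card b"
proof -
  let ?F = "{E. E \<subseteq> a \<and> graph_iso (S, E) \<Gamma>}"
  let ?ev = "\<lambda>E. {\<omega> \<in> space M. (\<forall>e\<in>a. K n e \<omega> \<longleftrightarrow> e \<in> E) \<and> (\<forall>e\<in>b. \<not> K n e \<omega>)}"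
  have fin: "finite a" using ab finite_index_pairs[of n] finite_subset by metis
  then have finF: "finite ?F" by simp
  have eq: "{\<omega> \<in> space M. graph_iso (S, {e \<in> a. K n e \<omega>}) \<Gamma> \<and> (\<forall>e\<in>b. \<not> K n e \<omega>)} = (\<Union>E\<in>?F. ?ev E)"
  proof (intro equalityI subsetI)
    fix \<omega> assume "\<omega> \<in> {\<omega> \<in> space M. graph_iso (S, {e \<in> a. K n e \<omega>}) \<Gamma> \<and> (\<forall>e\<in>b. \<not> K n e \<omega>)}"
    then have "{e \<in> a. K n e \<omega>} \<in> ?F" "\<omega> \<in> ?ev {e \<in> a. K n e \<omega>}" by auto
    then show "\<omega> \<in> (\<Union>E\<in>?F. ?ev E)" by blast
  next
    fix \<omega> assume "\<omega> \<in> (\<Union>E\<in>?F. ?ev E)"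
    then obtain E where E: "E \<in> ?F" "\<omega> \<in> ?ev E" by blast
    then have "{e \<in> a. K n e \<omega>} = E" by blast
    then show "\<omega> \<in> {\<omega> \<in> space M. graph_iso (S, {e \<in> a. K n e \<omega>}) \<Gamma> \<and> (\<forall>e\<in>b. \<not> K n e \<omega>)}"
      using E by simp
  qed
  have "prob (\<Union>E\<in>?F. ?ev E) = (\<Sum>E\<in>?F. prob (?ev E))"
  proof (rule finite_measure_finite_Union[OF finF])
    show "?ev ` ?F \<subseteq> events" using prob_marks_pattern(1)[OF n ab] by blast
    show "disjoint_family_on ?ev ?F" unfolding disjoint_family_on_def by blast
  qed
  also have "\<dots> = (\<Sum>E\<in>?F. p n ^ card (edges \<Gamma>) * (1 - p n) ^ (card a - card (edges \<Gamma>) + card b))"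
  proof (rule sum.cong)
    fix E assume E: "E \<in> ?F"
    have "e \<subseteq> S \<and> card e = 2" if "e \<in> E" for e
      using that E S ab by (auto simp: index_pairs_def)
    then have "simple_graph (S, E)" using S by (simp add: simple_graph_def)
    then have "card E = card (edges \<Gamma>)" using graph_iso_card(2)[of "(S, E)" \<Gamma>] E \<Gamma> by simp
    then show "prob (?ev E) = p n ^ card (edges \<Gamma>) * (1 - p n) ^ (card a - card (edges \<Gamma>) + card b)"
      using prob_marks_pattern(2)[OF n ab, of E] E by simp
  qed simp
  also have "\<dots> = p n ^ card (edges \<Gamma>) * weight \<Gamma> (p n) (S, a) * (1 - p n) ^ card b"
    by (simp add: weight_def copies_def power_add algebra_simps)
  finally show ?thesis unfolding eq .
qed


text \<open>Points and marks are independent, and the points enter only through two sets of index pairs. Splitting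
according to the finitely many values of these sets gives products of a point event and a mark
event; adding up again expresses the probability as an integral over the points alone.\<close>

lemma prob_isolated_copy:
  assumes n: "n \<ge> 1" and S: "S \<subseteq> {1..n}" and \<Gamma>: "simple_graph \<Gamma>" and A: "A \<in> sets borel"
    and k: "card S = card (verts \<Gamma>)" "S \<noteq> {}"
  defines "x \<equiv> \<lambda>\<omega>. \<lambda>i\<in>{1..n}. X i \<omega>"
  shows "{\<omega> \<in> space M. isolated_copy \<Gamma> r n (x \<omega>) (\<lambda>e. K n e \<omega>) S \<and> leftmost_in i1 A (x \<omega>) S} \<in> events"
      (is "?ev \<in> _")
    and "prob {\<omega> \<in> space M. isolated_copy \<Gamma> r n (x \<omega>) (\<lambda>e. K n e \<omega>) S \<and> leftmost_in i1 A (x \<omega>) S} =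
      (\<integral>\<omega>. p n ^ card (edges \<Gamma>) * copy_weight \<Gamma> (p n) i1 A r (x \<omega>) S *
        (1 - p n) ^ card (cross_pairs r (x \<omega>) S {1..n}) \<partial>M)"
proof -
  let ?I = "index_pairs n" and ?N = "{1..n}"
  let ?PX = "Pi\<^sub>M ?N (\<lambda>_. borel :: (real^'d) measure)"
  let ?PK = "Pi\<^sub>M ?I (\<lambda>_. count_space UNIV :: bool measure)"
  let ?\<kappa> = "\<lambda>\<omega>. \<lambda>e\<in>?I. K n e \<omega>"
  let ?c = "\<lambda>y. close_pairs r y S" and ?d = "\<lambda>y. cross_pairs r y S ?N"
  let ?HX = "\<lambda>a b. {y \<in> space ?PX. (?c y = a \<and> ?d y = b) \<and> leftmost_in i1 A y S}"
  let ?HK = "\<lambda>a b. {g \<in> space ?PK. graph_iso (S, {e \<in> a. g e}) \<Gamma> \<and> (\<forall>e\<in>b. \<not> g e)}"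
  let ?EX = "\<lambda>a b. x -` ?HX a b \<inter> space M" and ?EK = "\<lambda>a b. ?\<kappa> -` ?HK a b \<inter> space M"
  let ?w = "\<lambda>a b. p n ^ card (edges \<Gamma>) * weight \<Gamma> (p n) (S, a) * (1 - p n) ^ card b"
  let ?F = "{(a, b) \<in> Pow ?I \<times> Pow ?I. a \<subseteq> Pow S \<and> a \<inter> b = {}}"
  have finS: "finite S" using S finite_subset by blast
  have finF: "finite ?F" using finite_index_pairs[of n] by (rule_tac finite_subset[of _ "Pow ?I \<times> Pow ?I"]) auto
  have xm: "x \<in> measurable M ?PX"
    unfolding x_def by (rule measurable_restrict) (use X_meas in auto)
  have \<kappa>m: "?\<kappa> \<in> measurable M ?PK" by (rule measurable_restrict) (use K_meas[OF n] in auto)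
  have comp: "(\<lambda>y. y i) \<in> borel_measurable ?PX" if "i \<in> ?N" for i
    using that by (rule measurable_component_singleton)
  have pairs: "close_pairs r y S \<subseteq> ?I" "cross_pairs r y S ?N \<subseteq> ?I" for y
  proof -
    show "close_pairs r y S \<subseteq> ?I" unfolding index_pairs_def
      using close_pairs_subset[of r y S] card_close_pairs[of _ r y S] S by blast
    show "cross_pairs r y S ?N \<subseteq> ?I" unfolding index_pairs_def
      using cross_pairs_subset[OF S, of r y] card_cross_pairs_elem[of _ r y S ?N] by blast
  qed
  have HX: "?HX a b \<in> sets ?PX" for a b
  proof -
    have "Measurable.pred ?PX (\<lambda>y. ?c y = a \<and> ?d y = b)"
      by (rule pred_finite_set_valued2[where U = "Pow S" and V = "Pow ?N" and g = ?c and h = ?d and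
            Q = "\<lambda>c d. c = a \<and> d = b", OF _ pred_close_pairs _ _ pred_cross_pairs])
        (use finS S comp in \<open>auto intro!: close_pairs_subset cross_pairs_subset\<close>)
    moreover have "Measurable.pred ?PX (\<lambda>y. leftmost_in i1 A y S)"
      by (rule pred_leftmost_in[OF finS _ A]) (use comp S in auto)
    ultimately show ?thesis unfolding pred_def[symmetric] by (rule pred_intros_logic(3))
  qed
  have HK: "?HK a b \<in> sets ?PK" if "a \<subseteq> ?I" "b \<subseteq> ?I" for a b
  proof -
    have fin: "finite a" "finite b" using that finite_index_pairs[of n] finite_subset by metis+
    have g: "Measurable.pred ?PK (\<lambda>g. g e)" if "e \<in> ?I" for e
      using measurable_component_singleton[OF that, of "\<lambda>_. count_space UNIV :: bool measure"] .
    have "Measurable.pred ?PK (\<lambda>g. (\<lambda>E D. graph_iso (S, E) \<Gamma> \<and> D = {}) {e \<in> a. g e} {e \<in> b. g e})"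
      by (rule pred_finite_set_valued2[of a _ _ b]) (use fin that g in \<open>auto intro!: pred_intros_logic\<close>)
    then show ?thesis unfolding pred_def[symmetric] by (simp add: Ball_def)
  qed
  have EX: "?EX a b \<in> events" for a b using measurable_sets[OF xm HX] .
  have EK: "?EK a b \<in> events" if "(a, b) \<in> ?F" for a b
    by (rule measurable_sets[OF \<kappa>m HK]) (use that in auto)
  have prob_EK: "prob (?EK a b) = ?w a b" if "(a, b) \<in> ?F" for a b
  proof -
    have *: "a \<subseteq> ?I" "b \<subseteq> ?I" "a \<inter> b = {}" "a \<subseteq> Pow S" using that by auto
    have "{e \<in> a. ?\<kappa> \<omega> e} = {e \<in> a. K n e \<omega>}" "(\<forall>e\<in>b. \<not> ?\<kappa> \<omega> e) \<longleftrightarrow> (\<forall>e\<in>b. \<not> K n e \<omega>)" for \<omega>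
      using * by auto
    then have "?EK a b = {\<omega> \<in> space M. graph_iso (S, {e \<in> a. K n e \<omega>}) \<Gamma> \<and> (\<forall>e\<in>b. \<not> K n e \<omega>)}"
      using measurable_space[OF \<kappa>m] by auto
    then show ?thesis using prob_marks_copy[OF n *(1-3) finS *(4) \<Gamma>] by simp
  qed
  have indep: "prob (?EX a b \<inter> ?EK a b) = prob (?EX a b) * ?w a b" if "(a, b) \<in> ?F" for a b
  proof -
    have "prob (?EX a b \<inter> ?EK a b) = prob (?EX a b) * prob (?EK a b)"
      unfolding x_def
      by (rule indep_setD[OF marks_points_indep[OF n] in_vimage_algebra[OF HX] in_vimage_algebra[OF HK]])
        (use that in auto)
    then show ?thesis using prob_EK[OF that] by simp
  qed
  have in_F: "(?c y, ?d y) \<in> ?F" for y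
    using pairs[of y] close_pairs_subset[of r y S] close_cross_disjoint[of r y S ?N] by auto
  have ev: "?ev = (\<Union>z\<in>?F. ?EX (fst z) (snd z) \<inter> ?EK (fst z) (snd z))"
  proof (intro equalityI subsetI)
    fix \<omega> assume \<omega>: "\<omega> \<in> ?ev"
    have "{e \<in> ?c (x \<omega>). ?\<kappa> \<omega> e} = {e \<in> ?c (x \<omega>). K n e \<omega>}" using pairs(1)[of "x \<omega>"] by auto
    moreover have "\<forall>e\<in>?d (x \<omega>). \<not> ?\<kappa> \<omega> e" using pairs(2)[of "x \<omega>"] \<omega> by (auto simp: isolated_copy_def)
    ultimately have "\<omega> \<in> ?EX (?c (x \<omega>)) (?d (x \<omega>)) \<inter> ?EK (?c (x \<omega>)) (?d (x \<omega>))"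
      using \<omega> measurable_space[OF xm, of \<omega>] measurable_space[OF \<kappa>m, of \<omega>] by (simp add: isolated_copy_def)
    then show "\<omega> \<in> (\<Union>z\<in>?F. ?EX (fst z) (snd z) \<inter> ?EK (fst z) (snd z))"
      using in_F[of "x \<omega>"] by (intro UN_I[of "(?c (x \<omega>), ?d (x \<omega>))"]) simp_all
  next
    fix \<omega> assume "\<omega> \<in> (\<Union>z\<in>?F. ?EX (fst z) (snd z) \<inter> ?EK (fst z) (snd z))"
    then obtain a b where ab: "(a, b) \<in> ?F" "\<omega> \<in> ?EX a b" "\<omega> \<in> ?EK a b" by force
    have "{e \<in> a. ?\<kappa> \<omega> e} = {e \<in> a. K n e \<omega>}" "(\<forall>e\<in>b. \<not> ?\<kappa> \<omega> e) \<longleftrightarrow> (\<forall>e\<in>b. \<not> K n e \<omega>)"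
      using ab(1) by auto
    then show "\<omega> \<in> ?ev" using ab(2,3) by (simp add: isolated_copy_def)
  qed
  have EXK: "?EX (fst z) (snd z) \<inter> ?EK (fst z) (snd z) \<in> events" if "z \<in> ?F" for z
    by (rule sets.Int[OF EX EK]) (use that in simp)
  show "?ev \<in> events" unfolding ev by (rule sets.finite_UN[OF finF EXK])
  have "prob ?ev = (\<Sum>z\<in>?F. prob (?EX (fst z) (snd z) \<inter> ?EK (fst z) (snd z)))"
    unfolding ev
  proof (rule finite_measure_finite_Union[OF finF])
    show "(\<lambda>z. ?EX (fst z) (snd z) \<inter> ?EK (fst z) (snd z)) ` ?F \<subseteq> events"
      using EXK by blast
    show "disjoint_family_on (\<lambda>z. ?EX (fst z) (snd z) \<inter> ?EK (fst z) (snd z)) ?F"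
      unfolding disjoint_family_on_def by auto
  qed
  also have "\<dots> = (\<Sum>z\<in>?F. prob (?EX (fst z) (snd z)) * ?w (fst z) (snd z))"
    by (rule sum.cong[OF refl], rule indep) simp
  also have "\<dots> = (\<Sum>z\<in>?F. \<integral>\<omega>. indicator (?EX (fst z) (snd z)) \<omega> * ?w (fst z) (snd z) \<partial>M)"
    using EX by (intro sum.cong) simp_all
  also have "\<dots> = (\<integral>\<omega>. (\<Sum>z\<in>?F. indicator (?EX (fst z) (snd z)) \<omega> * ?w (fst z) (snd z)) \<partial>M)"
    using EX by (intro Bochner_Integration.integral_sum[symmetric]) (auto intro!: integrable_mult_left integrable_real_indicator simp: emeasure_eq_measure)
  also have "\<dots> = (\<integral>\<omega>. p n ^ card (edges \<Gamma>) * copy_weight \<Gamma> (p n) i1 A r (x \<omega>) S *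
        (1 - p n) ^ card (?d (x \<omega>)) \<partial>M)"
  proof (rule Bochner_Integration.integral_cong)
    fix \<omega> assume \<omega>: "\<omega> \<in> space M"
    let ?z = "(?c (x \<omega>), ?d (x \<omega>))"
    have x\<omega>: "x \<omega> \<in> space ?PX" using measurable_space[OF xm \<omega>] .
    have "indicator (?EX (fst z) (snd z)) \<omega> * ?w (fst z) (snd z) =
        (if z = ?z then of_bool (leftmost_in i1 A (x \<omega>) S) * ?w (fst z) (snd z) else 0)" for z
      using \<omega> x\<omega> by (auto simp: indicator_def prod_eq_iff)
    then have "(\<Sum>z\<in>?F. indicator (?EX (fst z) (snd z)) \<omega> * ?w (fst z) (snd z)) =
        (\<Sum>z\<in>?F. if z = ?z then of_bool (leftmost_in i1 A (x \<omega>) S) * ?w (fst z) (snd z) else 0)"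
      by (intro sum.cong) auto
    also have "\<dots> = of_bool (leftmost_in i1 A (x \<omega>) S) * ?w (fst ?z) (snd ?z)"
      using in_F[of "x \<omega>"] by (subst sum.delta[OF finF]) auto
    finally show "(\<Sum>z\<in>?F. indicator (?EX (fst z) (snd z)) \<omega> * ?w (fst z) (snd z)) =
        p n ^ card (edges \<Gamma>) * copy_weight \<Gamma> (p n) i1 A r (x \<omega>) S * (1 - p n) ^ card (?d (x \<omega>))"
      by (simp add: copy_weight_def)
  qed simp
  finally show "prob ?ev = (\<integral>\<omega>. p n ^ card (edges \<Gamma>) * copy_weight \<Gamma> (p n) i1 A r (x \<omega>) S *
        (1 - p n) ^ card (cross_pairs r (x \<omega>) S {1..n}) \<partial>M)" .
qed


lemma integral_product_reindex:
  assumes \<pi>: "bij_betw \<pi> I S" and I: "finite I" "I \<noteq> {}"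
    and F: "F \<in> borel_measurable (Pi\<^sub>M I (\<lambda>_. mu))"
  shows "(\<integral>y. F (\<lambda>i\<in>I. y (\<pi> i)) \<partial>Pi\<^sub>M S (\<lambda>_. mu)) = (\<integral>y. F y \<partial>Pi\<^sub>M I (\<lambda>_. mu) :: real)"
proof -
  have inj: "inj_on \<pi> I" "\<pi> \<in> I \<rightarrow> S" using \<pi> by (auto simp: bij_betw_def)
  have "distr (Pi\<^sub>M S (\<lambda>_. mu)) (Pi\<^sub>M I (\<lambda>_. mu)) (\<lambda>y. \<lambda>i\<in>I. y (\<pi> i)) = Pi\<^sub>M I (\<lambda>_. mu)"
    by (rule distr_PiM_reindex[OF _ inj]) (rule mu_prob)
  moreover have "(\<lambda>y. \<lambda>i\<in>I. y (\<pi> i)) \<in> measurable (Pi\<^sub>M S (\<lambda>_. mu)) (Pi\<^sub>M I (\<lambda>_. mu))"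
    by (rule measurable_restrict, rule measurable_component_singleton) (use inj in auto)
  ultimately show ?thesis using integral_distr[OF _ F] by metis
qed

text \<open>Conditionally on the points in \<open>S\<close>, the other points contribute independent identical factors, so
integrating them out produces a power. The remaining integral does not depend on which \<open>k\<close> indices
form \<open>S\<close>.\<close>

lemma integral_isolated_copy:
  fixes q :: real
  assumes S: "S \<subseteq> {1..n}" "card S = k" "k \<ge> 1" and q: "0 \<le> q" "q \<le> 1" and A: "A \<in> sets borel"
  shows "(\<integral>y. copy_weight \<Gamma> q i1 A r y S * (1 - q) ^ card (cross_pairs r y S {1..n}) \<partial>Pi\<^sub>M {1..n} (\<lambda>_. mu)) =
    (\<integral>y. copy_weight \<Gamma> q i1 A r y {..<k} * (\<integral>u. (1 - q) ^ near r y {..<k} u \<partial>mu) ^ (n - k)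
      \<partial>Pi\<^sub>M {..<k} (\<lambda>_. mu))"
proof -
  let ?N = "{1..n}" and ?J = "{1..n} - S"
  interpret mu: prob_space mu by (rule mu_prob)
  interpret P: product_sigma_finite "\<lambda>_::nat. mu" by standard
  interpret N: prob_space "Pi\<^sub>M ?N (\<lambda>_. mu)" by (intro prob_space_PiM mu_prob)
  have fin: "finite S" "finite ?J" using S finite_subset by auto
  have un: "S \<union> ?J = ?N" using S by auto
  have cardJ: "card ?J = n - k" using S fin by (simp add: card_Diff_subset)
  have comp: "(\<lambda>y. y i) \<in> borel_measurable (Pi\<^sub>M I (\<lambda>_. mu))" if "i \<in> I" for i :: nat and I
    using measurable_component_singleton[OF that, of "\<lambda>_. mu"] by simp
  let ?F = "\<lambda>y. copy_weight \<Gamma> q i1 A r y S * (\<Prod>j\<in>?J. (1 - q) ^ near r y S (y j))"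
  have Fm: "?F \<in> borel_measurable (Pi\<^sub>M ?N (\<lambda>_. mu))"
    by (intro borel_measurable_times measurable_copy_weight borel_measurable_prod measurable_near_power fin A comp)
      (use S in auto)
  have bound: "\<bar>?F y\<bar> \<le> 2 ^ 2 ^ card S" for y
  proof -
    have "0 \<le> (\<Prod>j\<in>?J. (1 - q) ^ near r y S (y j))" "(\<Prod>j\<in>?J. (1 - q) ^ near r y S (y j)) \<le> 1"
      using q by (auto intro!: prod_nonneg prod_le_1 power_le_one)
    then show ?thesis
      using mult_mono[OF copy_weight_le[OF q fin(1), of \<Gamma> i1 A r y], of "\<Prod>j\<in>?J. (1 - q) ^ near r y S (y j)" 1]
        copy_weight_nonneg[OF q(2), of \<Gamma> i1 A r y S] by (simp add: abs_mult)
  qed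
  have int: "integrable (Pi\<^sub>M (S \<union> ?J) (\<lambda>_. mu)) ?F" unfolding un
    by (rule N.integrable_const_bound[OF _ Fm]) (use bound in auto)
  have "(\<integral>y. copy_weight \<Gamma> q i1 A r y S * (1 - q) ^ card (cross_pairs r y S ?N) \<partial>Pi\<^sub>M ?N (\<lambda>_. mu)) =
      (\<integral>y. ?F y \<partial>Pi\<^sub>M (S \<union> ?J) (\<lambda>_. mu))"
    unfolding un using fin by (simp add: card_cross_pairs power_sum)
  also have "\<dots> = (\<integral>y. (\<integral>z. ?F (merge S ?J (y, z)) \<partial>Pi\<^sub>M ?J (\<lambda>_. mu)) \<partial>Pi\<^sub>M S (\<lambda>_. mu))"
    by (rule P.product_integral_fold[OF _ fin int]) auto
  also have "\<dots> = (\<integral>y. copy_weight \<Gamma> q i1 A r y S * (\<integral>u. (1 - q) ^ near r y S u \<partial>mu) ^ (n - k) \<partial>Pi\<^sub>M S (\<lambda>_. mu))"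
  proof (rule Bochner_Integration.integral_cong[OF refl])
    fix y
    have "?F (merge S ?J (y, z)) = copy_weight \<Gamma> q i1 A r y S * (\<Prod>j\<in>?J. (1 - q) ^ near r y S (z j))" for z
    proof -
      have m: "merge S ?J (y, z) i = y i" if "i \<in> S" for i using that by simp
      have "copy_weight \<Gamma> q i1 A r (merge S ?J (y, z)) S = copy_weight \<Gamma> q i1 A r y S"
        by (rule copy_weight_cong) (rule m)
      moreover have "near r (merge S ?J (y, z)) S = near r y S" by (rule near_cong) (rule m)
      moreover have "(\<Prod>j\<in>?J. (1 - q) ^ near r y S (merge S ?J (y, z) j)) = (\<Prod>j\<in>?J. (1 - q) ^ near r y S (z j))"
        by (rule prod.cong) simp_all
      ultimately show ?thesis by simp
    qed
    then have "(\<integral>z. ?F (merge S ?J (y, z)) \<partial>Pi\<^sub>M ?J (\<lambda>_. mu)) =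
        copy_weight \<Gamma> q i1 A r y S * (\<integral>z. (\<Prod>j\<in>?J. (1 - q) ^ near r y S (z j)) \<partial>Pi\<^sub>M ?J (\<lambda>_. mu))"
      by simp
    also have "(\<integral>z. (\<Prod>j\<in>?J. (1 - q) ^ near r y S (z j)) \<partial>Pi\<^sub>M ?J (\<lambda>_. mu)) =
        (\<Prod>j\<in>?J. \<integral>u. (1 - q) ^ near r y S u \<partial>mu)"
    proof (rule P.product_integral_prod[OF fin(2)])
      have "(\<lambda>u. (1 - q) ^ near r y S u) \<in> borel_measurable mu"
        by (rule measurable_near_power[OF fin(1)]) auto
      then show "integrable mu (\<lambda>u. (1 - q) ^ near r y S u)"
        by (intro mu.integrable_const_bound[of _ 1]) (use q in \<open>auto intro!: power_le_one\<close>)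
    qed
    finally show "(\<integral>z. ?F (merge S ?J (y, z)) \<partial>Pi\<^sub>M ?J (\<lambda>_. mu)) =
        copy_weight \<Gamma> q i1 A r y S * (\<integral>u. (1 - q) ^ near r y S u \<partial>mu) ^ (n - k)"
      by (simp only: prod_constant cardJ)
  qed
  also have "\<dots> = (\<integral>y. copy_weight \<Gamma> q i1 A r y {..<k} * (\<integral>u. (1 - q) ^ near r y {..<k} u \<partial>mu) ^ (n - k)
      \<partial>Pi\<^sub>M {..<k} (\<lambda>_. mu))"
  proof -
    let ?I = "{..<k}"
    let ?G = "\<lambda>y. copy_weight \<Gamma> q i1 A r y ?I * (\<integral>u. (1 - q) ^ near r y ?I u \<partial>mu) ^ (n - k)"
    have "\<exists>\<pi>. bij_betw \<pi> ?I S" using S(2) fin(1) ex_bij_betw_nat_finite[of S] by (simp add: atLeast0LessThan)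
    then obtain \<pi> where \<pi>: "bij_betw \<pi> ?I S" by blast
    then have inj: "inj_on \<pi> ?I" and im: "\<pi> ` ?I = S" by (auto simp: bij_betw_def)
    have Gm: "?G \<in> borel_measurable (Pi\<^sub>M ?I (\<lambda>_. mu))"
    proof (intro borel_measurable_times borel_measurable_power mu.borel_measurable_lebesgue_integral)
      show "(\<lambda>y. copy_weight \<Gamma> q i1 A r y ?I) \<in> borel_measurable (Pi\<^sub>M ?I (\<lambda>_. mu))"
        by (rule measurable_copy_weight[OF _ comp A]) auto
      show "(\<lambda>(y, u). (1 - q) ^ near r y ?I u) \<in> borel_measurable (Pi\<^sub>M ?I (\<lambda>_. mu) \<Otimes>\<^sub>M mu)"
        unfolding case_prod_beta
      proof (rule measurable_near_power)
        show "(\<lambda>z. fst z i) \<in> borel_measurable (Pi\<^sub>M ?I (\<lambda>_. mu) \<Otimes>\<^sub>M mu)" if "i \<in> ?I" for i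
          by (rule measurable_compose[OF measurable_fst comp[OF that]])
        show "snd \<in> borel_measurable (Pi\<^sub>M ?I (\<lambda>_. mu) \<Otimes>\<^sub>M mu)"
          using measurable_snd[of "Pi\<^sub>M ?I (\<lambda>_. mu)" mu] by simp
      qed simp
    qed
    have G: "?G (\<lambda>i\<in>?I. y (\<pi> i)) =
        copy_weight \<Gamma> q i1 A r y S * (\<integral>u. (1 - q) ^ near r y S u \<partial>mu) ^ (n - k)" for y
    proof -
      have c: "copy_weight \<Gamma> q i1 A r (\<lambda>i\<in>?I. y (\<pi> i)) ?I = copy_weight \<Gamma> q i1 A r (y \<circ> \<pi>) ?I"
        by (rule copy_weight_cong) simp
      have d: "near r (\<lambda>i\<in>?I. y (\<pi> i)) ?I = near r (y \<circ> \<pi>) ?I" by (rule near_cong) simp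
      show ?thesis unfolding c d copy_weight_reindex[OF inj, symmetric] near_reindex[OF inj, symmetric] im ..
    qed
    show ?thesis
      using integral_product_reindex[OF \<pi> _ _ Gm] S(3) unfolding G by (auto simp: lessThan_empty_iff)
  qed
  finally show ?thesis .
qed

lemma percolated_graph_restrict:
  "percolated_graph n (\<lambda>i\<in>{1..n}. y i) keep r = percolated_graph n y keep r"
  unfolding percolated_graph_def by (auto simp: image_restrict_eq restrict_apply)

theorem expected_component_count:
  assumes n: "n \<ge> 1" and A: "A \<in> sets borel" and \<Gamma>: "simple_graph \<Gamma>" "connected_graph \<Gamma>"
    and q: "0 \<le> p n" "p n \<le> 1" and k: "card (verts \<Gamma>) = k"
  shows "(\<integral>\<omega>. real (component_count i1 A \<Gamma>
              (percolated_graph n (\<lambda>i. X i \<omega>) (\<lambda>e. K n e \<omega>) r)) \<partial>M) =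
    real (n choose k) * p n ^ card (edges \<Gamma>) *
      (\<integral>y. copy_weight \<Gamma> (p n) i1 A r y {..<k} * (\<integral>u. (1 - p n) ^ near r y {..<k} u \<partial>mu) ^ (n - k)
        \<partial>Pi\<^sub>M {..<k} (\<lambda>_. mu))" (is "?E = _ * ?m * ?Q")
proof -
  let ?N = "{1..n}"
  let ?x = "\<lambda>\<omega>. \<lambda>i\<in>?N. X i \<omega>"
  let ?ev = "\<lambda>S. {\<omega> \<in> space M. isolated_copy \<Gamma> r n (?x \<omega>) (\<lambda>e. K n e \<omega>) S \<and> leftmost_in i1 A (?x \<omega>) S}"
  let ?F = "{S. S \<subseteq> ?N \<and> card S = k}"
  have k1: "k \<ge> 1"
    using k \<Gamma> simple_graphD(1)[OF \<Gamma>(1)] by (auto simp: connected_graph_def Suc_le_eq card_gt_0_iff)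
  have finF: "finite ?F" by (rule finite_subset[of _ "Pow ?N"]) auto
  have ev: "?ev S \<in> events" if "S \<in> ?F" for S
    by (rule prob_isolated_copy(1)[OF n _ \<Gamma>(1) A]) (use that k k1 in auto)
  have "?E = (\<integral>\<omega>. (\<Sum>S\<in>?F. indicator (?ev S) \<omega>) \<partial>M)"
  proof (rule integral_cong_AE)
    show "(\<lambda>\<omega>. real (component_count i1 A \<Gamma> (percolated_graph n (\<lambda>i. X i \<omega>) (\<lambda>e. K n e \<omega>) r))) \<in> borel_measurable M"
      by (rule component_count_measurable[OF _ _ A]) (use X_meas K_meas[OF n] in auto)
    show "(\<lambda>\<omega>. (\<Sum>S\<in>?F. indicator (?ev S) \<omega>) :: real) \<in> borel_measurable M"
      using ev by (intro borel_measurable_sum borel_measurable_indicator)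
    show "AE \<omega> in M. real (component_count i1 A \<Gamma> (percolated_graph n (\<lambda>i. X i \<omega>) (\<lambda>e. K n e \<omega>) r)) =
        (\<Sum>S\<in>?F. indicator (?ev S) \<omega>)"
      using AE_points_distinct[of n] AE_space
    proof eventually_elim
      fix \<omega> assume inj: "inj_on (\<lambda>i. X i \<omega>) ?N" and \<omega>: "\<omega> \<in> space M"
      have inj': "inj_on (?x \<omega>) ?N" using inj by (simp add: inj_on_restrict_eq)
      have "isolated_copy \<Gamma> r n (?x \<omega>) (\<lambda>e. K n e \<omega>) S \<Longrightarrow> card S = k" if S: "S \<subseteq> ?N" for S
      proof -
        assume "isolated_copy \<Gamma> r n (?x \<omega>) (\<lambda>e. K n e \<omega>) S"
        then have iso: "graph_iso (S, {e \<in> close_pairs r (?x \<omega>) S. K n e \<omega>}) \<Gamma>" by (simp add: isolated_copy_def)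
        have "simple_graph (S, {e \<in> close_pairs r (?x \<omega>) S. K n e \<omega>})"
          using simple_graph_close_pairs[of S r "?x \<omega>"] S finite_subset by (auto simp: simple_graph_def)
        then show "card S = k" using graph_iso_card(1)[OF iso _ \<Gamma>(1)] k by simp
      qed
      then have eq: "{S. S \<subseteq> ?N \<and> isolated_copy \<Gamma> r n (?x \<omega>) (\<lambda>e. K n e \<omega>) S \<and> leftmost_in i1 A (?x \<omega>) S} =
          {S \<in> ?F. \<omega> \<in> ?ev S}" using \<omega> by blast
      have count: "component_count i1 A \<Gamma> (percolated_graph n (\<lambda>i. X i \<omega>) (\<lambda>e. K n e \<omega>) r) = card {S \<in> ?F. \<omega> \<in> ?ev S}"
        unfolding percolated_graph_restrict[of n "\<lambda>i. X i \<omega>", symmetric]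
          component_count_eq_isolated_copies[OF \<Gamma> inj'] eq ..
      have "real (card {S \<in> ?F. \<omega> \<in> ?ev S}) = (\<Sum>S\<in>?F. indicator (?ev S) \<omega>)"
        unfolding indicator_def using finF by (simp only: of_bool_def sum.If_cases sum_constant Int_def mem_Collect_eq)
      then show "real (component_count i1 A \<Gamma> (percolated_graph n (\<lambda>i. X i \<omega>) (\<lambda>e. K n e \<omega>) r)) =
        (\<Sum>S\<in>?F. indicator (?ev S) \<omega>)" unfolding count .
    qed
  qed
  also have "\<dots> = (\<Sum>S\<in>?F. \<integral>\<omega>. indicator (?ev S) \<omega> \<partial>M)"
    using ev by (intro Bochner_Integration.integral_sum integrable_real_indicator) (auto simp: emeasure_eq_measure)
  also have "\<dots> = (\<Sum>S\<in>?F. ?m * ?Q)"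
  proof (rule sum.cong[OF refl])
    fix S assume S: "S \<in> ?F"
    have xm: "?x \<in> measurable M (Pi\<^sub>M ?N (\<lambda>_. borel))"
      by (rule measurable_restrict) (use X_meas in auto)
    have distr: "distr M (Pi\<^sub>M ?N (\<lambda>_. borel)) ?x = Pi\<^sub>M ?N (\<lambda>_. mu)"
      by (rule points_distr) (use n in auto)
    have "finite S" using S finite_subset by auto
    have comp: "(\<lambda>y. y i) \<in> borel_measurable (Pi\<^sub>M ?N (\<lambda>_. borel))" if "i \<in> ?N" for i
      using that by (rule measurable_component_singleton)
    let ?G = "\<lambda>y. ?m * (copy_weight \<Gamma> (p n) i1 A r y S * (1 - p n) ^ card (cross_pairs r y S ?N))"
    have "(\<integral>\<omega>. indicator (?ev S) \<omega> \<partial>M) = prob (?ev S)" using ev[OF S] by simp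
    also have "\<dots> = (\<integral>\<omega>. ?G (?x \<omega>) \<partial>M)"
      by (subst prob_isolated_copy(2)[OF n _ \<Gamma>(1) A]) (use S k k1 in \<open>auto simp: mult.assoc\<close>)
    also have "\<dots> = (\<integral>y. ?G y \<partial>distr M (Pi\<^sub>M ?N (\<lambda>_. borel)) ?x)"
    proof (rule integral_distr[symmetric, OF xm])
      have "(\<lambda>y. (1 - p n) ^ card (cross_pairs r y S ?N)) = (\<lambda>y. \<Prod>j\<in>?N - S. (1 - p n) ^ near r y S (y j))"
        using \<open>finite S\<close> by (simp add: card_cross_pairs power_sum)
      also have "\<dots> \<in> borel_measurable (Pi\<^sub>M ?N (\<lambda>_. borel))"
        by (intro borel_measurable_prod measurable_near_power comp) (use S \<open>finite S\<close> in auto)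
      finally have [measurable]: "(\<lambda>y. (1 - p n) ^ card (cross_pairs r y S ?N)) \<in> borel_measurable (Pi\<^sub>M ?N (\<lambda>_. borel))" .
      have [measurable]: "(\<lambda>y. copy_weight \<Gamma> (p n) i1 A r y S) \<in> borel_measurable (Pi\<^sub>M ?N (\<lambda>_. borel))"
        by (rule measurable_copy_weight[OF \<open>finite S\<close> comp A]) (use S in auto)
      show "?G \<in> borel_measurable (Pi\<^sub>M ?N (\<lambda>_. borel))" by measurable
    qed
    also have "\<dots> = ?m * ?Q" unfolding distr
      using integral_isolated_copy[of S n k "p n" A \<Gamma> i1 r] S k1 q A by simp
    finally show "(\<integral>\<omega>. indicator (?ev S) \<omega> \<partial>M) = ?m * ?Q" .
  qed
  also have "\<dots> = real (card ?F) * (?m * ?Q)" by simp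
  also have "card ?F = n choose k" using n_subsets[of ?N k] by simp
  finally show ?thesis by simp
qed

end

section \<open>Continuity of translations in mean\<close>

lemma ennreal_tendsto_0I:
  fixes X :: "nat \<Rightarrow> ennreal"
  assumes "\<And>e::real. 0 < e \<Longrightarrow> eventually (\<lambda>n. X n \<le> ennreal e) sequentially"
  shows "X \<longlonglongrightarrow> 0"
proof (rule order_tendstoI)
  fix a :: ennreal assume "0 < a"
  then obtain b where b: "0 < b" "b < a" using dense by blast
  then have "b < top" using top.not_eq_extremum by (metis less_trans top_greatest less_le)
  then obtain e where e: "b = ennreal e" "0 < e" using b
    by (cases b) (auto simp: ennreal_less_zero_iff)
  show "eventually (\<lambda>n. X n < a) sequentially"
    using assms[OF e(2)] by eventually_elim (use b e in auto)
qed simp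

lemma ennreal_tendsto_0D:
  fixes X :: "nat \<Rightarrow> ennreal" and e :: real
  assumes "X \<longlonglongrightarrow> 0" "0 < e"
  shows "eventually (\<lambda>n. X n \<le> ennreal e) sequentially"
  using order_tendstoD(2)[OF assms(1), of "ennreal e"] assms(2)
  by (auto elim: eventually_mono simp: less_imp_le)

text \<open>The modulus of continuity in \<open>L\<^sup>1\<close>. It takes values in \<^typ>\<open>ennreal\<close> so that no
integrability has to be carried along.\<close>

definition shift_dist :: "('a::euclidean_space \<Rightarrow> real) \<Rightarrow> 'a \<Rightarrow> ennreal" where
  "shift_dist f v = (\<integral>\<^sup>+x. ennreal \<bar>f (x + v) - f x\<bar> \<partial>lborel)"

lemma nn_integral_shift:
  fixes g :: "'a::euclidean_space \<Rightarrow> ennreal"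
  assumes "g \<in> borel_measurable borel"
  shows "(\<integral>\<^sup>+x. g (x + v) \<partial>lborel) = (\<integral>\<^sup>+x. g x \<partial>lborel)"
proof -
  have "(\<integral>\<^sup>+x. g x \<partial>lborel) = (\<integral>\<^sup>+x. g x \<partial>distr lborel borel ((+) v))"
    by (simp add: lborel_distr_plus)
  also have "\<dots> = (\<integral>\<^sup>+x. g (x + v) \<partial>lborel)"
    by (subst nn_integral_distr) (use assms in \<open>simp_all add: add.commute\<close>)
  finally show ?thesis by simp
qed

lemma shift_dist_triangle:
  fixes f g :: "'a::euclidean_space \<Rightarrow> real"
  assumes [measurable]: "f \<in> borel_measurable borel" "g \<in> borel_measurable borel"
  shows "shift_dist f v \<le> shift_dist g v + 2 * (\<integral>\<^sup>+x. ennreal \<bar>f x - g x\<bar> \<partial>lborel)"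
proof -
  have "shift_dist f v \<le> (\<integral>\<^sup>+x. ennreal \<bar>f (x + v) - g (x + v)\<bar> + (ennreal \<bar>g (x + v) - g x\<bar>
      + ennreal \<bar>f x - g x\<bar>) \<partial>lborel)"
    unfolding shift_dist_def
    by (intro nn_integral_mono) (simp flip: ennreal_plus)
  also have "\<dots> = (\<integral>\<^sup>+x. ennreal \<bar>f (x + v) - g (x + v)\<bar> \<partial>lborel) + (shift_dist g v
      + (\<integral>\<^sup>+x. ennreal \<bar>f x - g x\<bar> \<partial>lborel))"
    unfolding shift_dist_def by (simp add: nn_integral_add)
  also have "(\<integral>\<^sup>+x. ennreal \<bar>f (x + v) - g (x + v)\<bar> \<partial>lborel) = (\<integral>\<^sup>+x. ennreal \<bar>f x - g x\<bar> \<partial>lborel)"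
    by (rule nn_integral_shift[of "\<lambda>x. ennreal \<bar>f x - g x\<bar>"]) measurable
  finally show ?thesis by (simp add: mult_2 algebra_simps)
qed

lemma shift_dist_add:
  fixes f g :: "'a::euclidean_space \<Rightarrow> real"
  assumes [measurable]: "f \<in> borel_measurable borel" "g \<in> borel_measurable borel"
  shows "shift_dist (\<lambda>x. f x + g x) v \<le> shift_dist f v + shift_dist g v"
proof -
  have "shift_dist (\<lambda>x. f x + g x) v \<le> (\<integral>\<^sup>+x. ennreal \<bar>f (x + v) - f x\<bar> + ennreal \<bar>g (x + v) - g x\<bar> \<partial>lborel)"
    unfolding shift_dist_def by (intro nn_integral_mono) (simp flip: ennreal_plus)
  also have "\<dots> = shift_dist f v + shift_dist g v"
    unfolding shift_dist_def by (simp add: nn_integral_add)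
  finally show ?thesis .
qed

text \<open>Since the Lebesgue measure is translation invariant, an approximation in \<open>L\<^sup>1\<close> costs its error twice,
uniformly in the translation. So the functions on which translations act continuously form a closed set.\<close>

lemma shift_dist_tendsto_0_approx:
  fixes f :: "'a::euclidean_space \<Rightarrow> real"
  assumes f: "f \<in> borel_measurable borel"
    and approx: "\<And>e::real. 0 < e \<Longrightarrow> \<exists>g. g \<in> borel_measurable borel \<and>
      (\<integral>\<^sup>+x. ennreal \<bar>f x - g x\<bar> \<partial>lborel) \<le> ennreal e \<and> (\<lambda>n. shift_dist g (h n)) \<longlonglongrightarrow> 0"
  shows "(\<lambda>n. shift_dist f (h n)) \<longlonglongrightarrow> 0"
proof (rule ennreal_tendsto_0I)
  fix e :: real assume e: "0 < e"
  then obtain g where g: "g \<in> borel_measurable borel"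
      "(\<integral>\<^sup>+x. ennreal \<bar>f x - g x\<bar> \<partial>lborel) \<le> ennreal (e / 4)" "(\<lambda>n. shift_dist g (h n)) \<longlonglongrightarrow> 0"
    using approx[of "e / 4"] by auto
  have "eventually (\<lambda>n. shift_dist g (h n) \<le> ennreal (e / 2)) sequentially"
    using g(3) e by (intro ennreal_tendsto_0D) auto
  then show "eventually (\<lambda>n. shift_dist f (h n) \<le> ennreal e) sequentially"
  proof eventually_elim
    case (elim n)
    have "shift_dist f (h n) \<le> shift_dist g (h n) + 2 * (\<integral>\<^sup>+x. ennreal \<bar>f x - g x\<bar> \<partial>lborel)"
      using f g(1) by (rule shift_dist_triangle)
    also have "\<dots> \<le> ennreal (e / 2) + 2 * ennreal (e / 4)"
      using elim g(2) by (intro add_mono mult_left_mono) auto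
    also have "\<dots> = ennreal e" using e by (simp add: mult_2 flip: ennreal_plus)
    finally show ?case .
  qed
qed

text \<open>For an open set of finite measure the indicator is lower semicontinuous, which controls the points leaving the set under a
small translation. The points entering it have the same measure, because the translated set has.\<close>

lemma shift_dist_indicator_open:
  fixes U :: "'a::euclidean_space set"
  assumes U: "open U" "emeasure lborel U < \<infinity>" and h: "h \<longlonglongrightarrow> 0"
  shows "(\<lambda>n. shift_dist (\<lambda>x. indicator U x * c) (h n)) \<longlonglongrightarrow> 0"
proof -
  have [measurable]: "U \<in> sets borel" using U by simp
  let ?I = "\<lambda>v. (\<integral>\<^sup>+x. indicator U x * (1 - indicator U (x + v)) \<partial>lborel) :: ennreal"
  have eq: "shift_dist (indicator U) v = 2 * ?I v" for v
  proof -
    (* For indicators |b - a| + a = b + 2 a (1 - b); the integrals of a and b agree and cancel. *)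
    have "shift_dist (indicator U) v + emeasure lborel U =
        (\<integral>\<^sup>+x. ennreal \<bar>indicator U (x + v) - indicator U x\<bar> + indicator U x \<partial>lborel)"
      unfolding shift_dist_def by (subst nn_integral_add) auto
    also have "\<dots> = (\<integral>\<^sup>+x. indicator U (x + v) + 2 * (indicator U x * (1 - indicator U (x + v))) \<partial>lborel)"
      by (intro nn_integral_cong) (auto simp: indicator_def)
    also have "\<dots> = (\<integral>\<^sup>+x. indicator U (x + v) \<partial>lborel) + 2 * ?I v"
      by (subst nn_integral_add) (auto simp: nn_integral_cmult)
    also have "(\<integral>\<^sup>+x. indicator U (x + v) \<partial>lborel) = emeasure lborel U"
      using nn_integral_shift[of "indicator U" v] by simp
    finally show ?thesis using U(2) by (auto simp: add.commute ennreal_add_left_cancel)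
  qed
  have "(\<lambda>n. ?I (h n)) \<longlonglongrightarrow> (\<integral>\<^sup>+x. 0 \<partial>(lborel :: 'a measure))"
  proof (rule nn_integral_dominated_convergence[where w = "indicator U"])
    show "AE x in lborel. indicator U x * (1 - indicator U (x + h n)) \<le> (indicator U x :: ennreal)" for n
      by (auto simp: indicator_def)
    show "AE x in lborel. (\<lambda>n. indicator U x * (1 - indicator U (x + h n)) :: ennreal) \<longlonglongrightarrow> 0"
    proof (rule AE_I2)
      fix x :: 'a
      have lim: "(\<lambda>n. x + h n) \<longlonglongrightarrow> x" using tendsto_add[OF tendsto_const[of x] h] by simp
      show "(\<lambda>n. indicator U x * (1 - indicator U (x + h n)) :: ennreal) \<longlonglongrightarrow> 0"
      proof (cases "x \<in> U")
        case True
        then have "eventually (\<lambda>n. x + h n \<in> U) sequentially"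
          using topological_tendstoD[OF lim U(1)] by simp
        then show ?thesis by (rule tendsto_eventually[OF eventually_mono]) simp
      qed simp
    qed
  qed (use U in auto)
  then have "(\<lambda>n. ennreal \<bar>c\<bar> * (2 * ?I (h n))) \<longlonglongrightarrow> ennreal \<bar>c\<bar> * (2 * 0)"
    by (intro ennreal_tendsto_cmult) simp_all
  moreover have "shift_dist (\<lambda>x. indicator U x * c) v = ennreal \<bar>c\<bar> * (2 * ?I v)" for v
    unfolding eq[symmetric] shift_dist_def
    by (subst nn_integral_cmult[symmetric])
      (auto simp: ennreal_mult[symmetric] abs_mult[symmetric] right_diff_distrib mult.commute
        intro!: nn_integral_cong)
  ultimately show ?thesis by simp
qed

text \<open>Translations act continuously on \<open>L\<^sup>1\<close>. Indicators of measurable sets are reached from open sets by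
outer regularity, and the rest by linearity and dominated approximation.\<close>

lemma shift_dist_tendsto_0:
  fixes f :: "'a::euclidean_space \<Rightarrow> real"
  assumes "integrable lborel f" and h: "h \<longlonglongrightarrow> 0"
  shows "(\<lambda>n. shift_dist f (h n)) \<longlonglongrightarrow> 0"
  using assms(1)
proof (induction rule: integrable_induct)
  case (base A c)
  show ?case
  proof (rule shift_dist_tendsto_0_approx)
    show "(\<lambda>x. indicator A x *\<^sub>R c) \<in> borel_measurable borel" using base by auto
    fix e :: real assume e: "0 < e"
    have pos: "0 < e / (\<bar>c\<bar> + 1)" using e by simp
    have A: "A \<in> sets borel" using base by simp
    obtain U where U: "open U" "A \<subseteq> U" "emeasure lborel (U - A) < ennreal (e / (\<bar>c\<bar> + 1))"
      using outer_regular_lborel[OF A pos] by blast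
    have [measurable]: "U \<in> sets borel" "A \<in> sets borel" using U A by auto
    have "emeasure lborel U = emeasure lborel A + emeasure lborel (U - A)"
      using U by (subst plus_emeasure) (auto intro!: arg_cong[where f = "emeasure lborel"])
    also have "\<dots> < \<infinity>" using base(2) U(3) by (auto simp: less_top[symmetric] top_unique)
    finally have fin: "emeasure lborel U < \<infinity>" .
    have "(\<integral>\<^sup>+x. ennreal \<bar>indicator A x *\<^sub>R c - indicator U x * c\<bar> \<partial>lborel) =
        (\<integral>\<^sup>+x. ennreal \<bar>c\<bar> * indicator (U - A) x \<partial>lborel)"
      using U(2) by (intro nn_integral_cong) (auto simp: indicator_def)
    also have "\<dots> = ennreal \<bar>c\<bar> * emeasure lborel (U - A)" by (simp add: nn_integral_cmult)
    also have "\<dots> \<le> ennreal \<bar>c\<bar> * ennreal (e / (\<bar>c\<bar> + 1))" using U(3) by (intro mult_left_mono) auto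
    also have "\<dots> = ennreal (\<bar>c\<bar> * (e / (\<bar>c\<bar> + 1)))" using e by (subst ennreal_mult) auto
    also have "\<dots> \<le> ennreal e" using e by (intro ennreal_leI) (simp add: field_simps)
    finally show "\<exists>g. g \<in> borel_measurable borel \<and>
        (\<integral>\<^sup>+x. ennreal \<bar>indicator A x *\<^sub>R c - g x\<bar> \<partial>lborel) \<le> ennreal e \<and> (\<lambda>n. shift_dist g (h n)) \<longlonglongrightarrow> 0"
      using shift_dist_indicator_open[OF U(1) fin h, of c]
      by (intro exI[of _ "\<lambda>x. indicator U x * c"]) simp
  qed
next
  case (add f g)
  have fg: "f \<in> borel_measurable borel" "g \<in> borel_measurable borel" using add by auto
  have "(\<lambda>n. shift_dist f (h n) + shift_dist g (h n)) \<longlonglongrightarrow> 0 + 0" using add by (intro tendsto_add)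
  then show ?case
    by (intro tendsto_sandwich[of "\<lambda>_. 0" "\<lambda>n. shift_dist (\<lambda>x. f x + g x) (h n)"])
      (auto intro!: always_eventually shift_dist_add[OF fg])
next
  case (lim f s)
  have [measurable]: "f \<in> borel_measurable borel" "s i \<in> borel_measurable borel" for i using lim by auto
  show ?case
  proof (rule shift_dist_tendsto_0_approx)
    show "f \<in> borel_measurable borel" by measurable
    fix e :: real assume e: "0 < e"
    have "(\<lambda>i. \<integral>\<^sup>+x. ennreal \<bar>f x - s i x\<bar> \<partial>lborel) \<longlonglongrightarrow> (\<integral>\<^sup>+x. 0 \<partial>(lborel :: 'a measure))"
    proof (rule nn_integral_dominated_convergence[where w = "\<lambda>x. ennreal (3 * \<bar>f x\<bar>)"])
      show "AE x in lborel. ennreal \<bar>f x - s i x\<bar> \<le> ennreal (3 * \<bar>f x\<bar>)" for i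
      proof (rule AE_I2, rule ennreal_leI)
        fix x :: 'a
        have "\<bar>s i x\<bar> \<le> 2 * \<bar>f x\<bar>" using lim(3)[of x i] by simp
        then show "\<bar>f x - s i x\<bar> \<le> 3 * \<bar>f x\<bar>" by linarith
      qed
      have "integrable lborel (\<lambda>x. 3 * \<bar>f x\<bar>)" using lim by auto
      then show "(\<integral>\<^sup>+x. ennreal (3 * \<bar>f x\<bar>) \<partial>lborel) < \<infinity>"
        by (subst nn_integral_eq_integral) auto
      show "AE x in lborel. (\<lambda>i. ennreal \<bar>f x - s i x\<bar>) \<longlonglongrightarrow> 0"
      proof (rule AE_I2)
        fix x :: 'a
        have "(\<lambda>i. \<bar>f x - s i x\<bar>) \<longlonglongrightarrow> \<bar>f x - f x\<bar>" using lim(2)[of x] by (intro tendsto_intros) auto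
        then show "(\<lambda>i. ennreal \<bar>f x - s i x\<bar>) \<longlonglongrightarrow> 0" using tendsto_ennrealI by fastforce
      qed
    qed measurable
    then have "eventually (\<lambda>i. (\<integral>\<^sup>+x. ennreal \<bar>f x - s i x\<bar> \<partial>lborel) \<le> ennreal e) sequentially"
      using e by (intro ennreal_tendsto_0D) auto
    then obtain i where "(\<integral>\<^sup>+x. ennreal \<bar>f x - s i x\<bar> \<partial>lborel) \<le> ennreal e"
      by (auto simp: eventually_sequentially)
    then show "\<exists>g. g \<in> borel_measurable borel \<and> (\<integral>\<^sup>+x. ennreal \<bar>f x - g x\<bar> \<partial>lborel) \<le> ennreal e
        \<and> (\<lambda>n. shift_dist g (h n)) \<longlonglongrightarrow> 0"
      using lim by (intro exI[of _ "s i"]) auto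
  qed
qed

section \<open>Localisation of the density\<close>

text \<open>The Poisson limit \<open>(1 - x) ^ N\<close> with \<open>N x\<close> convergent, where \<open>N\<close> and \<open>x\<close> vary independently. Both
\<open>1 - x\<close> and \<open>exp (- x)\<close> lie in the unit interval and differ by at most \<open>x\<^sup>2\<close>, so their \<open>N\<close>-th powers
differ by at most \<open>N x\<^sup>2\<close>.\<close>

lemma power_tendsto_exp:
  fixes x :: "nat \<Rightarrow> real" and N :: "nat \<Rightarrow> nat"
  assumes x0: "x \<longlonglongrightarrow> 0" and nonneg: "\<And>n. 0 \<le> x n" and lam: "(\<lambda>n. real (N n) * x n) \<longlonglongrightarrow> lam"
  shows "(\<lambda>n. (1 - x n) ^ N n) \<longlonglongrightarrow> exp (- lam)"
proof -
  have "(\<lambda>n. exp (- (real (N n) * x n))) \<longlonglongrightarrow> exp (- lam)" by (intro tendsto_intros lam)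
  moreover have "(\<lambda>n. (1 - x n) ^ N n - exp (- (real (N n) * x n))) \<longlonglongrightarrow> 0"
  proof (rule Lim_null_comparison)
    have "(\<lambda>n. real (N n) * x n * x n) \<longlonglongrightarrow> lam * 0" by (intro tendsto_intros lam x0)
    then show "(\<lambda>n. real (N n) * x n * x n) \<longlonglongrightarrow> 0" by simp
    have "eventually (\<lambda>n. x n < 1) sequentially" using order_tendstoD(2)[OF x0] by simp
    then show "eventually (\<lambda>n. norm ((1 - x n) ^ N n - exp (- (real (N n) * x n))) \<le> real (N n) * x n * x n) sequentially"
    proof eventually_elim
      case (elim n)
      have "exp (- (real (N n) * x n)) = exp (- x n) ^ N n" by (simp add: exp_of_nat_mult[symmetric])
      then have "norm ((1 - x n) ^ N n - exp (- (real (N n) * x n))) \<le> real (N n) * norm ((1 - x n) - exp (- x n))"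
        using norm_power_diff[of "1 - x n" "exp (- x n)" "N n"] nonneg[of n] elim by simp
      also have "norm ((1 - x n) - exp (- x n)) \<le> x n * x n"
      proof -
        have "1 - x n \<le> exp (- x n)" using exp_ge_add_one_self[of "- x n"] by simp
        moreover have "exp (- x n) \<le> 1 / (1 + x n)"
          using exp_ge_add_one_self[of "x n"] nonneg[of n] by (simp add: exp_minus field_simps)
        moreover have "1 / (1 + x n) \<le> 1 - x n + x n * x n"
          using nonneg[of n] by (simp add: field_simps)
        ultimately show ?thesis by simp
      qed
      finally show ?case by (simp add: mult_left_mono mult.assoc)
    qed
  qed
  ultimately have "(\<lambda>n. ((1 - x n) ^ N n - exp (- (real (N n) * x n))) + exp (- (real (N n) * x n))) \<longlonglongrightarrow> 0 + exp (- lam)"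
    by (intro tendsto_add)
  then show ?thesis by simp
qed

lemma lborel_nn_integral_affine:
  fixes g :: "'a::euclidean_space \<Rightarrow> ennreal"
  assumes [measurable]: "g \<in> borel_measurable borel" and r: "r > 0"
  shows "(\<integral>\<^sup>+y. g y \<partial>lborel) = ennreal (r ^ DIM('a)) * (\<integral>\<^sup>+w. g (t + r *\<^sub>R w) \<partial>lborel)"
  using r by (subst lborel_affine[of r t]) (simp_all add: nn_integral_density nn_integral_distr nn_integral_cmult)

lemma lborel_affine_density_integral_le:
  fixes f \<phi> :: "'a::euclidean_space \<Rightarrow> real"
  assumes f: "f \<in> borel_measurable borel" "\<And>x. 0 \<le> f x" "(\<integral>\<^sup>+x. ennreal (f x) \<partial>lborel) = 1"
    and \<phi>: "\<phi> \<in> borel_measurable borel" "\<And>x. 0 \<le> \<phi> x" "\<And>x. \<phi> x \<le> 1" and r: "r > 0"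
  shows "integrable lborel (\<lambda>w. \<phi> w * f (t + r *\<^sub>R w))"
    and "0 \<le> r ^ DIM('a) * (\<integral>w. \<phi> w * f (t + r *\<^sub>R w) \<partial>lborel)"
    and "r ^ DIM('a) * (\<integral>w. \<phi> w * f (t + r *\<^sub>R w) \<partial>lborel) \<le> 1"
proof -
  note [measurable] = f(1) \<phi>(1)
  have 1: "ennreal (r ^ DIM('a)) * (\<integral>\<^sup>+w. ennreal (f (t + r *\<^sub>R w)) \<partial>lborel) = 1"
    using lborel_nn_integral_affine[of "\<lambda>x. ennreal (f x)" r t] f r by simp
  have fin: "integrable lborel (\<lambda>w. f (t + r *\<^sub>R w))"
  proof (rule integrableI_nonneg)
    show "(\<integral>\<^sup>+w. ennreal (f (t + r *\<^sub>R w)) \<partial>lborel) < \<infinity>"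
    proof (rule ccontr)
      assume "\<not> ?thesis"
      then have "(\<integral>\<^sup>+w. ennreal (f (t + r *\<^sub>R w)) \<partial>lborel) = \<top>" by (simp add: less_top[symmetric])
      then show False using 1 r by (simp add: ennreal_mult_top)
    qed
  qed (use f in auto)
  show int: "integrable lborel (\<lambda>w. \<phi> w * f (t + r *\<^sub>R w))"
    by (rule Bochner_Integration.integrable_bound[OF fin])
      (use f(2) \<phi>(2,3) in \<open>auto simp: abs_mult intro!: mult_left_le_one_le\<close>)
  show "0 \<le> r ^ DIM('a) * (\<integral>w. \<phi> w * f (t + r *\<^sub>R w) \<partial>lborel)"
    using f(2) \<phi>(2) r by (intro mult_nonneg_nonneg integral_nonneg_AE) auto
  have "(\<integral>w. \<phi> w * f (t + r *\<^sub>R w) \<partial>lborel) \<le> (\<integral>w. f (t + r *\<^sub>R w) \<partial>lborel)"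
    by (rule integral_mono[OF int fin]) (use f(2) \<phi>(2,3) in \<open>auto intro!: mult_left_le_one_le\<close>)
  then have "r ^ DIM('a) * (\<integral>w. \<phi> w * f (t + r *\<^sub>R w) \<partial>lborel) \<le> r ^ DIM('a) * (\<integral>w. f (t + r *\<^sub>R w) \<partial>lborel)"
    using r by (intro mult_left_mono) auto
  also have "ennreal \<dots> = 1"
    using 1 f(2) r by (simp add: ennreal_mult nn_integral_eq_integral[OF fin] integral_nonneg_AE)
  then have "r ^ DIM('a) * (\<integral>w. f (t + r *\<^sub>R w) \<partial>lborel) = 1" by simp
  finally show "r ^ DIM('a) * (\<integral>w. \<phi> w * f (t + r *\<^sub>R w) \<partial>lborel) \<le> 1" .
qed

text \<open>For \<open>\<phi>\<close> with values in the unit interval this is the expectation of \<open>\<phi> ((Y - t) / r)\<close> for a random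
point \<open>Y\<close> with density \<open>f\<close>: the probability that a random point is joined to a component of scale \<open>r\<close> near \<open>t\<close>.\<close>

definition near_mass :: "('a::euclidean_space \<Rightarrow> real) \<Rightarrow> ('a \<Rightarrow> real) \<Rightarrow> real \<Rightarrow> 'a \<Rightarrow> real" where
  "near_mass f \<phi> r t = r ^ DIM('a) * (\<integral>w. \<phi> w * f (t + r *\<^sub>R w) \<partial>lborel)"

lemma near_mass_measurable:
  fixes f \<phi> :: "'a::euclidean_space \<Rightarrow> real"
  assumes [measurable]: "f \<in> borel_measurable borel" "\<phi> \<in> borel_measurable borel"
  shows "near_mass f \<phi> r \<in> borel_measurable borel"
  unfolding near_mass_def[abs_def] by measurable

text \<open>After exchanging the integrals the inner one is the \<open>L\<^sup>1\<close> modulus of continuity at \<open>r n *\<^sub>R w\<close>. It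
replaces the Lebesgue differentiation theorem: an average over \<open>t\<close> is all that is required.\<close>

lemma nn_integral_local_oscillation_tendsto_0:
  fixes f :: "'a::euclidean_space \<Rightarrow> real" and r :: "nat \<Rightarrow> real"
  assumes f: "integrable lborel f" and r0: "r \<longlonglongrightarrow> 0"
    and B: "B \<in> sets borel" "emeasure lborel B < \<infinity>"
  shows "(\<lambda>n. \<integral>\<^sup>+t. (\<integral>\<^sup>+w. indicator B w * ennreal \<bar>f (t + r n *\<^sub>R w) - f t\<bar> \<partial>lborel) \<partial>lborel) \<longlonglongrightarrow> 0"
proof -
  note [measurable] = B(1)
  have [measurable]: "f \<in> borel_measurable borel" using f by auto
  have "(\<integral>\<^sup>+t. (\<integral>\<^sup>+w. indicator B w * ennreal \<bar>f (t + r n *\<^sub>R w) - f t\<bar> \<partial>lborel) \<partial>lborel) =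
      (\<integral>\<^sup>+w. indicator B w * shift_dist f (r n *\<^sub>R w) \<partial>lborel)" for n
    unfolding shift_dist_def
    by (subst lborel_pair.Fubini') (simp_all add: nn_integral_cmult)
  moreover have "(\<lambda>n. \<integral>\<^sup>+w. indicator B w * shift_dist f (r n *\<^sub>R w) \<partial>lborel) \<longlonglongrightarrow> (\<integral>\<^sup>+w. 0 \<partial>(lborel :: 'a measure))"
  proof (rule nn_integral_dominated_convergence)
    let ?c = "2 * (\<integral>\<^sup>+x. ennreal \<bar>f x\<bar> \<partial>lborel)"
    have "shift_dist f v \<le> ?c" for v
    proof -
      have "shift_dist f v \<le> shift_dist (\<lambda>_. 0) v + 2 * (\<integral>\<^sup>+x. ennreal \<bar>f x - 0\<bar> \<partial>lborel)"
        by (rule shift_dist_triangle) auto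
      then show ?thesis by (simp add: shift_dist_def)
    qed
    then show "AE w in lborel. indicator B w * shift_dist f (r n *\<^sub>R w) \<le> ?c * indicator B w" for n
      by (auto simp: indicator_def)
    have "?c < \<infinity>" using f by (auto simp: integrable_iff_bounded ennreal_mult_less_top)
    then show "(\<integral>\<^sup>+w. ?c * indicator B w \<partial>lborel) < \<infinity>"
      using B by (simp add: nn_integral_cmult ennreal_mult_less_top)
    show "AE w in lborel. (\<lambda>n. indicator B w * shift_dist f (r n *\<^sub>R w)) \<longlonglongrightarrow> 0"
    proof (rule AE_I2)
      fix w :: 'a
      have "(\<lambda>n. r n *\<^sub>R w) \<longlonglongrightarrow> 0" using tendsto_scaleR[OF r0 tendsto_const[of w]] by simp
      then have "(\<lambda>n. shift_dist f (r n *\<^sub>R w)) \<longlonglongrightarrow> 0" by (rule shift_dist_tendsto_0[OF f])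
      then show "(\<lambda>n. indicator B w * shift_dist f (r n *\<^sub>R w)) \<longlonglongrightarrow> 0" by (simp add: indicator_def)
    qed
    show "(\<lambda>w. indicator B w * shift_dist f (r n *\<^sub>R w)) \<in> borel_measurable lborel" for n
      unfolding shift_dist_def by measurable
  qed measurable
  ultimately show ?thesis by simp
qed

lemma near_mass_diff_le:
  fixes f \<phi> :: "'a::euclidean_space \<Rightarrow> real"
  assumes f: "f \<in> borel_measurable borel" "\<And>x. 0 \<le> f x" "(\<integral>\<^sup>+x. ennreal (f x) \<partial>lborel) = 1"
    and \<phi>: "\<phi> \<in> borel_measurable borel" "\<And>x. 0 \<le> \<phi> x" "\<And>x. \<phi> x \<le> indicator B x"
    and B: "B \<in> sets borel" "emeasure lborel B < \<infinity>" and r: "r > 0"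
  shows "ennreal \<bar>near_mass f \<phi> r t - r ^ DIM('a) * (f t * (\<integral>w. \<phi> w \<partial>lborel))\<bar> \<le>
      ennreal (r ^ DIM('a)) * (\<integral>\<^sup>+w. indicator B w * ennreal \<bar>f (t + r *\<^sub>R w) - f t\<bar> \<partial>lborel)"
proof -
  note [measurable] = f(1) \<phi>(1) B(1)
  have le1: "\<phi> x \<le> 1" for x using \<phi>(3)[of x] indicator_le_1[of B x] by (rule order_trans)
  have int\<phi>: "integrable lborel \<phi>"
    by (rule Bochner_Integration.integrable_bound[of _ "indicator B"])
      (use B \<phi>(2,3) in \<open>auto intro!: integrable_real_indicator\<close>)
  note int = lborel_affine_density_integral_le(1)[OF f \<phi>(1,2) le1 r, of t]
  have "near_mass f \<phi> r t - r ^ DIM('a) * (f t * (\<integral>w. \<phi> w \<partial>lborel)) =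
      r ^ DIM('a) * (\<integral>w. \<phi> w * f (t + r *\<^sub>R w) - \<phi> w * f t \<partial>lborel)"
    unfolding near_mass_def
    by (subst Bochner_Integration.integral_diff[OF int])
      (use int\<phi> in \<open>auto simp: algebra_simps\<close>)
  then have "ennreal \<bar>near_mass f \<phi> r t - r ^ DIM('a) * (f t * (\<integral>w. \<phi> w \<partial>lborel))\<bar> =
      ennreal (r ^ DIM('a)) * ennreal (norm (\<integral>w. \<phi> w * f (t + r *\<^sub>R w) - \<phi> w * f t \<partial>lborel))"
    using r by (simp add: abs_mult ennreal_mult)
  also have "ennreal (norm (\<integral>w. \<phi> w * f (t + r *\<^sub>R w) - \<phi> w * f t \<partial>lborel)) \<le>
      (\<integral>\<^sup>+w. ennreal (norm (\<phi> w * f (t + r *\<^sub>R w) - \<phi> w * f t)) \<partial>lborel)"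
    by (rule integral_norm_bound_ennreal) (use int int\<phi> in auto)
  also have "\<dots> \<le> (\<integral>\<^sup>+w. indicator B w * ennreal \<bar>f (t + r *\<^sub>R w) - f t\<bar> \<partial>lborel)"
  proof (rule nn_integral_mono)
    fix w :: 'a
    have "norm (\<phi> w * f (t + r *\<^sub>R w) - \<phi> w * f t) = \<phi> w * \<bar>f (t + r *\<^sub>R w) - f t\<bar>"
      using \<phi>(2)[of w] by (simp add: right_diff_distrib[symmetric] abs_mult)
    also have "\<dots> \<le> indicator B w * \<bar>f (t + r *\<^sub>R w) - f t\<bar>" using \<phi>(3) by (intro mult_right_mono) auto
    finally show "ennreal (norm (\<phi> w * f (t + r *\<^sub>R w) - \<phi> w * f t)) \<le> indicator B w * ennreal \<bar>f (t + r *\<^sub>R w) - f t\<bar>"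
      by (cases "w \<in> B") (auto intro!: ennreal_leI)
  qed
  finally show ?thesis by (simp add: mult_left_mono)
qed

lemma prod_diff_power_le:
  fixes a :: "'i \<Rightarrow> real"
  assumes "finite I" "\<And>i. i \<in> I \<Longrightarrow> 0 \<le> a i" "\<And>i. i \<in> I \<Longrightarrow> a i \<le> F" "0 \<le> b" "b \<le> F" "1 \<le> F"
  shows "\<bar>(\<Prod>i\<in>I. a i) - b ^ card I\<bar> \<le> F ^ card I * (\<Sum>i\<in>I. \<bar>a i - b\<bar>)"
proof -
  have F: "F > 0" using assms(6) by simp
  have "norm ((\<Prod>i\<in>I. a i / F) - (\<Prod>i\<in>I. b / F)) \<le> (\<Sum>i\<in>I. norm (a i / F - b / F))"
    by (rule norm_prod_diff) (use assms F in auto)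
  also have "\<dots> \<le> (\<Sum>i\<in>I. \<bar>a i - b\<bar>)"
  proof (rule sum_mono)
    fix i assume "i \<in> I"
    have "norm (a i / F - b / F) = \<bar>a i - b\<bar> / F" using F by (simp add: diff_divide_distrib[symmetric])
    also have "\<dots> \<le> \<bar>a i - b\<bar>"
      using assms(6) F mult_right_mono[OF assms(6), of "\<bar>a i - b\<bar>"] by (simp add: divide_le_eq mult.commute)
    finally show "norm (a i / F - b / F) \<le> \<bar>a i - b\<bar>" .
  qed
  finally have "F ^ card I * \<bar>(\<Prod>i\<in>I. a i / F) - (\<Prod>i\<in>I. b / F)\<bar> \<le> F ^ card I * (\<Sum>i\<in>I. \<bar>a i - b\<bar>)"
    using F by (intro mult_left_mono) auto
  moreover have "F ^ card I * \<bar>(\<Prod>i\<in>I. a i / F) - (\<Prod>i\<in>I. b / F)\<bar> = \<bar>(\<Prod>i\<in>I. a i) - b ^ card I\<bar>"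
    using F by (simp add: prod_dividef power_divide diff_divide_distrib[symmetric])
  ultimately show ?thesis by simp
qed

lemma power_density_integrable:
  fixes f :: "'a::euclidean_space \<Rightarrow> real"
  assumes f: "f \<in> borel_measurable borel" "\<And>x. 0 \<le> f x" "(\<integral>\<^sup>+x. ennreal (f x) \<partial>lborel) = 1"
    and F: "\<And>x. f x \<le> F" and k: "k \<ge> 1"
  shows "integrable lborel (\<lambda>t. f t ^ k)"
proof (rule Bochner_Integration.integrable_bound)
  have "integrable lborel f" by (rule integrableI_nonneg) (use f in auto)
  then show "integrable lborel (\<lambda>t. F ^ (k - 1) * f t)" by simp
  show "AE t in lborel. norm (f t ^ k) \<le> norm (F ^ (k - 1) * f t)"
  proof (rule AE_I2)
    fix t
    have "f t ^ k = f t ^ (k - 1) * f t" using k by (metis Suc_diff_le diff_Suc_1 One_nat_def power_Suc2)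
    also have "\<dots> \<le> F ^ (k - 1) * f t" using f(2) F by (intro mult_right_mono power_mono) auto
    finally show "norm (f t ^ k) \<le> norm (F ^ (k - 1) * f t)" using f(2)[of t] by simp
  qed
qed (use f in measurable)

lemma integral_diff_norm_le:
  fixes a c :: "'a \<Rightarrow> real"
  assumes "integrable M a" "integrable M c"
  shows "ennreal (norm (integral\<^sup>L M a - integral\<^sup>L M c)) \<le> (\<integral>\<^sup>+t. ennreal \<bar>a t - c t\<bar> \<partial>M)"
proof -
  have "integral\<^sup>L M a - integral\<^sup>L M c = (\<integral>t. a t - c t \<partial>M)" using assms by simp
  moreover have "ennreal (norm (\<integral>t. a t - c t \<partial>M)) \<le> (\<integral>\<^sup>+t. ennreal (norm (a t - c t)) \<partial>M)"
    by (rule integral_norm_bound_ennreal) (use assms in auto)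
  ultimately show ?thesis by simp
qed

text \<open>Freezing the density at \<open>t\<close>, both in the product and in \<^const>\<open>near_mass\<close>, changes the integral by at most a
multiple of \<open>L\<^sup>1\<close> moduli of continuity; the exponent \<open>N n\<close> is compensated by the factor \<open>r n ^ DIM\<close> of
the mass. For the frozen integrand pointwise convergence and domination by a power of \<open>f\<close> are elementary.\<close>

lemma local_integral_limit:
  fixes f :: "'a::euclidean_space \<Rightarrow> real" and r :: "nat \<Rightarrow> real" and N :: "nat \<Rightarrow> nat"
    and \<zeta> :: "'i \<Rightarrow> 'a" and T :: "nat \<Rightarrow> 'a \<Rightarrow> real" and \<phi> :: "nat \<Rightarrow> 'a \<Rightarrow> real"
  assumes f: "f \<in> borel_measurable borel" "\<And>x. 0 \<le> f x" "(\<integral>\<^sup>+x. ennreal (f x) \<partial>lborel) = 1"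
    and F: "\<And>x. f x \<le> F" "1 \<le> F"
    and I: "finite I" "I \<noteq> {}"
    and r: "\<And>n. 0 < r n" "r \<longlonglongrightarrow> 0" and lim: "(\<lambda>n. real (N n) * r n ^ DIM('a)) \<longlonglongrightarrow> \<rho>"
    and B: "B \<in> sets borel" "emeasure lborel B < \<infinity>"
    and \<phi>: "\<And>n. \<phi> n \<in> borel_measurable borel" "\<And>n x. 0 \<le> \<phi> n x" "\<And>n x. \<phi> n x \<le> indicator B x"
    and \<phi>_lim: "\<And>x. (\<lambda>n. \<phi> n x) \<longlonglongrightarrow> \<phi>' x"
    and T: "\<And>n. T n \<in> borel_measurable borel" "T' \<in> borel_measurable borel"
      "\<And>n x. 0 \<le> T n x" "\<And>n x. T n x \<le> 1"
    and T_lim: "AE x in lborel. (\<lambda>n. T n x) \<longlonglongrightarrow> T' x"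
  shows "(\<lambda>n. \<integral>t. T n t * (\<Prod>i\<in>I. f (t + r n *\<^sub>R \<zeta> i)) * (1 - near_mass f (\<phi> n) (r n) t) ^ N n \<partial>lborel)
     \<longlonglongrightarrow> (\<integral>t. T' t * f t ^ card I * exp (- \<rho> * f t * (\<integral>w. \<phi>' w \<partial>lborel)) \<partial>lborel)"
proof -
  note [measurable] = f(1) \<phi>(1) B(1) T(1,2)
  let ?d = "DIM('a)" and ?k = "card I"
  have k: "?k > 0" using I by (simp add: card_gt_0_iff)
  have intf: "integrable lborel f" by (rule integrableI_nonneg) (use f in auto)
  have \<phi>'m[measurable]: "\<phi>' \<in> borel_measurable borel"
    by (rule borel_measurable_LIMSEQ_real[OF \<phi>_lim]) measurable
  have \<phi>1: "\<phi> n x \<le> 1" for n x using \<phi>(3)[of n x] indicator_le_1[of B x] by (rule order_trans)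
  have \<phi>'0: "0 \<le> \<phi>' x" for x by (rule LIMSEQ_le_const[OF \<phi>_lim]) (use \<phi>(2) in auto)
  have int\<phi>: "integrable lborel (\<phi> n)" for n
    by (rule Bochner_Integration.integrable_bound[of _ "indicator B"])
      (use B \<phi>(2,3) in \<open>auto intro!: integrable_real_indicator\<close>)
  have \<phi>_int_lim: "(\<lambda>n. \<integral>w. \<phi> n w \<partial>lborel) \<longlonglongrightarrow> (\<integral>w. \<phi>' w \<partial>lborel)"
    by (rule integral_dominated_convergence[where w = "indicator B"])
      (use B \<phi>(2,3) \<phi>_lim in \<open>auto intro!: integrable_real_indicator\<close>)
  have \<phi>_int0: "0 \<le> (\<integral>w. \<phi> n w \<partial>lborel)" for n by (rule integral_nonneg_AE) (use \<phi>(2) in auto)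
  let ?b = "\<lambda>n t. near_mass f (\<phi> n) (r n) t"
  let ?c = "\<lambda>n t. r n ^ ?d * (f t * (\<integral>w. \<phi> n w \<partial>lborel))"
  (* For small n the frozen mass may exceed 1; clamping it keeps its complement in the unit interval. *)
  let ?b' = "\<lambda>n t. min 1 (?c n t)"
  let ?P = "\<lambda>n t. \<Prod>i\<in>I. f (t + r n *\<^sub>R \<zeta> i)"
  let ?A = "\<lambda>n t. T n t * ?P n t * (1 - ?b n t) ^ N n"
  let ?C = "\<lambda>n t. T n t * f t ^ ?k * (1 - ?b' n t) ^ N n"
  let ?D = "\<lambda>n t. \<integral>\<^sup>+w. indicator B w * ennreal \<bar>f (t + r n *\<^sub>R w) - f t\<bar> \<partial>lborel"
  have [measurable]: "?b n \<in> borel_measurable borel" for n by (rule near_mass_measurable) measurable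
  have b01: "0 \<le> ?b n t" "?b n t \<le> 1" for n t
    unfolding near_mass_def using lborel_affine_density_integral_le(2,3)[OF f \<phi>(1,2) \<phi>1 r(1)] by auto
  have c0: "0 \<le> ?c n t" for n t using f(2) \<phi>_int0 r(1)[of n] by (intro mult_nonneg_nonneg) auto
  have b'01: "0 \<le> ?b' n t" "?b' n t \<le> 1" for n t using c0[of n t] by auto
  have fpow: "f t ^ ?k \<le> F ^ ?k" "0 \<le> f t ^ ?k" for t using f(2) F by (auto intro: power_mono)
  have F0: "0 \<le> F ^ ?k" using F by simp

  have diff: "\<bar>?A n t - ?C n t\<bar> \<le> F ^ ?k * ((\<Sum>i\<in>I. \<bar>f (t + r n *\<^sub>R \<zeta> i) - f t\<bar>) + real (N n) * \<bar>?b n t - ?c n t\<bar>)" for n t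
  proof -
    have P: "\<bar>?P n t - f t ^ ?k\<bar> \<le> F ^ ?k * (\<Sum>i\<in>I. \<bar>f (t + r n *\<^sub>R \<zeta> i) - f t\<bar>)"
      by (rule prod_diff_power_le) (use I f F in auto)
    have pw: "\<bar>(1 - ?b n t) ^ N n - (1 - ?b' n t) ^ N n\<bar> \<le> real (N n) * \<bar>?b n t - ?c n t\<bar>"
    proof -
      have "norm ((1 - ?b n t) ^ N n - (1 - ?b' n t) ^ N n) \<le> real (N n) * norm ((1 - ?b n t) - (1 - ?b' n t))"
        by (rule norm_power_diff) (use b01[of n t] b'01[of n t] in auto)
      also have "norm ((1 - ?b n t) - (1 - ?b' n t)) \<le> \<bar>?b n t - ?c n t\<bar>" using b01[of n t] by auto
      finally show ?thesis by (simp add: mult_left_mono)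
    qed
    have q01: "0 \<le> (1 - ?b n t) ^ N n" "(1 - ?b n t) ^ N n \<le> 1"
      using b01[of n t] by (auto intro!: power_le_one)
    have "?A n t - ?C n t = T n t * ((?P n t - f t ^ ?k) * (1 - ?b n t) ^ N n
        + f t ^ ?k * ((1 - ?b n t) ^ N n - (1 - ?b' n t) ^ N n))"
      by (simp add: algebra_simps)
    then have "\<bar>?A n t - ?C n t\<bar> = T n t * \<bar>(?P n t - f t ^ ?k) * (1 - ?b n t) ^ N n
        + f t ^ ?k * ((1 - ?b n t) ^ N n - (1 - ?b' n t) ^ N n)\<bar>"
      using T(3)[of n t] by (simp add: abs_mult)
    also have "\<dots> \<le> \<bar>(?P n t - f t ^ ?k) * (1 - ?b n t) ^ N n
        + f t ^ ?k * ((1 - ?b n t) ^ N n - (1 - ?b' n t) ^ N n)\<bar>"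
      using T(3,4)[of n t] by (intro mult_left_le_one_le) auto
    also have "\<dots> \<le> \<bar>(?P n t - f t ^ ?k) * (1 - ?b n t) ^ N n\<bar>
        + \<bar>f t ^ ?k * ((1 - ?b n t) ^ N n - (1 - ?b' n t) ^ N n)\<bar>" by (rule abs_triangle_ineq)
    also have "\<bar>(?P n t - f t ^ ?k) * (1 - ?b n t) ^ N n\<bar> \<le> \<bar>?P n t - f t ^ ?k\<bar>"
      unfolding abs_mult using q01 by (intro mult_right_le_one_le) auto
    also have "\<bar>f t ^ ?k * ((1 - ?b n t) ^ N n - (1 - ?b' n t) ^ N n)\<bar> \<le> F ^ ?k * (real (N n) * \<bar>?b n t - ?c n t\<bar>)"
      unfolding abs_mult using fpow[of t] pw by (intro mult_mono) auto
    finally show ?thesis using P by (simp add: distrib_left)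
  qed

  have fk_int: "integrable lborel (\<lambda>t. f t ^ ?k)"
    by (rule power_density_integrable[OF f F(1)]) (use k in simp)
  have C_bound: "norm (?C n t) \<le> f t ^ ?k" for n t
  proof -
    have "0 \<le> (1 - ?b' n t) ^ N n" "(1 - ?b' n t) ^ N n \<le> 1"
      using b'01[of n t] by (auto intro!: power_le_one)
    then have "0 \<le> T n t * (1 - ?b' n t) ^ N n" "T n t * (1 - ?b' n t) ^ N n \<le> 1"
      using T(3,4)[of n t] by (auto intro!: mult_le_one)
    then have "\<bar>(T n t * (1 - ?b' n t) ^ N n) * f t ^ ?k\<bar> \<le> \<bar>f t ^ ?k\<bar>"
      unfolding abs_mult by (intro mult_left_le_one_le) auto
    then show ?thesis using fpow(2)[of t] by (simp add: ac_simps)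
  qed
  have C_int: "integrable lborel (?C n)" for n
  proof (rule Bochner_Integration.integrable_bound[OF fk_int])
    show "AE t in lborel. norm (?C n t) \<le> norm (f t ^ ?k)"
      by (intro AE_I2 order_trans[OF C_bound]) simp
  qed measurable
  have C_lim: "(\<lambda>n. \<integral>t. ?C n t \<partial>lborel) \<longlonglongrightarrow> (\<integral>t. T' t * f t ^ ?k * exp (- \<rho> * f t * (\<integral>w. \<phi>' w \<partial>lborel)) \<partial>lborel)"
  proof (rule integral_dominated_convergence[where w = "\<lambda>t. f t ^ ?k"])
    show "AE t in lborel. norm (?C n t) \<le> f t ^ ?k" for n using C_bound by (intro AE_I2)
    show "AE t in lborel. (\<lambda>n. ?C n t) \<longlonglongrightarrow> T' t * f t ^ ?k * exp (- \<rho> * f t * (\<integral>w. \<phi>' w \<partial>lborel))"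
      using T_lim
    proof eventually_elim
      case (elim t)
      have "(\<lambda>n. r n ^ ?d * (f t * (\<integral>w. \<phi> n w \<partial>lborel))) \<longlonglongrightarrow> 0 ^ ?d * (f t * (\<integral>w. \<phi>' w \<partial>lborel))"
        by (intro tendsto_intros r(2) \<phi>_int_lim)
      then have c_lim: "(\<lambda>n. ?c n t) \<longlonglongrightarrow> 0" by (simp add: zero_power[OF DIM_positive])
      have "(\<lambda>n. min 1 (?c n t)) \<longlonglongrightarrow> min 1 0" by (intro tendsto_min tendsto_const c_lim)
      then have b'_lim: "(\<lambda>n. ?b' n t) \<longlonglongrightarrow> 0" by simp
      have "(\<lambda>n. (real (N n) * r n ^ ?d) * (f t * (\<integral>w. \<phi> n w \<partial>lborel))) \<longlonglongrightarrow> \<rho> * (f t * (\<integral>w. \<phi>' w \<partial>lborel))"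
        by (intro tendsto_mult[OF lim] tendsto_intros \<phi>_int_lim)
      (* Eventually the frozen mass is below 1 and the clamping has no effect. *)
      moreover have "eventually (\<lambda>n. (real (N n) * r n ^ ?d) * (f t * (\<integral>w. \<phi> n w \<partial>lborel)) = real (N n) * ?b' n t) sequentially"
        using order_tendstoD(2)[OF c_lim, of 1] by (auto elim!: eventually_mono)
      ultimately have "(\<lambda>n. real (N n) * ?b' n t) \<longlonglongrightarrow> \<rho> * (f t * (\<integral>w. \<phi>' w \<partial>lborel))"
        by (rule Lim_transform_eventually)
      then have "(\<lambda>n. (1 - ?b' n t) ^ N n) \<longlonglongrightarrow> exp (- (\<rho> * (f t * (\<integral>w. \<phi>' w \<partial>lborel))))"
        by (rule power_tendsto_exp[OF b'_lim b'01(1)])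
      then have "(\<lambda>n. T n t * f t ^ ?k * (1 - ?b' n t) ^ N n) \<longlonglongrightarrow> T' t * f t ^ ?k * exp (- (\<rho> * (f t * (\<integral>w. \<phi>' w \<partial>lborel))))"
        by (intro tendsto_mult elim tendsto_const)
      then show ?case by (simp add: mult.assoc)
    qed
    show "integrable lborel (\<lambda>t. f t ^ ?k)" by (rule fk_int)
  qed measurable

  have S_lim: "(\<lambda>n. \<integral>\<^sup>+t. ennreal \<bar>?A n t - ?C n t\<bar> \<partial>lborel) \<longlonglongrightarrow> 0"
  proof (rule tendsto_sandwich[OF _ _ tendsto_const])
    let ?S = "\<lambda>n. ennreal (F ^ ?k) * ((\<Sum>i\<in>I. shift_dist f (r n *\<^sub>R \<zeta> i))
        + ennreal (real (N n) * r n ^ ?d) * (\<integral>\<^sup>+t. ?D n t \<partial>lborel))"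
    have le: "(\<integral>\<^sup>+t. ennreal \<bar>?A n t - ?C n t\<bar> \<partial>lborel) \<le> ?S n" for n
    proof -
      have "(\<integral>\<^sup>+t. ennreal \<bar>?A n t - ?C n t\<bar> \<partial>lborel) \<le>
         (\<integral>\<^sup>+t. ennreal (F ^ ?k) * ((\<Sum>i\<in>I. ennreal \<bar>f (t + r n *\<^sub>R \<zeta> i) - f t\<bar>) + ennreal (real (N n) * r n ^ ?d) * ?D n t) \<partial>lborel)"
      proof (rule nn_integral_mono)
        fix t
        have "ennreal \<bar>?A n t - ?C n t\<bar> \<le> ennreal (F ^ ?k * ((\<Sum>i\<in>I. \<bar>f (t + r n *\<^sub>R \<zeta> i) - f t\<bar>) + real (N n) * \<bar>?b n t - ?c n t\<bar>))"
          using diff by (rule ennreal_leI)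
        also have "\<dots> = ennreal (F ^ ?k) * ((\<Sum>i\<in>I. ennreal \<bar>f (t + r n *\<^sub>R \<zeta> i) - f t\<bar>) + ennreal (real (N n)) * ennreal \<bar>?b n t - ?c n t\<bar>)"
          using F0 by (simp add: ennreal_mult ennreal_plus sum_nonneg)
        also have "\<dots> \<le> ennreal (F ^ ?k) * ((\<Sum>i\<in>I. ennreal \<bar>f (t + r n *\<^sub>R \<zeta> i) - f t\<bar>) + ennreal (real (N n)) * (ennreal (r n ^ ?d) * ?D n t))"
          by (intro mult_left_mono add_left_mono near_mass_diff_le f \<phi> B r) auto
        also have "ennreal (real (N n)) * (ennreal (r n ^ ?d) * ?D n t) = ennreal (real (N n) * r n ^ ?d) * ?D n t"
          using r(1)[of n] by (simp add: ennreal_mult mult.assoc)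
        finally show "ennreal \<bar>?A n t - ?C n t\<bar> \<le> ennreal (F ^ ?k) * ((\<Sum>i\<in>I. ennreal \<bar>f (t + r n *\<^sub>R \<zeta> i) - f t\<bar>) + ennreal (real (N n) * r n ^ ?d) * ?D n t)" .
      qed
      also have "\<dots> = ?S n"
        unfolding shift_dist_def
        by (simp add: nn_integral_cmult nn_integral_add nn_integral_sum del: sum_ennreal)
      finally show ?thesis .
    qed
    then show "eventually (\<lambda>n. (\<integral>\<^sup>+t. ennreal \<bar>?A n t - ?C n t\<bar> \<partial>lborel) \<le> ?S n) sequentially" by simp
    show "eventually (\<lambda>n. 0 \<le> (\<integral>\<^sup>+t. ennreal \<bar>?A n t - ?C n t\<bar> \<partial>lborel)) sequentially" by simp
    have shift: "(\<lambda>n. shift_dist f (r n *\<^sub>R \<zeta> i)) \<longlonglongrightarrow> 0" for i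
      using tendsto_scaleR[OF r(2) tendsto_const[of "\<zeta> i"]] by (intro shift_dist_tendsto_0[OF intf]) simp
    have "(\<lambda>n. \<Sum>i\<in>I. shift_dist f (r n *\<^sub>R \<zeta> i)) \<longlonglongrightarrow> (\<Sum>i\<in>I. 0)" by (intro tendsto_sum shift)
    moreover have "(\<lambda>n. ennreal (real (N n) * r n ^ ?d) * (\<integral>\<^sup>+t. ?D n t \<partial>lborel)) \<longlonglongrightarrow> ennreal \<rho> * 0"
      by (intro tendsto_mult_ennreal tendsto_ennrealI lim nn_integral_local_oscillation_tendsto_0 intf r B) simp
    ultimately have "(\<lambda>n. (\<Sum>i\<in>I. shift_dist f (r n *\<^sub>R \<zeta> i))
        + ennreal (real (N n) * r n ^ ?d) * (\<integral>\<^sup>+t. ?D n t \<partial>lborel)) \<longlonglongrightarrow> (\<Sum>i\<in>I. 0) + ennreal \<rho> * 0"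
      by (rule tendsto_add)
    then have "?S \<longlonglongrightarrow> ennreal (F ^ ?k) * ((\<Sum>i\<in>I. 0) + ennreal \<rho> * 0)"
      by (intro ennreal_tendsto_cmult) simp_all
    then show "?S \<longlonglongrightarrow> 0" by simp
  qed
  have A_int: "eventually (\<lambda>n. integrable lborel (?A n)) sequentially"
  proof -
    have "eventually (\<lambda>n. (\<integral>\<^sup>+t. ennreal \<bar>?A n t - ?C n t\<bar> \<partial>lborel) \<le> ennreal 1) sequentially"
      by (rule ennreal_tendsto_0D[OF S_lim]) simp
    then show ?thesis
    proof eventually_elim
      case (elim n)
      have "integrable lborel (\<lambda>t. ?A n t - ?C n t)"
        unfolding integrable_iff_bounded
        using elim by (auto intro: le_less_trans)
      then have "integrable lborel (\<lambda>t. (?A n t - ?C n t) + ?C n t)"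
        using C_int by (rule Bochner_Integration.integrable_add)
      then show ?case by simp
    qed
  qed
  have "(\<lambda>n. (\<integral>t. ?A n t \<partial>lborel) - (\<integral>t. ?C n t \<partial>lborel)) \<longlonglongrightarrow> 0"
  proof (rule tendsto_norm_zero_cancel, rule tendsto_ennrealD)
    have ev: "eventually (\<lambda>n. ennreal (norm ((\<integral>t. ?A n t \<partial>lborel) - (\<integral>t. ?C n t \<partial>lborel))) \<le> (\<integral>\<^sup>+t. ennreal \<bar>?A n t - ?C n t\<bar> \<partial>lborel)) sequentially"
      using A_int
    proof eventually_elim
      case (elim n)
      show ?case using integral_diff_norm_le[OF elim C_int[of n]] .
    qed
    show "(\<lambda>n. ennreal (norm ((\<integral>t. ?A n t \<partial>lborel) - (\<integral>t. ?C n t \<partial>lborel)))) \<longlonglongrightarrow> ennreal 0"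
      unfolding ennreal_0
      by (rule tendsto_sandwich[OF always_eventually ev tendsto_const S_lim]) (rule allI, rule zero_le)
  qed auto
  then have "(\<lambda>n. ((\<integral>t. ?A n t \<partial>lborel) - (\<integral>t. ?C n t \<partial>lborel)) + (\<integral>t. ?C n t \<partial>lborel)) \<longlonglongrightarrow> 0 +
      (\<integral>t. T' t * f t ^ ?k * exp (- \<rho> * f t * (\<integral>w. \<phi>' w \<partial>lborel)) \<partial>lborel)"
    using C_lim by (rule tendsto_add)
  then show ?thesis by simp
qed

section \<open>Rescaling around a base point\<close>

lemma lborel_integral_affine:
  fixes g :: "'a::euclidean_space \<Rightarrow> real"
  assumes [measurable]: "g \<in> borel_measurable borel" and r: "r > 0"
  shows "(\<integral>y. g y \<partial>lborel) = r ^ DIM('a) * (\<integral>w. g (t + r *\<^sub>R w) \<partial>lborel)"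
  using r by (subst lborel_affine[of r t]) (simp_all add: integral_density integral_distr)

lemma nn_integral_PiM_density_affine:
  fixes f :: "'a::euclidean_space \<Rightarrow> real"
  assumes f[measurable]: "f \<in> borel_measurable borel" and f0: "\<And>x. 0 \<le> f x"
    and prob: "prob_space (density lborel (\<lambda>x. ennreal (f x)))"
    and r: "r > 0" and I: "finite I" and g: "g \<in> borel_measurable (Pi\<^sub>M I (\<lambda>_. borel))"
  shows "(\<integral>\<^sup>+y. g y \<partial>Pi\<^sub>M I (\<lambda>_. density lborel (\<lambda>x. ennreal (f x)))) =
    (\<integral>\<^sup>+z. (\<Prod>i\<in>I. ennreal (r ^ DIM('a) * f (t + r *\<^sub>R z i))) * g (\<lambda>i\<in>I. t + r *\<^sub>R z i) \<partial>Pi\<^sub>M I (\<lambda>_. lborel))"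
  using I g
proof (induction I arbitrary: g rule: finite_induct)
  case empty
  show ?case by (simp add: PiM_empty nn_integral_count_space_finite restrict_def)
next
  case (insert i I)
  let ?mu = "density lborel (\<lambda>x. ennreal (f x))"
  interpret mu: prob_space ?mu by (rule prob)
  interpret P: product_sigma_finite "\<lambda>_. ?mu" by standard
  interpret L: product_sigma_finite "\<lambda>_. lborel :: 'a measure" by standard
  have setsmu: "sets (Pi\<^sub>M K (\<lambda>_. ?mu)) = sets (Pi\<^sub>M K (\<lambda>_. borel))" for K by (rule sets_PiM_cong) simp_all
  have setsl: "sets (Pi\<^sub>M K (\<lambda>_. lborel :: 'a measure)) = sets (Pi\<^sub>M K (\<lambda>_. borel))" for K by (rule sets_PiM_cong) simp_all
  note [measurable] = insert.prems
  have upd: "(\<lambda>(x, y). x(i := y)) \<in> measurable (Pi\<^sub>M I (\<lambda>_. borel) \<Otimes>\<^sub>M borel) (Pi\<^sub>M (insert i I) (\<lambda>_. borel :: 'a measure))"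
    by measurable
  have aff: "(\<lambda>z. \<lambda>j\<in>K. t + r *\<^sub>R z j) \<in> measurable (Pi\<^sub>M K (\<lambda>_. lborel)) (Pi\<^sub>M K (\<lambda>_. borel))" for K
    by (rule measurable_restrict) measurable
  let ?G = "\<lambda>x. \<integral>\<^sup>+y. g (x(i := y)) \<partial>?mu"
  have Gm: "?G \<in> borel_measurable (Pi\<^sub>M I (\<lambda>_. borel))"
    by (rule mu.borel_measurable_nn_integral)
      (use measurable_compose[OF upd insert.prems] in \<open>simp add: case_prod_beta cong: measurable_cong_sets\<close>)
  have "(\<integral>\<^sup>+y. g y \<partial>Pi\<^sub>M (insert i I) (\<lambda>_. ?mu)) = (\<integral>\<^sup>+x. ?G x \<partial>Pi\<^sub>M I (\<lambda>_. ?mu))"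
    by (rule P.product_nn_integral_insert[OF insert.hyps]) (use insert.prems setsmu in \<open>simp cong: measurable_cong_sets\<close>)
  also have "\<dots> = (\<integral>\<^sup>+z. (\<Prod>j\<in>I. ennreal (r ^ DIM('a) * f (t + r *\<^sub>R z j))) * ?G (\<lambda>j\<in>I. t + r *\<^sub>R z j) \<partial>Pi\<^sub>M I (\<lambda>_. lborel))"
    by (rule insert.IH[OF Gm])
  also have "\<dots> = (\<integral>\<^sup>+z. \<integral>\<^sup>+w. (\<Prod>j\<in>insert i I. ennreal (r ^ DIM('a) * f (t + r *\<^sub>R (z(i := w)) j))) *
      g (\<lambda>j\<in>insert i I. t + r *\<^sub>R (z(i := w)) j) \<partial>lborel \<partial>Pi\<^sub>M I (\<lambda>_. lborel))"
  proof (rule nn_integral_cong)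
    fix z assume z: "z \<in> space (Pi\<^sub>M I (\<lambda>_. lborel :: 'a measure))"
    let ?x = "\<lambda>j\<in>I. t + r *\<^sub>R z j"
    have x: "?x \<in> space (Pi\<^sub>M I (\<lambda>_. borel))" using measurable_space[OF aff z] .
    have gx[measurable]: "(\<lambda>y. g (?x(i := y))) \<in> borel_measurable borel"
      using measurable_compose[OF measurable_Pair2[OF upd x] insert.prems] by simp
    have "?G ?x = (\<integral>\<^sup>+y. ennreal (f y) * g (?x(i := y)) \<partial>lborel)"
      by (subst nn_integral_density) (use f in auto)
    also have "\<dots> = ennreal (r ^ DIM('a)) * (\<integral>\<^sup>+w. ennreal (f (t + r *\<^sub>R w)) * g (?x(i := t + r *\<^sub>R w)) \<partial>lborel)"
      by (rule lborel_nn_integral_affine[OF _ r]) measurable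
    also have "\<dots> = (\<integral>\<^sup>+w. ennreal (r ^ DIM('a) * f (t + r *\<^sub>R w)) * g (?x(i := t + r *\<^sub>R w)) \<partial>lborel)"
      using r f0 by (subst nn_integral_cmult[symmetric]) (auto simp: ennreal_mult mult.assoc)
    finally have G: "(\<Prod>j\<in>I. ennreal (r ^ DIM('a) * f (t + r *\<^sub>R z j))) * ?G ?x =
        (\<integral>\<^sup>+w. (\<Prod>j\<in>I. ennreal (r ^ DIM('a) * f (t + r *\<^sub>R z j))) *
          (ennreal (r ^ DIM('a) * f (t + r *\<^sub>R w)) * g (?x(i := t + r *\<^sub>R w))) \<partial>lborel)"
      by (simp add: nn_integral_cmult)
    have e1: "(\<lambda>j\<in>insert i I. t + r *\<^sub>R (z(i := w)) j) = ?x(i := t + r *\<^sub>R w)" for w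
      using insert.hyps(2) by (auto simp: fun_eq_iff)
    have e2: "(\<Prod>j\<in>insert i I. ennreal (r ^ DIM('a) * f (t + r *\<^sub>R (z(i := w)) j))) =
        ennreal (r ^ DIM('a) * f (t + r *\<^sub>R w)) * (\<Prod>j\<in>I. ennreal (r ^ DIM('a) * f (t + r *\<^sub>R z j)))" for w
    proof -
      have "(\<Prod>j\<in>I. ennreal (r ^ DIM('a) * f (t + r *\<^sub>R (z(i := w)) j))) = (\<Prod>j\<in>I. ennreal (r ^ DIM('a) * f (t + r *\<^sub>R z j)))"
        by (rule prod.cong[OF refl]) (use insert.hyps(2) in auto)
      then show ?thesis using insert.hyps by simp
    qed
    show "(\<Prod>j\<in>I. ennreal (r ^ DIM('a) * f (t + r *\<^sub>R z j))) * ?G ?x =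
      (\<integral>\<^sup>+w. (\<Prod>j\<in>insert i I. ennreal (r ^ DIM('a) * f (t + r *\<^sub>R (z(i := w)) j))) *
        g (\<lambda>j\<in>insert i I. t + r *\<^sub>R (z(i := w)) j) \<partial>lborel)"
      unfolding G e1 e2 by (simp add: ac_simps)
  qed
  also have "\<dots> = (\<integral>\<^sup>+z. (\<Prod>j\<in>insert i I. ennreal (r ^ DIM('a) * f (t + r *\<^sub>R z j))) *
      g (\<lambda>j\<in>insert i I. t + r *\<^sub>R z j) \<partial>Pi\<^sub>M (insert i I) (\<lambda>_. lborel))"
  proof (rule L.product_nn_integral_insert[OF insert.hyps, symmetric])
    show "(\<lambda>z. (\<Prod>j\<in>insert i I. ennreal (r ^ DIM('a) * f (t + r *\<^sub>R z j))) *
      g (\<lambda>j\<in>insert i I. t + r *\<^sub>R z j)) \<in> borel_measurable (Pi\<^sub>M (insert i I) (\<lambda>_. lborel))"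
    proof (rule borel_measurable_times_ennreal)
      show "(\<lambda>z. g (\<lambda>j\<in>insert i I. t + r *\<^sub>R z j)) \<in> borel_measurable (Pi\<^sub>M (insert i I) (\<lambda>_. lborel))"
        by (rule measurable_compose[OF aff insert.prems])
      show "(\<lambda>z. \<Prod>j\<in>insert i I. ennreal (r ^ DIM('a) * f (t + r *\<^sub>R z j))) \<in> borel_measurable (Pi\<^sub>M (insert i I) (\<lambda>_. lborel))"
      proof (rule borel_measurable_prod_ennreal)
        fix j assume "j \<in> insert i I"
        then have [measurable]: "(\<lambda>z. z j) \<in> borel_measurable (Pi\<^sub>M (insert i I) (\<lambda>_. lborel :: 'a measure))"
          using measurable_component_singleton[of j "insert i I" "\<lambda>_. lborel :: 'a measure"] by simp
        show "(\<lambda>z. ennreal (r ^ DIM('a) * f (t + r *\<^sub>R z j))) \<in> borel_measurable (Pi\<^sub>M (insert i I) (\<lambda>_. lborel))"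
          by measurable
      qed
    qed
  qed
  finally show ?case .
qed

lemma near_affine:
  fixes \<zeta> :: "'i \<Rightarrow> real^'d"
  assumes "r > 0"
  shows "near r (\<lambda>i. t + r *\<^sub>R \<zeta> i) S (t + r *\<^sub>R w) = near 1 \<zeta> S w"
  using assms by (simp add: near_def dist_norm flip: scaleR_diff_right)

lemma close_pairs_affine:
  fixes \<zeta> :: "'i \<Rightarrow> real^'d"
  assumes "r > 0"
  shows "close_pairs r (\<lambda>i. t + r *\<^sub>R \<zeta> i) S = close_pairs 1 \<zeta> S"
  using assms by (simp add: close_pairs_def dist_norm flip: scaleR_diff_right)

text \<open>The probability that a point at \<open>w\<close> is joined to at least one of the points \<open>\<zeta> i\<close> after percolation.\<close>

definition hit_prob :: "real \<Rightarrow> ('i \<Rightarrow> real^'d) \<Rightarrow> 'i set \<Rightarrow> real^'d \<Rightarrow> real" where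
  "hit_prob q \<zeta> S w = 1 - (1 - q) ^ near 1 \<zeta> S w"

lemma hit_prob_bounds:
  assumes "0 \<le> q" "q \<le> 1"
  shows "0 \<le> hit_prob q \<zeta> S w" "hit_prob q \<zeta> S w \<le> 1"
  using assms by (auto simp: hit_prob_def power_le_one)

lemma hit_prob_le_indicator:
  fixes \<zeta> :: "'i \<Rightarrow> real^'d"
  assumes "0 \<le> q" "q \<le> 1"
  shows "hit_prob q \<zeta> S w \<le> indicator (\<Union>i\<in>S. cball (\<zeta> i) 1) w"
proof (cases "w \<in> (\<Union>i\<in>S. cball (\<zeta> i) 1)")
  case True
  then show ?thesis using hit_prob_bounds(2)[OF assms] by simp
next
  case False
  then have "{i \<in> S. dist (\<zeta> i) w \<le> 1} = {}" by auto
  then have "near 1 \<zeta> S w = 0" unfolding near_def by (metis card.empty)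
  then show ?thesis using False by (simp add: hit_prob_def)
qed

lemma measurable_hit_prob:
  fixes x :: "'w \<Rightarrow> 'i \<Rightarrow> real^'d::finite"
  assumes "finite S" "\<And>i. i \<in> S \<Longrightarrow> (\<lambda>\<omega>. x \<omega> i) \<in> borel_measurable M" "y \<in> borel_measurable M"
  shows "(\<lambda>\<omega>. hit_prob q (x \<omega>) S (y \<omega>)) \<in> borel_measurable M"
  unfolding hit_prob_def by (intro borel_measurable_diff borel_measurable_const measurable_near_power assms)

text \<open>The probability that a random point has no retained edge to the component, in rescaled coordinates.\<close>

lemma void_probability_affine:
  fixes f :: "real^'d::finite \<Rightarrow> real"
  assumes f: "f \<in> borel_measurable borel" "\<And>x. 0 \<le> f x" "(\<integral>\<^sup>+x. ennreal (f x) \<partial>lborel) = 1"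
    and q: "0 \<le> q" "q \<le> 1" and r: "r > 0" and S: "finite S"
  shows "(\<integral>u. (1 - q) ^ near r (\<lambda>i. t + r *\<^sub>R \<zeta> i) S u \<partial>density lborel (\<lambda>x. ennreal (f x))) =
    1 - near_mass f (hit_prob q \<zeta> S) r t"
proof -
  let ?mu = "density lborel (\<lambda>x. ennreal (f x))"
  let ?x = "\<lambda>i. t + r *\<^sub>R \<zeta> i"
  note [measurable] = f(1)
  interpret mu: prob_space ?mu
    by (rule prob_spaceI) (use f in \<open>simp add: emeasure_density\<close>)
  have [measurable]: "(\<lambda>u. (1 - q) ^ near r ?x S u) \<in> borel_measurable borel"
    by (rule measurable_near_power[OF S]) auto
  have int: "integrable ?mu (\<lambda>u. (1 - q) ^ near r ?x S u)"
    by (intro mu.integrable_const_bound[of _ 1]) (use q in \<open>auto intro!: power_le_one\<close>)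
  have "(\<integral>u. 1 - (1 - q) ^ near r ?x S u \<partial>?mu) = (\<integral>u. f u * (1 - (1 - q) ^ near r ?x S u) \<partial>lborel)"
    by (subst integral_density) (use f in auto)
  also have "\<dots> = r ^ DIM(real^'d) * (\<integral>w. f (t + r *\<^sub>R w) * (1 - (1 - q) ^ near r ?x S (t + r *\<^sub>R w)) \<partial>lborel)"
    by (rule lborel_integral_affine[OF _ r]) measurable
  also have "\<dots> = near_mass f (hit_prob q \<zeta> S) r t"
    unfolding near_mass_def hit_prob_def near_affine[OF r] by (simp add: mult.commute)
  finally show ?thesis using int mu.prob_space by simp
qed

text \<open>The part of the integrand that depends on the base point \<open>t\<close>, for a fixed shape \<open>\<zeta>\<close> of the component.\<close>

definition slice_integrand ::
    "(real^'d::finite \<Rightarrow> real) \<Rightarrow> 'd \<Rightarrow> (real^'d) set \<Rightarrow> real \<Rightarrow> real \<Rightarrow> nat \<Rightarrow> 'i set \<Rightarrow> ('i \<Rightarrow> real^'d) \<Rightarrow> real^'d \<Rightarrow> real" where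
  "slice_integrand f i1 A q r N I \<zeta> t =
     of_bool (leftmost_in i1 A (\<lambda>i. t + r *\<^sub>R \<zeta> i) I) * (\<Prod>i\<in>I. f (t + r *\<^sub>R \<zeta> i)) *
       (1 - near_mass f (hit_prob q \<zeta> I) r t) ^ N"

text \<open>The index \<open>i0\<close> sits at the base point itself. Its factor \<open>f t\<close> keeps the bound integrable in \<open>t\<close>, while
the other factors are bounded by \<open>F\<close>.\<close>

lemma slice_integrand_bounds:
  fixes f :: "real^'d::finite \<Rightarrow> real"
  assumes f: "f \<in> borel_measurable borel" "\<And>x. 0 \<le> f x" "(\<integral>\<^sup>+x. ennreal (f x) \<partial>lborel) = 1"
    and F: "\<And>x. f x \<le> F" and q: "0 \<le> q" "q \<le> 1" and r: "r > 0"
    and I: "finite I" "i0 \<in> I" "\<zeta> i0 = 0"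
  shows "0 \<le> slice_integrand f i1 A q r N I \<zeta> t"
    and "slice_integrand f i1 A q r N I \<zeta> t \<le> F ^ (card I - 1) * f t"
proof -
  have hm: "hit_prob q \<zeta> I \<in> borel_measurable borel" by (rule measurable_hit_prob[OF I(1)]) auto
  have m: "0 \<le> near_mass f (hit_prob q \<zeta> I) r t" "near_mass f (hit_prob q \<zeta> I) r t \<le> 1"
    unfolding near_mass_def
    using lborel_affine_density_integral_le(2,3)[OF f hm hit_prob_bounds[OF q] r] by auto
  have v: "0 \<le> (1 - near_mass f (hit_prob q \<zeta> I) r t) ^ N" "(1 - near_mass f (hit_prob q \<zeta> I) r t) ^ N \<le> 1"
    using m by (auto intro!: power_le_one)
  have P: "0 \<le> (\<Prod>i\<in>I. f (t + r *\<^sub>R \<zeta> i))" using f by (intro prod_nonneg) auto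
  show "0 \<le> slice_integrand f i1 A q r N I \<zeta> t"
    unfolding slice_integrand_def using v P by (intro mult_nonneg_nonneg) auto
  have le: "slice_integrand f i1 A q r N I \<zeta> t \<le> (1 * (\<Prod>i\<in>I. f (t + r *\<^sub>R \<zeta> i))) * 1"
    unfolding slice_integrand_def using v P by (intro mult_mono) auto
  have split: "(\<Prod>i\<in>I. f (t + r *\<^sub>R \<zeta> i)) = f t * (\<Prod>i\<in>I - {i0}. f (t + r *\<^sub>R \<zeta> i))"
    using I by (subst prod.remove[of I i0]) auto
  have "(\<Prod>i\<in>I - {i0}. f (t + r *\<^sub>R \<zeta> i)) \<le> (\<Prod>i\<in>I - {i0}. F)"
    using f F by (intro prod_mono) auto
  also have "\<dots> = F ^ (card I - 1)" using I by simp
  finally have others: "(\<Prod>i\<in>I - {i0}. f (t + r *\<^sub>R \<zeta> i)) \<le> F ^ (card I - 1)" .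
  show "slice_integrand f i1 A q r N I \<zeta> t \<le> F ^ (card I - 1) * f t"
    using le split mult_left_mono[OF others f(2)[of t]] by (simp add: mult.commute)
qed

lemma slice_integrand_measurable:
  fixes f :: "real^'d::finite \<Rightarrow> real" and x :: "'w \<Rightarrow> 'i \<Rightarrow> real^'d"
  assumes f[measurable]: "f \<in> borel_measurable borel" and A: "A \<in> sets borel" and I: "finite I"
    and x: "\<And>i. i \<in> I \<Longrightarrow> (\<lambda>\<omega>. x \<omega> i) \<in> borel_measurable M"
    and y[measurable]: "y \<in> borel_measurable M"
  shows "(\<lambda>\<omega>. slice_integrand f i1 A q r N I (x \<omega>) (y \<omega>)) \<in> borel_measurable M"
proof -
  have xy: "(\<lambda>\<omega>. y \<omega> + r *\<^sub>R x \<omega> i) \<in> borel_measurable M" if "i \<in> I" for i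
    using x[OF that] by measurable
  have 1: "(\<lambda>\<omega>. of_bool (leftmost_in i1 A (\<lambda>i. y \<omega> + r *\<^sub>R x \<omega> i) I) :: real) \<in> borel_measurable M"
    by (rule measurable_compose[OF pred_leftmost_in[OF I xy A]]) auto
  have 2: "(\<lambda>\<omega>. \<Prod>i\<in>I. f (y \<omega> + r *\<^sub>R x \<omega> i)) \<in> borel_measurable M"
    by (intro borel_measurable_prod measurable_compose[OF xy f])
  have "(\<lambda>z. hit_prob q (x (fst z)) I (snd z)) \<in> borel_measurable (M \<Otimes>\<^sub>M lborel)"
  proof (rule measurable_hit_prob[OF I])
    show "(\<lambda>z. x (fst z) i) \<in> borel_measurable (M \<Otimes>\<^sub>M lborel)" if "i \<in> I" for i
      by (rule measurable_compose[OF measurable_fst x[OF that]])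
    show "snd \<in> borel_measurable (M \<Otimes>\<^sub>M lborel)"
      using measurable_snd[of M "lborel :: (real^'d) measure"] by simp
  qed
  then have [measurable]: "(\<lambda>(\<omega>, w). hit_prob q (x \<omega>) I w) \<in> borel_measurable (M \<Otimes>\<^sub>M lborel)"
    by (simp add: case_prod_beta)
  have 3: "(\<lambda>\<omega>. near_mass f (hit_prob q (x \<omega>) I) r (y \<omega>)) \<in> borel_measurable M"
    unfolding near_mass_def by measurable
  show ?thesis unfolding slice_integrand_def
    by (intro borel_measurable_times borel_measurable_power borel_measurable_diff borel_measurable_const 1 2 3)
qed

text \<open>The point with index 0 serves as the base point \<open>t\<close>, and the others are expressed relative to it in units of
\<open>r\<close>. The order of integration is then exchanged, so that the limit can be taken in \<open>t\<close> for each shape \<open>z\<close>.\<close>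

lemma rescaled_copy_integral:
  fixes f :: "real^'d::finite \<Rightarrow> real"
  assumes f: "f \<in> borel_measurable borel" "\<And>x. 0 \<le> f x" "(\<integral>\<^sup>+x. ennreal (f x) \<partial>lborel) = 1"
    and F: "\<And>x. f x \<le> F" and q: "0 \<le> q" "q \<le> 1" and r: "r > 0" and k: "k \<ge> 1" and A: "A \<in> sets borel"
  defines "mu \<equiv> density lborel (\<lambda>x. ennreal (f x))"
  shows "(\<integral>y. copy_weight \<Gamma> q i1 A r y {..<k} * (\<integral>u. (1 - q) ^ near r y {..<k} u \<partial>mu) ^ N \<partial>Pi\<^sub>M {..<k} (\<lambda>_. mu)) =
    (r ^ CARD('d)) ^ (k - 1) * (\<integral>z. weight \<Gamma> q ({..<k}, close_pairs 1 (z(0 := 0)) {..<k}) *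
      (\<integral>t. slice_integrand f i1 A q r N {..<k} (z(0 := 0)) t \<partial>lborel) \<partial>Pi\<^sub>M {1..k-1} (\<lambda>_. lborel))"
    (is "?L = ?c * (\<integral>z. ?W z * (\<integral>t. ?H z t \<partial>lborel) \<partial>?PJ)")
proof -
  let ?I = "{..<k}" and ?J = "{1..k-1}"
  have IJ: "?I = insert 0 ?J" "0 \<notin> ?J" "finite ?J" using k by auto
  note [measurable] = f(1)
  have mu_dens: "(\<integral>\<^sup>+t. h t \<partial>mu) = (\<integral>\<^sup>+t. ennreal (f t) * h t \<partial>lborel)"
    if "h \<in> borel_measurable lborel" for h
    unfolding mu_def by (rule nn_integral_density) (use that in simp_all)
  interpret mu: prob_space mu
    unfolding mu_def by (rule prob_spaceI) (use f in \<open>simp add: emeasure_density\<close>)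
  interpret P: product_sigma_finite "\<lambda>_::nat. mu" by standard
  interpret L: product_sigma_finite "\<lambda>_::nat. lborel :: (real^'d) measure" by standard
  interpret LJ: sigma_finite_measure ?PJ by (rule L.sigma_finite) simp
  interpret pair: pair_sigma_finite ?PJ "lborel :: (real^'d) measure" by standard
  have setsmu: "sets (Pi\<^sub>M K (\<lambda>_::nat. mu)) = sets (Pi\<^sub>M K (\<lambda>_. borel))" for K
    by (rule sets_PiM_cong) (simp_all add: mu_def)
  have comp: "(\<lambda>y. y i) \<in> borel_measurable (Pi\<^sub>M K (\<lambda>_. borel :: (real^'d) measure))" if "i \<in> K" for i :: nat and K
    by (rule measurable_component_singleton[OF that])
  let ?\<Phi> = "\<lambda>y. copy_weight \<Gamma> q i1 A r y ?I * (\<integral>u. (1 - q) ^ near r y ?I u \<partial>mu) ^ N"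
  have \<Phi>m: "?\<Phi> \<in> borel_measurable (Pi\<^sub>M ?I (\<lambda>_. borel))"
  proof (intro borel_measurable_times borel_measurable_power mu.borel_measurable_lebesgue_integral)
    show "(\<lambda>y. copy_weight \<Gamma> q i1 A r y ?I) \<in> borel_measurable (Pi\<^sub>M ?I (\<lambda>_. borel))"
      by (rule measurable_copy_weight[OF _ comp A]) auto
    show "(\<lambda>(y, u). (1 - q) ^ near r y ?I u) \<in> borel_measurable (Pi\<^sub>M ?I (\<lambda>_. borel :: (real^'d) measure) \<Otimes>\<^sub>M mu)"
      unfolding case_prod_beta
    proof (rule measurable_near_power)
      show "(\<lambda>z. fst z i) \<in> borel_measurable (Pi\<^sub>M ?I (\<lambda>_. borel :: (real^'d) measure) \<Otimes>\<^sub>M mu)" if "i \<in> ?I" for i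
        by (rule measurable_compose[OF measurable_fst comp[OF that]])
      show "snd \<in> borel_measurable (Pi\<^sub>M ?I (\<lambda>_. borel :: (real^'d) measure) \<Otimes>\<^sub>M mu)"
        using measurable_snd[of "Pi\<^sub>M ?I (\<lambda>_. borel :: (real^'d) measure)" mu] by (simp add: mu_def)
    qed simp
  qed
  have \<Phi>0: "0 \<le> ?\<Phi> y" for y
    using q by (intro mult_nonneg_nonneg copy_weight_nonneg zero_le_power integral_nonneg_AE) auto
  have W0: "0 \<le> ?W z" for z using q by (intro weight_nonneg)
  have \<zeta>m: "(\<lambda>z. (z(0 := 0)) i) \<in> borel_measurable ?PJ" if "i \<in> ?I" for i
    using that IJ(1) measurable_component_singleton[of i ?J "\<lambda>_. lborel :: (real^'d) measure"] by (cases "i = 0") auto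
  have Wm: "?W \<in> borel_measurable ?PJ" by (rule measurable_weight[OF _ \<zeta>m]) auto
  have Hm: "(\<lambda>u. ?H (fst u) (snd u)) \<in> borel_measurable (?PJ \<Otimes>\<^sub>M lborel)"
  proof (rule slice_integrand_measurable[OF f(1) A])
    show "(\<lambda>u. ((fst u)(0 := 0)) i) \<in> borel_measurable (?PJ \<Otimes>\<^sub>M lborel)" if "i \<in> ?I" for i
      by (rule measurable_compose[OF measurable_fst \<zeta>m[OF that]])
    show "snd \<in> borel_measurable (?PJ \<Otimes>\<^sub>M lborel)"
      using measurable_snd[of ?PJ "lborel :: (real^'d) measure"] by simp
  qed simp
  have H0: "0 \<le> ?H z t" and HF: "?H z t \<le> F ^ (k - 1) * f t" for z t
    using slice_integrand_bounds[OF f F q r, of ?I 0 "z(0 := 0)" i1 A N t] k by auto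
  have intf: "integrable lborel f" by (rule integrableI_nonneg) (use f in auto)
  have intH: "integrable lborel (?H z)" if "z \<in> space ?PJ" for z
  proof (rule Bochner_Integration.integrable_bound)
    show "integrable lborel (\<lambda>t. F ^ (k - 1) * f t)" using intf by simp
    show "?H z \<in> borel_measurable lborel"
      using measurable_Pair2[OF Hm that] by simp
    show "AE t in lborel. norm (?H z t) \<le> norm (F ^ (k - 1) * f t)"
      using H0 HF by (intro AE_I2) (simp add: abs_of_nonneg order_trans[OF _ abs_ge_self])
  qed
  have HIm: "(\<lambda>z. \<integral>t. ?H z t \<partial>lborel) \<in> borel_measurable ?PJ"
    by (rule lborel.borel_measurable_lebesgue_integral) (use Hm in \<open>simp add: case_prod_beta\<close>)
  have HI0: "0 \<le> (\<integral>t. ?H z t \<partial>lborel)" for z using H0 by (intro integral_nonneg_AE) auto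
  have c0: "0 \<le> ?c" using r by simp
  let ?jac = "\<lambda>t z. \<Prod>i\<in>?J. ennreal (r ^ DIM(real^'d) * f (t + r *\<^sub>R z i))"
  let ?v = "\<lambda>t z. (\<lambda>i\<in>?J. t + r *\<^sub>R z i)(0 := t)"
  have pointwise: "ennreal (f t) * (?jac t z *
        ennreal (?\<Phi> (?v t z))) = ennreal (?c * (?W z * ?H z t))" for t z
  proof -
    let ?\<zeta> = "z(0 := 0)"
    let ?x = "\<lambda>i. t + r *\<^sub>R ?\<zeta> i"
    have agree: "(?v t z) i = ?x i" if "i \<in> ?I" for i
      using that IJ(1) by auto
    have "copy_weight \<Gamma> q i1 A r (?v t z) ?I = copy_weight \<Gamma> q i1 A r ?x ?I"
      by (rule copy_weight_cong) (rule agree)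
    moreover have "near r (?v t z) ?I = near r ?x ?I" by (rule near_cong) (rule agree)
    ultimately have "?\<Phi> (?v t z) = ?\<Phi> ?x" by simp
    also have "\<dots> = of_bool (leftmost_in i1 A ?x ?I) * ?W z * (1 - near_mass f (hit_prob q ?\<zeta> ?I) r t) ^ N"
      unfolding mu_def void_probability_affine[OF f q r finite_lessThan] copy_weight_def close_pairs_affine[OF r] ..
    finally have \<Phi>: "?\<Phi> (?v t z) =
        of_bool (leftmost_in i1 A ?x ?I) * ?W z * (1 - near_mass f (hit_prob q ?\<zeta> ?I) r t) ^ N" .
    have prodI: "(\<Prod>i\<in>?I. f (?x i)) = f t * (\<Prod>i\<in>?J. f (t + r *\<^sub>R z i))"
    proof -
      have "(\<Prod>i\<in>?J. f (?x i)) = (\<Prod>i\<in>?J. f (t + r *\<^sub>R z i))" by (rule prod.cong) auto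
      then show ?thesis unfolding IJ(1) by (subst prod.insert) (use IJ in auto)
    qed
    have "?jac t z = ennreal (\<Prod>i\<in>?J. r ^ DIM(real^'d) * f (t + r *\<^sub>R z i))"
      by (rule prod_ennreal) (use r f in auto)
    also have "(\<Prod>i\<in>?J. r ^ DIM(real^'d) * f (t + r *\<^sub>R z i)) = ?c * (\<Prod>i\<in>?J. f (t + r *\<^sub>R z i))"
      by (simp add: prod.distrib)
    finally have "ennreal (f t) * (?jac t z *
        ennreal (?\<Phi> (?v t z))) =
        ennreal (f t * (?c * (\<Prod>i\<in>?J. f (t + r *\<^sub>R z i)) * ?\<Phi> (?v t z)))"
      using f(2) \<Phi>0 c0 by (simp add: ennreal_mult prod_nonneg)
    also have "f t * (?c * (\<Prod>i\<in>?J. f (t + r *\<^sub>R z i)) * ?\<Phi> (?v t z)) = ?c * (?W z * ?H z t)"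
      unfolding \<Phi> slice_integrand_def prodI by (simp only: ac_simps)
    finally show ?thesis .
  qed
  have inner: "(\<integral>\<^sup>+y. ennreal (?\<Phi> y) \<partial>Pi\<^sub>M ?I (\<lambda>_. mu)) =
      (\<integral>\<^sup>+z. ennreal (?c * (?W z * (\<integral>t. ?H z t \<partial>lborel))) \<partial>?PJ)"
  proof -
    have \<Phi>m': "(\<lambda>y. ennreal (?\<Phi> y)) \<in> borel_measurable (Pi\<^sub>M (insert 0 ?J) (\<lambda>_. borel))"
      using \<Phi>m unfolding IJ(1) by (rule measurable_compose[OF _ measurable_ennreal])
    have "(\<integral>\<^sup>+y. ennreal (?\<Phi> y) \<partial>Pi\<^sub>M (insert 0 ?J) (\<lambda>_. mu)) =
        (\<integral>\<^sup>+t. (\<integral>\<^sup>+x. ennreal (?\<Phi> (x(0 := t))) \<partial>Pi\<^sub>M ?J (\<lambda>_. mu)) \<partial>mu)"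
      by (rule P.product_nn_integral_insert_rev) (use \<Phi>m' setsmu in \<open>simp_all cong: measurable_cong_sets\<close>)
    also have "\<dots> = (\<integral>\<^sup>+t. (\<integral>\<^sup>+z. ?jac t z *
        ennreal (?\<Phi> (?v t z)) \<partial>?PJ) \<partial>mu)"
    proof (rule nn_integral_cong)
      fix t
      have upd: "(\<lambda>x. x(0 := t)) \<in> measurable (Pi\<^sub>M ?J (\<lambda>_. borel)) (Pi\<^sub>M (insert 0 ?J) (\<lambda>_. borel :: (real^'d) measure))"
        by measurable
      show "(\<integral>\<^sup>+x. ennreal (?\<Phi> (x(0 := t))) \<partial>Pi\<^sub>M ?J (\<lambda>_. mu)) =
          (\<integral>\<^sup>+z. ?jac t z *
        ennreal (?\<Phi> (?v t z)) \<partial>?PJ)"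
        using nn_integral_PiM_density_affine[OF f(1,2) mu.prob_space_axioms[unfolded mu_def] r IJ(3),
            OF measurable_compose[OF upd \<Phi>m'], of t]
        unfolding mu_def .
    qed
    also have "\<dots> = (\<integral>\<^sup>+t. (\<integral>\<^sup>+z. ennreal (?c * (?W z * ?H z t)) \<partial>?PJ) \<partial>lborel)"
    proof -
      let ?K = "\<lambda>t. \<integral>\<^sup>+z. ?jac t z *
        ennreal (?\<Phi> (?v t z)) \<partial>?PJ"
      have zm: "(\<lambda>u. snd u i) \<in> borel_measurable (lborel \<Otimes>\<^sub>M ?PJ)" if "i \<in> ?J" for i
        by (rule measurable_compose[OF measurable_snd])
          (use measurable_component_singleton[OF that, of "\<lambda>_. lborel :: (real^'d) measure"] in simp)
      have tm: "fst \<in> borel_measurable ((lborel :: (real^'d) measure) \<Otimes>\<^sub>M ?PJ)"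
        using measurable_fst[of "lborel :: (real^'d) measure" ?PJ] by simp
      have tz: "(\<lambda>u. fst u + r *\<^sub>R snd u i) \<in> borel_measurable (lborel \<Otimes>\<^sub>M ?PJ)" if "i \<in> ?J" for i
        using zm[OF that] tm by measurable
      have vec: "(\<lambda>u. (\<lambda>i\<in>?J. fst u + r *\<^sub>R snd u i)(0 := fst u)) \<in>
          measurable (lborel \<Otimes>\<^sub>M ?PJ) (Pi\<^sub>M (insert 0 ?J) (\<lambda>_. borel))"
        by (rule measurable_fun_upd[OF _ measurable_restrict[OF tz] tm]) auto
      have joint: "(\<lambda>u. ?jac (fst u) (snd u) *
        ennreal (?\<Phi> (?v (fst u) (snd u)))) \<in> borel_measurable (lborel \<Otimes>\<^sub>M ?PJ)"
      proof (rule borel_measurable_times_ennreal[OF borel_measurable_prod_ennreal measurable_compose[OF vec \<Phi>m']])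
        fix i assume i: "i \<in> ?J"
        show "(\<lambda>u. ennreal (r ^ DIM(real^'d) * f (fst u + r *\<^sub>R snd u i))) \<in> borel_measurable (lborel \<Otimes>\<^sub>M ?PJ)"
          using measurable_compose[OF tz[OF i] f(1)] by measurable
      qed
      have Km: "?K \<in> borel_measurable lborel"
        using joint by (intro LJ.borel_measurable_nn_integral) (simp add: case_prod_beta)
      have "(\<integral>\<^sup>+t. ?K t \<partial>mu) = (\<integral>\<^sup>+t. ennreal (f t) * ?K t \<partial>lborel)"
        by (rule mu_dens[OF Km])
      also have "\<dots> = (\<integral>\<^sup>+t. (\<integral>\<^sup>+z. ennreal (f t) * (?jac t z *
        ennreal (?\<Phi> (?v t z))) \<partial>?PJ) \<partial>lborel)"
      proof (rule nn_integral_cong, rule nn_integral_cmult[symmetric])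
        fix t :: "real^'d"
        have "(\<lambda>z. (t, z)) \<in> measurable ?PJ (lborel \<Otimes>\<^sub>M ?PJ)" by measurable
        from measurable_compose[OF this joint]
        show "(\<lambda>z. ?jac t z *
        ennreal (?\<Phi> (?v t z))) \<in> borel_measurable ?PJ" by simp
      qed
      finally show ?thesis unfolding pointwise .
    qed
    also have "\<dots> = (\<integral>\<^sup>+z. (\<integral>\<^sup>+t. ennreal (?c * (?W z * ?H z t)) \<partial>lborel) \<partial>?PJ)"
    proof (rule pair.Fubini')
      have "(\<lambda>u. ?W (fst u)) \<in> borel_measurable (?PJ \<Otimes>\<^sub>M lborel)" by (rule measurable_compose[OF measurable_fst Wm])
      then have "(\<lambda>u. ennreal (?c * (?W (fst u) * ?H (fst u) (snd u)))) \<in> borel_measurable (?PJ \<Otimes>\<^sub>M lborel)"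
        using Hm by measurable
      then show "(\<lambda>(z, t). ennreal (?c * (?W z * ?H z t))) \<in> borel_measurable (?PJ \<Otimes>\<^sub>M lborel)"
        by (simp add: case_prod_beta)
    qed
    also have "\<dots> = (\<integral>\<^sup>+z. ennreal (?c * (?W z * (\<integral>t. ?H z t \<partial>lborel))) \<partial>?PJ)"
    proof (rule nn_integral_cong)
      fix z assume z: "z \<in> space ?PJ"
      have "(\<integral>\<^sup>+t. ennreal (?c * (?W z * ?H z t)) \<partial>lborel) = ennreal (\<integral>t. ?c * (?W z * ?H z t) \<partial>lborel)"
        by (rule nn_integral_eq_integral) (use intH[OF z] H0 W0 c0 in auto)
      then show "(\<integral>\<^sup>+t. ennreal (?c * (?W z * ?H z t)) \<partial>lborel) = ennreal (?c * (?W z * (\<integral>t. ?H z t \<partial>lborel)))"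
        by simp
    qed
    finally show ?thesis unfolding IJ(1)[symmetric] .
  qed
  have "?L = enn2real (\<integral>\<^sup>+y. ennreal (?\<Phi> y) \<partial>Pi\<^sub>M ?I (\<lambda>_. mu))"
    by (rule integral_eq_nn_integral) (use \<Phi>m \<Phi>0 setsmu in \<open>simp_all cong: measurable_cong_sets\<close>)
  also have "\<dots> = enn2real (\<integral>\<^sup>+z. ennreal (?c * (?W z * (\<integral>t. ?H z t \<partial>lborel))) \<partial>?PJ)" unfolding inner ..
  also have "\<dots> = (\<integral>z. ?c * (?W z * (\<integral>t. ?H z t \<partial>lborel)) \<partial>?PJ)"
    by (rule integral_eq_nn_integral[symmetric]) (use Wm HIm W0 HI0 c0 in \<open>auto intro!: mult_nonneg_nonneg\<close>)
  finally show ?thesis by simp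
qed

section \<open>The thermodynamic limit\<close>

text \<open>Some copy of the connected graph \<open>\<Gamma>\<close> links any two of the points by a path with edges of length at most 1,
and a shortest path is no longer than the number of ordered adjacent pairs.\<close>

lemma weight_nonzero_bounded:
  fixes \<zeta> :: "'i \<Rightarrow> real^'d"
  assumes \<Gamma>: "simple_graph \<Gamma>" "connected_graph \<Gamma>" and I: "finite I" "i0 \<in> I" "i \<in> I"
    and nz: "weight \<Gamma> q (I, close_pairs 1 \<zeta> I) \<noteq> 0"
  shows "dist (\<zeta> i0) (\<zeta> i) \<le> real (card I * card I)"
proof -
  have "copies \<Gamma> (I, close_pairs 1 \<zeta> I) \<noteq> 0" using nz by (auto simp: weight_def)
  then have "{E. E \<subseteq> close_pairs 1 \<zeta> I \<and> graph_iso (I, E) \<Gamma>} \<noteq> {}"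
    unfolding copies_def fst_conv snd_conv by (metis card.empty)
  then obtain E where E: "E \<subseteq> close_pairs 1 \<zeta> I" "graph_iso (I, E) \<Gamma>" by blast
  have "connected_graph (I, E)"
    by (rule connected_graph_iso[OF E(2) \<Gamma>(2)])
      (use E(1) close_pairs_subset[of 1 \<zeta> I] simple_graphD(2)[OF \<Gamma>(1)] in auto)
  then have "reachable (I, E) i0 i" using I by (auto simp: connected_graph_def)
  then have reach: "(i0, i) \<in> {(x, y). {x, y} \<in> E}\<^sup>*" by (simp add: reachable_def)
  let ?R = "{(x, y). {x, y} \<in> E}"
  have sub: "?R \<subseteq> I \<times> I" using E(1) close_pairs_subset[of 1 \<zeta> I] by blast
  then have finR: "finite ?R" using I(1) finite_subset by blast
  have cardR: "card ?R \<le> card I * card I" using card_mono[OF _ sub] I(1) by (simp add: card_cartesian_product)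
  obtain n where n: "n \<le> card ?R" "(i0, i) \<in> ?R ^^ n"
    using reach unfolding rtrancl_finite_eq_relpow[OF finR] by blast
  have "dist (\<zeta> i0) (\<zeta> j) \<le> real n" if "(i0, j) \<in> ?R ^^ n" for n j
    using that
  proof (induction n arbitrary: j)
    case (Suc n)
    then obtain l where l: "(i0, l) \<in> ?R ^^ n" "{l, j} \<in> E" by auto
    then have "dist (\<zeta> l) (\<zeta> j) \<le> 1" using E(1) doubleton_mem_close_pairs[of l j 1 \<zeta> I] by blast
    then show ?case using Suc.IH[OF l(1)] dist_triangle[of "\<zeta> i0" "\<zeta> j" "\<zeta> l"] by simp
  qed simp
  from this[OF n(2)] show ?thesis using n(1) cardR by (meson le_trans of_nat_le_iff order_trans)
qed

text \<open>All points of the component converge to \<open>t\<close>, so the choice of the left-most one does not matter in the limit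
unless \<open>t\<close> lies on the boundary of \<open>A\<close>.\<close>

lemma leftmost_in_affine_tendsto:
  fixes \<zeta> :: "'i \<Rightarrow> real^'d::finite" and r :: "nat \<Rightarrow> real"
  assumes A: "open A" and I: "finite I" "I \<noteq> {}" and r: "\<And>n. 0 < r n" "r \<longlonglongrightarrow> 0"
    and t: "t \<notin> frontier A"
  shows "(\<lambda>n. of_bool (leftmost_in i1 A (\<lambda>i. t + r n *\<^sub>R \<zeta> i) I) :: real) \<longlonglongrightarrow> indicator A t"
proof -
  have lim: "(\<lambda>n. t + r n *\<^sub>R \<zeta> i) \<longlonglongrightarrow> t" for i
    using tendsto_add[OF tendsto_const tendsto_scaleR[OF r(2) tendsto_const[of "\<zeta> i"]], of t] by simp
  show ?thesis
  proof (cases "t \<in> A")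
    case True
    obtain i0 where i0: "i0 \<in> I" "\<And>j. j \<in> I \<Longrightarrow> \<zeta> i0 $ i1 \<le> \<zeta> j $ i1"
      using ex_min_if_finite[of "(\<lambda>i. \<zeta> i $ i1) ` I"] I by (auto simp: not_less)
    have "eventually (\<lambda>n. t + r n *\<^sub>R \<zeta> i0 \<in> A) sequentially"
      using topological_tendstoD[OF lim A True] .
    then have "eventually (\<lambda>n. of_bool (leftmost_in i1 A (\<lambda>i. t + r n *\<^sub>R \<zeta> i) I) = (1 :: real)) sequentially"
    proof eventually_elim
      case (elim n)
      have "(t + r n *\<^sub>R \<zeta> i0) $ i1 \<le> (t + r n *\<^sub>R \<zeta> j) $ i1" if "j \<in> I" for j
        using i0(2)[OF that] r(1)[of n] by simp
      then show ?case using elim i0(1) by (auto simp: leftmost_in_def)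
    qed
    then show ?thesis using True by (simp add: tendsto_eventually)
  next
    case False
    then have "t \<in> - closure A" using t A by (simp add: frontier_def interior_open)
    then have "eventually (\<lambda>n. t + r n *\<^sub>R \<zeta> i \<in> - closure A) sequentially" for i
      by (intro topological_tendstoD[OF lim]) auto
    then have "eventually (\<lambda>n. \<forall>i\<in>I. t + r n *\<^sub>R \<zeta> i \<in> - closure A) sequentially"
      using I(1) by (simp add: eventually_ball_finite)
    then have "eventually (\<lambda>n. of_bool (leftmost_in i1 A (\<lambda>i. t + r n *\<^sub>R \<zeta> i) I) = (0 :: real)) sequentially"
    proof eventually_elim
      case (elim n)
      then show ?case using closure_subset[of A] by (auto simp: leftmost_in_def)
    qed
    then show ?thesis using False by (simp add: tendsto_eventually)
  qed
qed

lemma union_cball_finite_measure: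
  fixes \<zeta> :: "'i \<Rightarrow> real^'d::finite"
  assumes "finite I"
  shows "(\<Union>i\<in>I. cball (\<zeta> i) 1) \<in> sets borel" "emeasure lborel (\<Union>i\<in>I. cball (\<zeta> i) 1) < \<infinity>"
proof -
  show "(\<Union>i\<in>I. cball (\<zeta> i) 1) \<in> sets borel" using assms by auto
  have "bounded (\<Union>i\<in>I. cball (\<zeta> i) 1)" using assms by auto
  then show "emeasure lborel (\<Union>i\<in>I. cball (\<zeta> i) 1) < \<infinity>" by (rule emeasure_bounded_finite)
qed

lemma slice_limit:
  fixes f :: "real^'d::finite \<Rightarrow> real" and r pp :: "nat \<Rightarrow> real" and N :: "nat \<Rightarrow> nat"
  assumes f: "f \<in> borel_measurable borel" "\<And>x. 0 \<le> f x" "(\<integral>\<^sup>+x. ennreal (f x) \<partial>lborel) = 1"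
    and F: "\<And>x. f x \<le> F" "1 \<le> F"
    and I: "finite I" "I \<noteq> {}"
    and r: "\<And>n. 0 < r n" "r \<longlonglongrightarrow> 0" and lim: "(\<lambda>n. real (N n) * r n ^ CARD('d)) \<longlonglongrightarrow> \<rho>"
    and pp: "\<And>n. 0 \<le> pp n" "\<And>n. pp n \<le> 1" "pp \<longlonglongrightarrow> q"
    and A: "open A" "emeasure lborel (frontier A) = 0"
  shows "(\<lambda>n. \<integral>t. slice_integrand f i1 A (pp n) (r n) (N n) I \<zeta> t \<partial>lborel) \<longlonglongrightarrow>
     (\<integral>t. indicator A t * f t ^ card I * exp (- \<rho> * f t * (\<integral>w. hit_prob q \<zeta> I w \<partial>lborel)) \<partial>lborel)"
  unfolding slice_integrand_def
proof (rule local_integral_limit[OF f F I r _ union_cball_finite_measure[OF I(1)]])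
  show "(\<lambda>n. real (N n) * r n ^ DIM(real^'d)) \<longlonglongrightarrow> \<rho>" using lim by simp
  show "hit_prob (pp n) \<zeta> I \<in> borel_measurable borel" for n by (rule measurable_hit_prob[OF I(1)]) auto
  show "0 \<le> hit_prob (pp n) \<zeta> I x" for n x using hit_prob_bounds(1)[OF pp(1,2)] .
  show "hit_prob (pp n) \<zeta> I x \<le> indicator (\<Union>i\<in>I. cball (\<zeta> i) 1) x" for n x
    using hit_prob_le_indicator[OF pp(1,2)] .
  show "(\<lambda>n. hit_prob (pp n) \<zeta> I x) \<longlonglongrightarrow> hit_prob q \<zeta> I x" for x
    unfolding hit_prob_def by (intro tendsto_intros pp(3))
  show "(\<lambda>t. of_bool (leftmost_in i1 A (\<lambda>i. t + r n *\<^sub>R \<zeta> i) I) :: real) \<in> borel_measurable borel" for n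
    by (rule measurable_compose[OF pred_leftmost_in[OF I(1)]]) (use A in auto)
  show "indicator A \<in> borel_measurable borel" using A by simp
  have "AE t in lborel. t \<notin> frontier A"
    using A by (intro AE_not_in null_setsI) auto
  then show "AE t in lborel. (\<lambda>n. of_bool (leftmost_in i1 A (\<lambda>i. t + r n *\<^sub>R \<zeta> i) I) :: real) \<longlonglongrightarrow> indicator A t"
    by (rule AE_mp) (intro AE_I2 impI leftmost_in_affine_tendsto A I r)
qed auto

definition support_box :: "nat \<Rightarrow> (nat \<Rightarrow> real^'d::finite) set" where
  "support_box k = (\<Pi>\<^sub>E i\<in>{1..k-1}. cball 0 (real (k * k)))"

lemma support_box_measure:
  shows "support_box k \<in> sets (Pi\<^sub>M {1..k-1} (\<lambda>_. lborel :: (real^'d::finite) measure))"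
    and "emeasure (Pi\<^sub>M {1..k-1} (\<lambda>_. lborel :: (real^'d::finite) measure)) (support_box k) < \<infinity>"
proof -
  interpret L: product_sigma_finite "\<lambda>_::nat. lborel :: (real^'d) measure" by standard
  show "support_box k \<in> sets (Pi\<^sub>M {1..k-1} (\<lambda>_. lborel :: (real^'d) measure))"
    unfolding support_box_def by (rule sets_PiM_I_finite) auto
  have "emeasure (Pi\<^sub>M {1..k-1} (\<lambda>_. lborel :: (real^'d) measure)) (support_box k) =
      (\<Prod>i\<in>{1..k-1}. emeasure lborel (cball (0 :: real^'d) (real (k * k))))"
    unfolding support_box_def by (rule L.emeasure_PiM) auto
  also have "\<dots> < \<infinity>"
    unfolding prod_constant 
    using emeasure_lborel_cball_finite[of "0 :: real^'d" "real (k * k)"] by (simp add: power_less_top_ennreal)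
  finally show "emeasure (Pi\<^sub>M {1..k-1} (\<lambda>_. lborel :: (real^'d) measure)) (support_box k) < \<infinity>" .
qed

lemma weight_le_support_box:
  fixes z :: "nat \<Rightarrow> real^'d::finite"
  assumes \<Gamma>: "simple_graph \<Gamma>" "connected_graph \<Gamma>" and q: "0 \<le> q" "q \<le> 1" and k: "k \<ge> 1"
    and z: "z \<in> space (Pi\<^sub>M {1..k-1} (\<lambda>_. lborel :: (real^'d) measure))"
  shows "weight \<Gamma> q ({..<k}, close_pairs 1 (z(0 := 0)) {..<k}) \<le> 2 ^ 2 ^ k * indicator (support_box k) z"
proof (cases "weight \<Gamma> q ({..<k}, close_pairs 1 (z(0 := 0)) {..<k}) = 0")
  case True
  then show ?thesis by simp
next
  case False
  have "z i \<in> cball 0 (real (k * k))" if "i \<in> {1..k-1}" for i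
    using weight_nonzero_bounded[OF \<Gamma> finite_lessThan _ _ False, of 0 i] that k by auto
  then have "z \<in> support_box k"
    using z unfolding support_box_def by (intro PiE_I) (auto simp: space_PiM PiE_def extensional_def)
  then show ?thesis using weight_close_pairs_le[OF q, of "{..<k}" \<Gamma> 1 "z(0 := 0)"] by simp
qed

lemma shifted_component_measurable:
  fixes k :: nat
  assumes "i \<in> {..<k}"
  shows "(\<lambda>z. (z(0 := 0)) i) \<in> borel_measurable (Pi\<^sub>M {1..k-1} (\<lambda>_. lborel :: (real^'d::finite) measure))"
proof (cases "i = 0")
  case False
  then have "i \<in> {1..k-1}" using assms by auto
  then show ?thesis
    using measurable_component_singleton[of i "{1..k-1}" "\<lambda>_. lborel :: (real^'d) measure"] False by simp
qed simp

lemma shifted_weight_measurable: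
  fixes k :: nat
  shows "(\<lambda>z. weight \<Gamma> q ({..<k}, close_pairs 1 (z(0 := 0)) {..<k})) \<in>
     borel_measurable (Pi\<^sub>M {1..k-1} (\<lambda>_. lborel :: (real^'d::finite) measure))"
  by (rule measurable_weight[OF finite_lessThan shifted_component_measurable])

definition hit_volume :: "real \<Rightarrow> nat \<Rightarrow> (nat \<Rightarrow> real^'d::finite) \<Rightarrow> real" where
  "hit_volume q k z = (\<integral>w. hit_prob q (z(0 := 0)) {..<k} w \<partial>lborel)"

lemma hit_volume_measurable:
  "hit_volume q k \<in> borel_measurable (Pi\<^sub>M {1..k-1} (\<lambda>_. lborel :: (real^'d::finite) measure))"
proof -
  let ?P = "Pi\<^sub>M {1..k-1} (\<lambda>_. lborel :: (real^'d::finite) measure)"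
  have "(\<lambda>u. hit_prob q ((fst u)(0 := 0)) {..<k} (snd u)) \<in> borel_measurable (?P \<Otimes>\<^sub>M lborel)"
  proof (rule measurable_hit_prob[OF finite_lessThan])
    show "(\<lambda>u. ((fst u)(0 := 0)) i) \<in> borel_measurable (?P \<Otimes>\<^sub>M lborel)" if "i \<in> {..<k}" for i
      by (rule measurable_compose[OF measurable_fst shifted_component_measurable[OF that]])
    show "snd \<in> borel_measurable (?P \<Otimes>\<^sub>M lborel)"
      using measurable_snd[of ?P "lborel :: (real^'d) measure"] by simp
  qed
  then show ?thesis unfolding hit_volume_def[abs_def]
    by (intro lborel.borel_measurable_lebesgue_integral) (simp add: case_prod_beta)
qed

lemma hit_volume_nonneg: "0 \<le> q \<Longrightarrow> q \<le> 1 \<Longrightarrow> 0 \<le> hit_volume q k z"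
  unfolding hit_volume_def by (intro integral_nonneg_AE) (simp add: hit_prob_bounds)

definition limit_integrand ::
    "'v graph \<Rightarrow> real \<Rightarrow> nat \<Rightarrow> real \<Rightarrow> (nat \<Rightarrow> real^'d::finite) \<Rightarrow> real" where
  "limit_integrand \<Gamma> q k lam z =
     weight \<Gamma> q ({..<k}, close_pairs 1 (z(0 := 0)) {..<k}) * exp (- lam * hit_volume q k z)"

lemma limit_integrand_integrable:
  assumes \<Gamma>: "simple_graph \<Gamma>" "connected_graph \<Gamma>" and q: "0 \<le> q" "q \<le> 1" and k: "k \<ge> 1" and lam: "0 \<le> lam"
  shows "integrable (Pi\<^sub>M {1..k-1} (\<lambda>_. lborel :: (real^'d::finite) measure)) (limit_integrand \<Gamma> q k lam)"
    (is "integrable ?P _")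
proof (rule Bochner_Integration.integrable_bound)
  show "integrable ?P (\<lambda>z. 2 ^ 2 ^ k * indicator (support_box k) z :: real)"
    by (intro integrable_mult_right integrable_real_indicator support_box_measure)
  show "limit_integrand \<Gamma> q k lam \<in> borel_measurable ?P"
    unfolding limit_integrand_def[abs_def]
    using shifted_weight_measurable hit_volume_measurable by measurable
  show "AE z in ?P. norm (limit_integrand \<Gamma> q k lam z) \<le> norm (2 ^ 2 ^ k * indicator (support_box k) z :: real)"
  proof (rule AE_I2)
    fix z assume z: "z \<in> space ?P"
    have W0: "0 \<le> weight \<Gamma> q ({..<k}, close_pairs 1 (z(0 := 0)) {..<k})" by (rule weight_nonneg[OF q(2)])
    have "exp (- lam * hit_volume q k z) \<le> 1" using lam hit_volume_nonneg[OF q, of k z] by simp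
    then have "limit_integrand \<Gamma> q k lam z \<le> weight \<Gamma> q ({..<k}, close_pairs 1 (z(0 := 0)) {..<k})"
      unfolding limit_integrand_def using W0 by (intro mult_right_le_one_le) auto
    also have "\<dots> \<le> 2 ^ 2 ^ k * indicator (support_box k) z" by (rule weight_le_support_box[OF \<Gamma> q k z])
    finally show "norm (limit_integrand \<Gamma> q k lam z) \<le> norm (2 ^ 2 ^ k * indicator (support_box k) z :: real)"
      using W0 by (simp add: limit_integrand_def)
  qed
qed

text \<open>For each fixed shape the inner integral converges; the box outside of which the weight vanishes gives domination
in the shape.\<close>

lemma rescaled_integral_limit:
  fixes f :: "real^'d::finite \<Rightarrow> real" and r pp :: "nat \<Rightarrow> real" and N :: "nat \<Rightarrow> nat"
  assumes f: "f \<in> borel_measurable borel" "\<And>x. 0 \<le> f x" "(\<integral>\<^sup>+x. ennreal (f x) \<partial>lborel) = 1"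
    and F: "\<And>x. f x \<le> F" "1 \<le> F"
    and r: "\<And>n. 0 < r n" "r \<longlonglongrightarrow> 0" and lim: "(\<lambda>n. real (N n) * r n ^ CARD('d)) \<longlonglongrightarrow> \<rho>"
    and pp: "\<And>n. 0 \<le> pp n" "\<And>n. pp n \<le> 1" "pp \<longlonglongrightarrow> q"
    and A: "open A" "emeasure lborel (frontier A) = 0"
    and \<Gamma>: "simple_graph \<Gamma>" "connected_graph \<Gamma>" and k: "k \<ge> 1"
  shows "(\<lambda>n. \<integral>z. weight \<Gamma> (pp n) ({..<k}, close_pairs 1 (z(0 := 0)) {..<k}) *
        (\<integral>t. slice_integrand f i1 A (pp n) (r n) (N n) {..<k} (z(0 := 0)) t \<partial>lborel) \<partial>Pi\<^sub>M {1..k-1} (\<lambda>_. lborel :: (real^'d) measure))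
     \<longlonglongrightarrow> (\<integral>z. weight \<Gamma> q ({..<k}, close_pairs 1 (z(0 := 0)) {..<k}) *
        (\<integral>t. indicator A t * f t ^ k * exp (- \<rho> * f t * hit_volume q k z) \<partial>lborel) \<partial>Pi\<^sub>M {1..k-1} (\<lambda>_. lborel :: (real^'d) measure))"
proof -
  let ?P = "Pi\<^sub>M {1..k-1} (\<lambda>_. lborel :: (real^'d) measure)"
  let ?s = "\<lambda>n z. weight \<Gamma> (pp n) ({..<k}, close_pairs 1 (z(0 := 0)) {..<k}) *
        (\<integral>t. slice_integrand f i1 A (pp n) (r n) (N n) {..<k} (z(0 := 0)) t \<partial>lborel)"
  let ?s' = "\<lambda>z. weight \<Gamma> q ({..<k}, close_pairs 1 (z(0 := 0)) {..<k}) *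
        (\<integral>t. indicator A t * f t ^ k * exp (- \<rho> * f t * hit_volume q k z) \<partial>lborel)"
  have k0: "{..<k} \<noteq> {}" "0 \<in> {..<k}" using k by (auto simp: lessThan_empty_iff)
  have intf: "integrable lborel f" by (rule integrableI_nonneg) (use f in auto)
  have intf1: "(\<integral>t. f t \<partial>lborel) = 1" using f by (subst integral_eq_nn_integral) auto
  have Hm: "(\<lambda>u. slice_integrand f i1 A (pp n) (r n) (N n) {..<k} ((fst u)(0 := 0)) (snd u)) \<in> borel_measurable (?P \<Otimes>\<^sub>M lborel)" for n
  proof (rule slice_integrand_measurable[OF f(1)])
    show "(\<lambda>u. ((fst u)(0 := 0)) i) \<in> borel_measurable (?P \<Otimes>\<^sub>M lborel)" if "i \<in> {..<k}" for i
      by (rule measurable_compose[OF measurable_fst shifted_component_measurable[OF that]])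
    show "snd \<in> borel_measurable (?P \<Otimes>\<^sub>M lborel)"
      using measurable_snd[of ?P "lborel :: (real^'d) measure"] by simp
  qed (use A in auto)
  have sm: "?s n \<in> borel_measurable ?P" for n
    by (intro borel_measurable_times shifted_weight_measurable lborel.borel_measurable_lebesgue_integral)
      (use Hm[of n] in \<open>simp add: case_prod_beta\<close>)
  have slim: "(\<lambda>n. ?s n z) \<longlonglongrightarrow> ?s' z" for z
  proof (intro tendsto_mult)
    show "(\<lambda>n. weight \<Gamma> (pp n) ({..<k}, close_pairs 1 (z(0 := 0)) {..<k})) \<longlonglongrightarrow>
        weight \<Gamma> q ({..<k}, close_pairs 1 (z(0 := 0)) {..<k})"
      unfolding weight_def by (intro tendsto_intros pp(3))
    show "(\<lambda>n. \<integral>t. slice_integrand f i1 A (pp n) (r n) (N n) {..<k} (z(0 := 0)) t \<partial>lborel) \<longlonglongrightarrow>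
        (\<integral>t. indicator A t * f t ^ k * exp (- \<rho> * f t * hit_volume q k z) \<partial>lborel)"
      using slice_limit[OF f F finite_lessThan k0(1) r lim pp A, of i1 "z(0 := 0)"]
      by (simp add: hit_volume_def)
  qed
  show ?thesis
  proof (rule integral_dominated_convergence)
    show "?s' \<in> borel_measurable ?P" by (rule borel_measurable_LIMSEQ_real[OF slim sm])
    show "integrable ?P (\<lambda>z. 2 ^ 2 ^ k * indicator (support_box k) z * F ^ (k - 1) :: real)"
      by (intro integrable_mult_right integrable_mult_left integrable_real_indicator support_box_measure)
    show "AE z in ?P. norm (?s n z) \<le> 2 ^ 2 ^ k * indicator (support_box k) z * F ^ (k - 1)" for n
    proof (rule AE_I2)
      fix z assume z: "z \<in> space ?P"
      let ?h = "slice_integrand f i1 A (pp n) (r n) (N n) {..<k} (z(0 := 0))"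
      have b: "0 \<le> ?h t" "?h t \<le> F ^ (k - 1) * f t" for t
        using slice_integrand_bounds[OF f F(1) pp(1,2) r(1) finite_lessThan k0(2), of "z(0 := 0)"] by auto
      have "(\<integral>t. ?h t \<partial>lborel) \<le> (\<integral>t. F ^ (k - 1) * f t \<partial>lborel)"
        by (rule integral_mono') (use intf b f F in auto)
      then have "(\<integral>t. ?h t \<partial>lborel) \<le> F ^ (k - 1)" using intf1 by simp
      moreover have "0 \<le> (\<integral>t. ?h t \<partial>lborel)" using b by (intro integral_nonneg_AE) auto
      ultimately show "norm (?s n z) \<le> 2 ^ 2 ^ k * indicator (support_box k) z * F ^ (k - 1)"
        using weight_nonneg[OF pp(2), of \<Gamma> n "({..<k}, close_pairs 1 (z(0 := 0)) {..<k})"] weight_le_support_box[OF \<Gamma> pp(1,2) k z]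
        by (simp add: abs_mult mult_mono)
    qed
    show "AE z in ?P. (\<lambda>n. ?s n z) \<longlonglongrightarrow> ?s' z" using slim by simp
  qed (rule sm)
qed

text \<open>The limit arises with the shape as the outer variable, whereas \<^const>\<open>p_iso\<close> and \<^const>\<open>p_strict\<close> integrate over
shapes first.\<close>

lemma limit_integral_Fubini:
  fixes f :: "real^'d::finite \<Rightarrow> real"
  assumes f: "f \<in> borel_measurable borel" "\<And>x. 0 \<le> f x" "(\<integral>\<^sup>+x. ennreal (f x) \<partial>lborel) = 1"
    and F: "\<And>x. f x \<le> F" and q: "0 \<le> q" "q \<le> 1" and A: "open A" and \<rho>: "0 \<le> \<rho>"
    and \<Gamma>: "simple_graph \<Gamma>" "connected_graph \<Gamma>" and k: "k \<ge> 1"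
  defines "P \<equiv> Pi\<^sub>M {1..k-1} (\<lambda>_. lborel :: (real^'d) measure)"
  shows "integrable lborel (\<lambda>t. indicator A t * f t ^ k * (\<integral>z. limit_integrand \<Gamma> q k (\<rho> * f t) z \<partial>P))"
    and "(\<integral>z. weight \<Gamma> q ({..<k}, close_pairs 1 (z(0 := 0)) {..<k}) *
        (\<integral>t. indicator A t * f t ^ k * exp (- \<rho> * f t * hit_volume q k z) \<partial>lborel) \<partial>P) =
      (\<integral>t. indicator A t * f t ^ k * (\<integral>z. limit_integrand \<Gamma> q k (\<rho> * f t) z \<partial>P) \<partial>lborel)"
proof -
  interpret L: product_sigma_finite "\<lambda>_::nat. lborel :: (real^'d) measure" by standard
  interpret LP: sigma_finite_measure P unfolding P_def by (rule L.sigma_finite) simp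
  interpret pair: pair_sigma_finite P "lborel :: (real^'d) measure" by standard
  let ?W = "\<lambda>z. weight \<Gamma> q ({..<k}, close_pairs 1 (z(0 := 0)) {..<k})"
  let ?G = "\<lambda>z t. ?W z * (indicator A t * f t ^ k * exp (- \<rho> * f t * hit_volume q k z))"
  let ?D = "\<lambda>z t. 2 ^ 2 ^ k * indicator (support_box k) z * f t ^ k :: real"
  note [measurable] = f(1)
  have [measurable]: "A \<in> sets borel" using A by simp
  have [measurable]: "?W \<in> borel_measurable P" "hit_volume q k \<in> borel_measurable P" "support_box k \<in> sets P"
    unfolding P_def by (rule shifted_weight_measurable hit_volume_measurable support_box_measure)+
  have fk: "integrable lborel (\<lambda>t. f t ^ k)" by (rule power_density_integrable[OF f F k])
  have box: "integrable P (\<lambda>z. 2 ^ 2 ^ k * indicator (support_box k) z :: real)"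
    unfolding P_def by (intro integrable_mult_right integrable_real_indicator support_box_measure)
  have D: "integrable (P \<Otimes>\<^sub>M lborel) (\<lambda>(z, t). ?D z t)"
  proof (rule pair.Fubini_integrable)
    show "(\<lambda>(z, t). ?D z t) \<in> borel_measurable (P \<Otimes>\<^sub>M lborel)" by measurable
    show "integrable P (\<lambda>z. \<integral>t. norm (case (z, t) of (z, t) \<Rightarrow> ?D z t) \<partial>lborel)"
      using integrable_mult_left[OF box, of "\<integral>t. f t ^ k \<partial>lborel"] f(2) by (simp add: abs_mult)
    show "AE z in P. integrable lborel (\<lambda>t. case (z, t) of (z, t) \<Rightarrow> ?D z t)" using fk by simp
  qed
  have G: "integrable (P \<Otimes>\<^sub>M lborel) (\<lambda>(z, t). ?G z t)"
  proof (rule Bochner_Integration.integrable_bound[OF D])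
    show "(\<lambda>(z, t). ?G z t) \<in> borel_measurable (P \<Otimes>\<^sub>M lborel)" by measurable
    show "AE u in P \<Otimes>\<^sub>M lborel. norm (case u of (z, t) \<Rightarrow> ?G z t) \<le> norm (case u of (z, t) \<Rightarrow> ?D z t)"
    proof (rule AE_I2)
      fix u assume "u \<in> space (P \<Otimes>\<^sub>M (lborel :: (real^'d) measure))"
      then obtain z t where u: "u = (z, t)" and z: "z \<in> space P" by (auto simp: space_pair_measure)
      have W0: "0 \<le> ?W z" by (rule weight_nonneg[OF q(2)])
      have e: "exp (- \<rho> * f t * hit_volume q k z) \<le> 1"
        using \<rho> f(2)[of t] hit_volume_nonneg[OF q, of k z] by simp
      have "indicator A t * f t ^ k * exp (- \<rho> * f t * hit_volume q k z) \<le> 1 * f t ^ k * 1"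
        using e f(2)[of t] by (intro mult_mono) (auto simp: indicator_def)
      then have "?G z t \<le> (2 ^ 2 ^ k * indicator (support_box k) z) * f t ^ k"
        using weight_le_support_box[OF \<Gamma> q k, of z] z W0 f(2)[of t]
        by (intro mult_mono) (auto simp: P_def)
      then show "norm (case u of (z, t) \<Rightarrow> ?G z t) \<le> norm (case u of (z, t) \<Rightarrow> ?D z t)"
        using W0 f(2)[of t] unfolding u by (simp add: abs_mult)
    qed
  qed
  have inner: "(\<integral>z. ?G z t \<partial>P) = indicator A t * f t ^ k * (\<integral>z. limit_integrand \<Gamma> q k (\<rho> * f t) z \<partial>P)" for t
    unfolding limit_integrand_def
    by (subst integral_mult_right_zero[symmetric]) (simp add: ac_simps)
  have outer: "(\<integral>t. ?G z t \<partial>lborel) = ?W z * (\<integral>t. indicator A t * f t ^ k * exp (- \<rho> * f t * hit_volume q k z) \<partial>lborel)" for z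
    by simp
  show "integrable lborel (\<lambda>t. indicator A t * f t ^ k * (\<integral>z. limit_integrand \<Gamma> q k (\<rho> * f t) z \<partial>P))"
    using pair.integrable_snd[OF G] unfolding inner .
  show "(\<integral>z. ?W z * (\<integral>t. indicator A t * f t ^ k * exp (- \<rho> * f t * hit_volume q k z) \<partial>lborel) \<partial>P) =
      (\<integral>t. indicator A t * f t ^ k * (\<integral>z. limit_integrand \<Gamma> q k (\<rho> * f t) z \<partial>P) \<partial>lborel)"
    using pair.Fubini_integral[OF G] unfolding inner outer by simp
qed

lemma binomial_limit:
  assumes "k \<ge> 1"
  shows "(\<lambda>n. real (n choose k) / real n ^ k) \<longlonglongrightarrow> 1 / fact k"
proof -
  have "eventually (\<lambda>n. (\<Prod>i<k. 1 - real i / real n) / fact k = real (n choose k) / real n ^ k) sequentially"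
    using eventually_gt_at_top[of 0]
  proof eventually_elim
    case (elim n)
    have "real (n choose k) = (\<Prod>i<k. real n - real i) / fact k"
      by (simp add: binomial_gbinomial gbinomial_prod_rev atLeast0LessThan)
    moreover have "(\<Prod>i<k. 1 - real i / real n) = (\<Prod>i<k. real n - real i) / real n ^ k"
    proof -
      have "(\<Prod>i<k. 1 - real i / real n) = (\<Prod>i<k. (real n - real i) / real n)"
        using elim by (intro prod.cong) (auto simp: field_simps)
      then show ?thesis by (simp add: prod_dividef)
    qed
    ultimately show ?case by simp
  qed
  moreover have "(\<lambda>n. (\<Prod>i<k. 1 - real i / real n) / fact k) \<longlonglongrightarrow> (\<Prod>i<k. 1 - 0) / fact k"
    by (intro tendsto_intros lim_const_over_n) simp
  ultimately show ?thesis using Lim_transform_eventually by fastforce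
qed

section \<open>The lower bound\<close>

text \<open>A function that is not integrable has integral 0, so the bound covers non-measurable \<open>u\<close> and \<open>v\<close> as well.
It will be applied to functions built from \<^const>\<open>h_ind\<close> and \<^const>\<open>g_ind\<close>.\<close>

lemma integral_add_le:
  fixes u v w :: "'a \<Rightarrow> real"
  assumes w: "integrable M w" and u: "\<And>x. x \<in> space M \<Longrightarrow> 0 \<le> u x" and v: "\<And>x. x \<in> space M \<Longrightarrow> 0 \<le> v x"
    and le: "\<And>x. x \<in> space M \<Longrightarrow> u x + v x \<le> w x"
  shows "(\<integral>x. u x \<partial>M) + (\<integral>x. v x \<partial>M) \<le> (\<integral>x. w x \<partial>M)"
proof -
  have w0: "0 \<le> w x" and uw: "u x \<le> w x" and vw: "v x \<le> w x" if "x \<in> space M" for x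
    using u[OF that] v[OF that] le[OF that] by auto
  have U: "(\<integral>x. u x \<partial>M) \<le> (\<integral>x. w x \<partial>M)" and V: "(\<integral>x. v x \<partial>M) \<le> (\<integral>x. w x \<partial>M)"
    using uw vw w0 by (auto intro!: integral_mono' w)
  (* If one of u and v is not integrable, its integral is 0 and the other one is bounded on its own. *)
  consider "integrable M u" "integrable M v" | "\<not> integrable M u" | "\<not> integrable M v" by blast
  then show ?thesis
  proof cases
    case 1
    then have "(\<integral>x. u x \<partial>M) + (\<integral>x. v x \<partial>M) = (\<integral>x. u x + v x \<partial>M)" by simp
    also have "\<dots> \<le> (\<integral>x. w x \<partial>M)" by (rule integral_mono) (use 1 w le in auto)
    finally show ?thesis .
  qed (use U V in \<open>simp_all add: not_integrable_integral_eq\<close>)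
qed

lemma geometric_graph_eq_relabel:
  assumes "inj_on \<zeta> I"
  shows "geometric_graph (\<zeta> ` I) r = relabel \<zeta> (I, close_pairs r \<zeta> I)"
proof -
  have "edges (geometric_graph (\<zeta> ` I) r) = (`) \<zeta> ` close_pairs r \<zeta> I"
  proof (intro equalityI subsetI)
    fix e assume "e \<in> edges (geometric_graph (\<zeta> ` I) r)"
    then obtain i j where ij: "e = {\<zeta> i, \<zeta> j}" "i \<in> I" "j \<in> I" "\<zeta> i \<noteq> \<zeta> j" "dist (\<zeta> i) (\<zeta> j) \<le> r"
      by (auto simp: geometric_graph_def)
    then have "{i, j} \<in> close_pairs r \<zeta> I" by (auto simp: doubleton_mem_close_pairs)
    moreover have "e = \<zeta> ` {i, j}" using ij by simp
    ultimately show "e \<in> (`) \<zeta> ` close_pairs r \<zeta> I" by blast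
  next
    fix e assume "e \<in> (`) \<zeta> ` close_pairs r \<zeta> I"
    then obtain i j where ij: "e = {\<zeta> i, \<zeta> j}" "i \<in> I" "j \<in> I" "i \<noteq> j" "dist (\<zeta> i) (\<zeta> j) \<le> r"
      by (elim close_pairsE imageE) simp
    then have "\<zeta> i \<noteq> \<zeta> j" using assms by (auto dest: inj_onD)
    then show "e \<in> edges (geometric_graph (\<zeta> ` I) r)" using ij by (simp add: doubleton_mem_geometric)
  qed
  then show ?thesis by (simp add: relabel_def geometric_graph_def)
qed

lemma simple_geometric_graph: "finite Y \<Longrightarrow> simple_graph (geometric_graph Y r)"
  by (auto simp: simple_graph_def geometric_graph_def card_2_iff)

lemma hit_volume_le_ball_union_volume:
  fixes z :: "nat \<Rightarrow> real^'d::finite"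
  assumes q: "0 \<le> q" "q \<le> 1"
  shows "hit_volume q k z \<le> ball_union_volume ((z(0 := 0)) ` {..<k})"
proof -
  define B where "B = (\<Union>i\<in>{..<k}. cball ((z(0 := 0)) i) 1)"
  have B: "B \<in> sets borel" "emeasure lborel B < \<infinity>"
    unfolding B_def by (rule union_cball_finite_measure[OF finite_lessThan])+
  have le: "hit_prob q (z(0 := 0)) {..<k} w \<le> indicator B w" for w
    unfolding B_def by (rule hit_prob_le_indicator[OF q])
  have "hit_volume q k z \<le> (\<integral>w. indicator B w \<partial>lborel)"
    unfolding hit_volume_def by (rule integral_mono') (use B le in \<open>auto intro!: integrable_real_indicator\<close>)
  also have "\<dots> = measure lborel B" using B by simp
  also have "B = (\<Union>y\<in>(z(0 := 0)) ` {..<k}. cball y 1)" unfolding B_def by blast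
  finally show ?thesis by (simp only: ball_union_volume_def)
qed

text \<open>Pointwise comparison behind the lower bound. If two of the points coincide, the left-hand side
is 0; otherwise the geometric graph is a relabelling of the index graph.\<close>

lemma iso_strict_le_limit_integrand:
  fixes z :: "nat \<Rightarrow> real^'d::finite"
  assumes \<Gamma>: "simple_graph \<Gamma>" and k: "card (verts \<Gamma>) = k" "k \<ge> 1" and q: "0 \<le> q" "q \<le> 1" and lam: "0 \<le> lam"
  defines "Y \<equiv> insert 0 (z ` {1..k-1})"
  shows "h_ind \<Gamma> Y * exp (- lam * ball_union_volume Y) +
      (1 - q) ^ ((k choose 2) - card (edges \<Gamma>)) * (g_ind \<Gamma> Y * exp (- lam * ball_union_volume Y))
    \<le> limit_integrand \<Gamma> q k lam z"
proof -
  let ?\<zeta> = "z(0 := 0)" and ?I = "{..<k}"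
  let ?W = "weight \<Gamma> q (?I, close_pairs 1 ?\<zeta> ?I)"
  have Y: "Y = ?\<zeta> ` ?I"
  proof -
    have "?I = insert 0 {1..k-1}" using k by auto
    then show ?thesis unfolding Y_def by auto
  qed
  have "finite Y" by (simp add: Y)
  have W0: "0 \<le> ?W" by (rule weight_nonneg[OF q(2)])
  have hg: "h_ind \<Gamma> Y + (1 - q) ^ ((k choose 2) - card (edges \<Gamma>)) * g_ind \<Gamma> Y \<le> ?W"
  proof (cases "card Y = k")
    case True
    then have inj: "inj_on ?\<zeta> ?I" unfolding Y by (intro eq_card_imp_inj_on) auto
    have rel: "geometric_graph Y 1 = relabel ?\<zeta> (?I, close_pairs 1 ?\<zeta> ?I)"
      unfolding Y by (rule geometric_graph_eq_relabel[OF inj])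
    have W: "?W = weight \<Gamma> q (geometric_graph Y 1)"
      unfolding rel by (rule weight_relabel[symmetric]) (use inj close_pairs_subset[of 1 ?\<zeta> ?I] in auto)
    have simple: "simple_graph (geometric_graph Y 1)" using \<open>finite Y\<close> by (rule simple_geometric_graph)
    have cardv: "card (verts (geometric_graph Y 1)) = card (verts \<Gamma>)" using True k by (simp add: geometric_graph_def)
    consider "graph_iso (geometric_graph Y 1) \<Gamma>" | "strictly_contains (geometric_graph Y 1) \<Gamma>"
      | "\<not> graph_iso (geometric_graph Y 1) \<Gamma>" "\<not> strictly_contains (geometric_graph Y 1) \<Gamma>" by blast
    then show ?thesis
    proof cases
      case 1
      then have "\<not> strictly_contains (geometric_graph Y 1) \<Gamma>" by (simp add: strictly_contains_def)
      then show ?thesis using weight_iso[OF simple \<Gamma> 1 q] by (simp add: h_ind_def g_ind_def W)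
    next
      case 2
      then have "\<not> graph_iso (geometric_graph Y 1) \<Gamma>" by (simp add: strictly_contains_def)
      then show ?thesis
        using weight_strictly_contains[OF simple \<Gamma> 2 cardv q] k True \<open>finite Y\<close> 2
        by (simp add: h_ind_def g_ind_def W)
    next
      case 3
      then show ?thesis using W0 by (simp add: h_ind_def g_ind_def)
    qed
  next
    case False
    then show ?thesis using W0 k by (simp add: h_ind_def g_ind_def)
  qed
  have "hit_volume q k z \<le> ball_union_volume Y"
    unfolding Y by (rule hit_volume_le_ball_union_volume[OF q])
  then have e: "exp (- lam * ball_union_volume Y) \<le> exp (- lam * hit_volume q k z)"
    using lam by (simp add: mult_left_mono)
  have "(h_ind \<Gamma> Y + (1 - q) ^ ((k choose 2) - card (edges \<Gamma>)) * g_ind \<Gamma> Y) * exp (- lam * ball_union_volume Y)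
      \<le> limit_integrand \<Gamma> q k lam z"
    unfolding limit_integrand_def by (rule mult_mono[OF hg e W0]) auto
  then show ?thesis by (simp add: algebra_simps)
qed

text \<open>For \<open>k = 1\<close> the convention \<open>exp (- lam * \<theta>)\<close> agrees with the integral formula over the one-point space.\<close>

lemma p_iso_eq_integral:
  assumes \<Gamma>: "simple_graph \<Gamma>" and k: "card (verts \<Gamma>) = k" "k \<ge> 1"
  shows "p_iso TYPE('d::finite) \<Gamma> lam = lam ^ (k - 1) / fact (k - 1) *
    (\<integral>x. h_ind \<Gamma> (insert 0 (x ` {1..k-1})) * exp (- lam * ball_union_volume (insert 0 (x ` {1..k-1})))
       \<partial>Pi\<^sub>M {1..k-1} (\<lambda>_. lborel :: (real^'d) measure))"
proof (cases "k = 1")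
  case True
  obtain v where v: "verts \<Gamma> = {v}" using k True by (auto simp: card_1_singleton_iff)
  have "e \<notin> edges \<Gamma>" for e
  proof
    assume "e \<in> edges \<Gamma>"
    then have "e \<subseteq> {v}" "card e = 2" using \<Gamma> v by (auto simp: simple_graph_def)
    then show False using card_mono[of "{v}" e] by simp
  qed
  then have "graph_iso (geometric_graph {0 :: real^'d} 1) \<Gamma>"
    unfolding graph_iso_def geometric_graph_def by (intro exI[of _ "\<lambda>_. v"]) (auto simp: v bij_betw_def)
  then have "h_ind \<Gamma> {0 :: real^'d} = 1" using k True by (simp add: h_ind_def)
  then show ?thesis
    using True k
    by (simp add: p_iso_def PiM_empty lebesgue_integral_count_space_finite ball_union_volume_def)
next
  case False
  then show ?thesis using k by (simp add: p_iso_def)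
qed

lemma p_iso_p_strict_le:
  assumes \<Gamma>: "simple_graph \<Gamma>" "connected_graph \<Gamma>" and k: "card (verts \<Gamma>) = k" "k \<ge> 1"
    and q: "0 \<le> q" "q \<le> 1" and lam: "0 \<le> lam"
  shows "0 \<le> p_iso TYPE('d::finite) \<Gamma> lam" and "0 \<le> p_strict TYPE('d) \<Gamma> lam"
    and "p_iso TYPE('d) \<Gamma> lam + (1 - q) ^ ((k choose 2) - card (edges \<Gamma>)) * p_strict TYPE('d) \<Gamma> lam
      \<le> lam ^ (k - 1) / fact (k - 1) *
        (\<integral>z. limit_integrand \<Gamma> q k lam z \<partial>Pi\<^sub>M {1..k-1} (\<lambda>_. lborel :: (real^'d) measure))"
proof -
  let ?P = "Pi\<^sub>M {1..k-1} (\<lambda>_. lborel :: (real^'d) measure)"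
  let ?Y = "\<lambda>x. insert 0 (x ` {1..k-1}) :: (real^'d) set"
  let ?h = "\<lambda>x. h_ind \<Gamma> (?Y x) * exp (- lam * ball_union_volume (?Y x))"
  let ?g = "\<lambda>x. g_ind \<Gamma> (?Y x) * exp (- lam * ball_union_volume (?Y x))"
  let ?c = "(1 - q) ^ ((k choose 2) - card (edges \<Gamma>))"
  have c: "0 \<le> ?c" using q by simp
  have a: "0 \<le> lam ^ (k - 1) / fact (k - 1)" using lam by simp
  have h0: "0 \<le> ?h x" and g0: "0 \<le> ?g x" for x by (simp_all add: h_ind_def g_ind_def)
  have iso: "p_iso TYPE('d) \<Gamma> lam = lam ^ (k - 1) / fact (k - 1) * (\<integral>x. ?h x \<partial>?P)"
    by (rule p_iso_eq_integral[OF \<Gamma>(1) k])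
  have strict: "p_strict TYPE('d) \<Gamma> lam = lam ^ (k - 1) / fact (k - 1) * (\<integral>x. ?g x \<partial>?P)"
    using k by (simp add: p_strict_def)
  show "0 \<le> p_iso TYPE('d) \<Gamma> lam"
    unfolding iso by (rule mult_nonneg_nonneg[OF a integral_nonneg_AE]) (use h0 in auto)
  show "0 \<le> p_strict TYPE('d) \<Gamma> lam"
    unfolding strict by (rule mult_nonneg_nonneg[OF a integral_nonneg_AE]) (use g0 in auto)
  have "(\<integral>x. ?h x \<partial>?P) + (\<integral>x. ?c * ?g x \<partial>?P) \<le> (\<integral>z. limit_integrand \<Gamma> q k lam z \<partial>?P)"
    by (rule integral_add_le[OF limit_integrand_integrable[OF \<Gamma> q k(2) lam] h0 mult_nonneg_nonneg[OF c g0]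
      iso_strict_le_limit_integrand[OF \<Gamma>(1) k q lam]])
  then have "(\<integral>x. ?h x \<partial>?P) + ?c * (\<integral>x. ?g x \<partial>?P) \<le> (\<integral>z. limit_integrand \<Gamma> q k lam z \<partial>?P)"
    by simp
  from mult_left_mono[OF this a]
  show "p_iso TYPE('d) \<Gamma> lam + ?c * p_strict TYPE('d) \<Gamma> lam
      \<le> lam ^ (k - 1) / fact (k - 1) * (\<integral>z. limit_integrand \<Gamma> q k lam z \<partial>?P)"
    unfolding iso strict by (simp add: distrib_left ac_simps)
qed

lemma p_strict_integral_nonneg:
  fixes f :: "real^'d::finite \<Rightarrow> real"
  assumes "simple_graph \<Gamma>" "\<And>x. 0 \<le> f x" "0 \<le> \<rho>"
  shows "0 \<le> (LINT x:A|lborel. p_strict TYPE('d) \<Gamma> (\<rho> * f x) * f x)"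
proof -
  have "0 \<le> p_strict TYPE('d) \<Gamma> lam" if "0 \<le> lam" for lam
    unfolding p_strict_def Let_def using that
    by (intro mult_nonneg_nonneg divide_nonneg_pos integral_nonneg_AE) (auto simp: g_ind_def)
  then show ?thesis
    unfolding set_lebesgue_integral_def using assms by (intro integral_nonneg_AE) auto
qed

text \<open>The limit exists for every convergent sequence of retention probabilities, and depends on it only through
the limit \<open>q\<close>.\<close>

theorem expected_count_limit:
  fixes M :: "'w measure" and f :: "real^'d::finite \<Rightarrow> real" and p r :: "nat \<Rightarrow> real"
    and X :: "nat \<Rightarrow> 'w \<Rightarrow> real^'d" and K :: "nat \<Rightarrow> nat set \<Rightarrow> 'w \<Rightarrow> bool"
    and A :: "(real^'d) set" and axis :: 'd and \<Gamma> :: "'v graph" and q :: real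
  assumes model: "percolation_model M f p X K"
    and f: "f \<in> borel_measurable borel" "\<And>x. 0 \<le> f x" "(\<integral>\<^sup>+x. ennreal (f x) \<partial>lborel) = 1"
    and F: "\<And>x. f x \<le> F" "1 \<le> F"
    and r_pos: "\<And>n. n \<ge> 1 \<Longrightarrow> 0 < r n"
    and p_range: "\<And>n. n \<ge> 1 \<Longrightarrow> 0 < p n \<and> p n \<le> 1"
    and p_lim: "p \<longlonglongrightarrow> q"
    and A: "open A" "emeasure lborel (frontier A) = 0"
    and \<Gamma>: "simple_graph \<Gamma>" "connected_graph \<Gamma>" and k: "card (verts \<Gamma>) = k"
    and thermodynamic: "(\<lambda>n. real n * r n ^ CARD('d)) \<longlonglongrightarrow> \<rho>" and \<rho>: "0 < \<rho>"
  defines "EJ \<equiv> \<lambda>n. \<integral>\<omega>. real (component_count axis A \<Gamma>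
              (percolated_graph n (\<lambda>i. X i \<omega>) (\<lambda>e. K n e \<omega>) (r n))) \<partial>M"
  defines "c \<equiv> (1 - q) ^ ((k choose 2) - card (edges \<Gamma>))"
  shows "\<exists>L. (\<lambda>n. EJ n / (real n * p n ^ card (edges \<Gamma>))) \<longlonglongrightarrow> L \<and>
    L \<ge> 1 / real k * (LINT x:A|lborel. p_iso TYPE('d) \<Gamma> (\<rho> * f x) * f x)
       + 1 / real k * c * (LINT x:A|lborel. p_strict TYPE('d) \<Gamma> (\<rho> * f x) * f x)"
proof -
  let ?m = "card (edges \<Gamma>)" and ?d = "CARD('d)"
  let ?P = "Pi\<^sub>M {1..k-1} (\<lambda>_. lborel :: (real^'d) measure)"
  interpret model: percolation_model M f p X K by (rule model)
  have k1: "k \<ge> 1"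
    using k \<Gamma> simple_graphD(1)[OF \<Gamma>(1)] by (auto simp: connected_graph_def Suc_le_eq card_gt_0_iff)
  have q: "0 \<le> q" "q \<le> 1"
    by (rule LIMSEQ_le_const[OF p_lim] LIMSEQ_le_const2[OF p_lim], use p_range in \<open>auto intro: exI[of _ 1] less_imp_le\<close>)+
  let ?Q = "\<lambda>n. \<integral>z. weight \<Gamma> (p n) ({..<k}, close_pairs 1 (z(0 := 0)) {..<k}) *
        (\<integral>t. slice_integrand f axis A (p n) (r n) (n - k) {..<k} (z(0 := 0)) t \<partial>lborel) \<partial>?P"
  let ?Q' = "\<integral>z. weight \<Gamma> q ({..<k}, close_pairs 1 (z(0 := 0)) {..<k}) *
        (\<integral>t. indicator A t * f t ^ k * exp (- \<rho> * f t * hit_volume q k z) \<partial>lborel) \<partial>?P"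
  have exact: "EJ n / (real n * p n ^ ?m) = (real (n choose k) / real n ^ k) * (real n * r n ^ ?d) ^ (k - 1) * ?Q n"
    if n: "n \<ge> 1" for n
  proof -
    have p: "0 < p n" "p n \<le> 1" using p_range[OF n] by auto
    have "EJ n = real (n choose k) * p n ^ ?m * ((r n ^ ?d) ^ (k - 1) * ?Q n)"
      unfolding EJ_def
      by (subst model.expected_component_count[OF n _ \<Gamma> _ p(2) k])
        (use p A rescaled_copy_integral[OF f F(1) _ p(2) r_pos[OF n] k1, of A \<Gamma> axis "n - k"] in auto)
    moreover have "real n ^ k = real n * real n ^ (k - 1)" using k1 by (cases k) auto
    ultimately show ?thesis using p n by (simp add: field_simps power_mult_distrib)
  qed
  have r0: "r \<longlonglongrightarrow> 0"
  proof -
    have "(\<lambda>n. (real n * r n ^ ?d) * (1 / real n)) \<longlonglongrightarrow> \<rho> * 0"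
      by (intro tendsto_mult thermodynamic lim_const_over_n)
    moreover have "eventually (\<lambda>n. (real n * r n ^ ?d) * (1 / real n) = r n ^ ?d) sequentially"
      using eventually_gt_at_top[of 0] by eventually_elim simp
    ultimately have pow: "(\<lambda>n. r n ^ ?d) \<longlonglongrightarrow> 0" using Lim_transform_eventually by fastforce
    have "(\<lambda>n. root ?d (r n ^ ?d)) \<longlonglongrightarrow> root ?d 0" by (intro tendsto_real_root pow)
    moreover have "eventually (\<lambda>n. root ?d (r n ^ ?d) = r n) sequentially"
      using eventually_ge_at_top[of 1] by eventually_elim (use r_pos in \<open>simp add: real_root_power_cancel less_imp_le\<close>)
    ultimately show ?thesis using Lim_transform_eventually by fastforce
  qed
  have nk: "(\<lambda>n. real (n - k) * r n ^ ?d) \<longlonglongrightarrow> \<rho>"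
  proof -
    have "(\<lambda>n. real n * r n ^ ?d - real k * r n ^ ?d) \<longlonglongrightarrow> \<rho> - real k * 0 ^ ?d"
      by (intro tendsto_intros thermodynamic r0)
    moreover have "eventually (\<lambda>n. real n * r n ^ ?d - real k * r n ^ ?d = real (n - k) * r n ^ ?d) sequentially"
      using eventually_ge_at_top[of k] by eventually_elim (simp add: of_nat_diff left_diff_distrib)
    ultimately have "(\<lambda>n. real (n - k) * r n ^ ?d) \<longlonglongrightarrow> \<rho> - real k * 0 ^ ?d"
      by (rule Lim_transform_eventually)
    then show ?thesis by (simp add: power_0_left)
  qed
  (* Positivity of r and p is known from index 1 on only, hence the shift by one. *)
  have "(\<lambda>n. ?Q (Suc n)) \<longlonglongrightarrow> ?Q'"
    by (rule rescaled_integral_limit[OF f F _ _ _ _ _ _ A \<Gamma> k1,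
          of "\<lambda>n. r (Suc n)" "\<lambda>n. Suc n - k" \<rho> "\<lambda>n. p (Suc n)" q])
      (use r_pos p_range in \<open>auto simp: less_imp_le intro: LIMSEQ_Suc[OF r0] LIMSEQ_Suc[OF nk] LIMSEQ_Suc[OF p_lim]\<close>)
  then have Q_lim: "?Q \<longlonglongrightarrow> ?Q'" by (rule LIMSEQ_imp_Suc)
  have "(\<lambda>n. (real (n choose k) / real n ^ k) * (real n * r n ^ ?d) ^ (k - 1) * ?Q n) \<longlonglongrightarrow>
      (1 / fact k) * \<rho> ^ (k - 1) * ?Q'"
    by (intro tendsto_mult tendsto_power binomial_limit k1 thermodynamic Q_lim)
  then have "(\<lambda>n. EJ n / (real n * p n ^ ?m)) \<longlonglongrightarrow> (1 / fact k) * \<rho> ^ (k - 1) * ?Q'"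
    by (rule Lim_transform_eventually)
      (use eventually_ge_at_top[of 1] in \<open>eventually_elim, simp only: exact\<close>)
  moreover have "(1 / fact k) * \<rho> ^ (k - 1) * ?Q' \<ge>
      1 / real k * (LINT x:A|lborel. p_iso TYPE('d) \<Gamma> (\<rho> * f x) * f x)
       + 1 / real k * c * (LINT x:A|lborel. p_strict TYPE('d) \<Gamma> (\<rho> * f x) * f x)"
  proof -
    let ?u = "\<lambda>x. indicator A x * (p_iso TYPE('d) \<Gamma> (\<rho> * f x) * f x)"
    let ?v = "\<lambda>x. c * (indicator A x * (p_strict TYPE('d) \<Gamma> (\<rho> * f x) * f x))"
    let ?G = "\<lambda>x. indicator A x * f x ^ k * (\<integral>z. limit_integrand \<Gamma> q k (\<rho> * f x) z \<partial>?P)"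
    let ?w = "\<lambda>x. (\<rho> ^ (k - 1) / fact (k - 1)) * ?G x"
    have c0: "0 \<le> c" using q by (simp add: c_def)
    note Fub = limit_integral_Fubini[OF f F(1) q A(1) less_imp_le[OF \<rho>] \<Gamma> k1]
    have "(\<integral>x. ?u x \<partial>lborel) + (\<integral>x. ?v x \<partial>lborel) \<le> (\<integral>x. ?w x \<partial>lborel)"
    proof (rule integral_add_le)
      show "integrable lborel ?w" by (intro integrable_mult_right Fub(1))
      fix x :: "real^'d"
      have lam: "0 \<le> \<rho> * f x" using \<rho> f by simp
      note pp = p_iso_p_strict_le[OF \<Gamma> k k1 q lam, where 'd = 'd, folded c_def]
      show "0 \<le> ?u x" using pp(1) f by (simp add: indicator_def)
      show "0 \<le> ?v x" using pp(2) f c0 by (simp add: indicator_def)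
      have fk: "f x ^ k = f x ^ (k - 1) * f x" using k1 by (cases k) auto
      have "(p_iso TYPE('d) \<Gamma> (\<rho> * f x) + c * p_strict TYPE('d) \<Gamma> (\<rho> * f x)) * f x \<le>
         ((\<rho> * f x) ^ (k - 1) / fact (k - 1) * (\<integral>z. limit_integrand \<Gamma> q k (\<rho> * f x) z \<partial>?P)) * f x"
        by (rule mult_right_mono[OF pp(3)]) (use f in auto)
      then have "indicator A x * ((p_iso TYPE('d) \<Gamma> (\<rho> * f x) + c * p_strict TYPE('d) \<Gamma> (\<rho> * f x)) * f x) \<le>
         indicator A x * (((\<rho> * f x) ^ (k - 1) / fact (k - 1) * (\<integral>z. limit_integrand \<Gamma> q k (\<rho> * f x) z \<partial>?P)) * f x)"
        by (rule mult_left_mono) simp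
      then show "?u x + ?v x \<le> ?w x"
        unfolding fk by (simp add: algebra_simps power_mult_distrib)
    qed
    then have "1 / real k * ((\<integral>x. ?u x \<partial>lborel) + (\<integral>x. ?v x \<partial>lborel)) \<le> 1 / real k * (\<integral>x. ?w x \<partial>lborel)"
      by (intro mult_left_mono) auto
    moreover have "(\<integral>x. ?v x \<partial>lborel) = c * (\<integral>x. indicator A x * (p_strict TYPE('d) \<Gamma> (\<rho> * f x) * f x) \<partial>lborel)" by simp
    moreover have "(\<integral>x. ?w x \<partial>lborel) = (\<rho> ^ (k - 1) / fact (k - 1)) * ?Q'" unfolding Fub(2) by simp
    moreover have "(fact k :: real) = real k * fact (k - 1)" using k1 by (cases k) auto
    ultimately show ?thesis
      by (simp add: set_lebesgue_integral_def algebra_simps)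
  qed
  ultimately show ?thesis by blast
qed

theorem theorem2p8:
  fixes M :: "'w measure"
    and f :: "real^'d::finite \<Rightarrow> real"
    and X :: "nat \<Rightarrow> 'w \<Rightarrow> real^'d"
    and K :: "nat \<Rightarrow> nat set \<Rightarrow> 'w \<Rightarrow> bool"
    and p r :: "nat \<Rightarrow> real"
    and \<rho> :: real
    and A :: "(real^'d) set"
    and i1 :: 'd
    and \<Gamma> :: "'v graph"
    and k m :: nat
  defines "EJ \<equiv> \<lambda>n. \<integral>\<omega>. real (component_count i1 A \<Gamma>
              (percolated_graph n (\<lambda>i. X i \<omega>) (\<lambda>e. K n e \<omega>) (r n))) \<partial>M"
  assumes f_nonneg: "\<And>x. 0 \<le> f x"
    and f_bounded: "bounded (range f)"
    and f_measurable: "f \<in> borel_measurable borel"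
    and f_density: "(\<integral>\<^sup>+x. ennreal (f x) \<partial>lborel) = 1"
    and model: "percolation_model M f p X K"
    and r_pos: "\<And>n. n \<ge> 1 \<Longrightarrow> 0 < r n"
    and p_range: "\<And>n. n \<ge> 1 \<Longrightarrow> 0 < p n \<and> p n \<le> 1"
    and A_open: "open A"
    and A_boundary: "emeasure lborel (frontier A) = 0"
    and \<Gamma>_graph: "simple_graph \<Gamma>"
    and \<Gamma>_connected: "connected_graph \<Gamma>"
    and \<Gamma>_verts: "card (verts \<Gamma>) = k"
    and \<Gamma>_edges: "card (edges \<Gamma>) = m"
    and thermodynamic: "(\<lambda>n. real n * r n ^ CARD('d)) \<longlonglongrightarrow> \<rho>"
    and \<rho>_pos: "0 < \<rho>"
  shows
    "(\<forall>q. (\<forall>n\<ge>1. p n = q) \<longrightarrow>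
       (\<exists>L. (\<lambda>n. EJ n / (real n * p n ^ m)) \<longlonglongrightarrow> L \<and>
          L \<ge> 1 / real k * (LINT x:A|lborel. p_iso TYPE('d) \<Gamma> (\<rho> * f x) * f x)
             + 1 / real k * (1 - q) ^ ((k choose 2) - m)
               * (LINT x:A|lborel. p_strict TYPE('d) \<Gamma> (\<rho> * f x) * f x)))
     \<and> (\<forall>\<alpha>>0. (\<lambda>n. (real n)\<^sup>2 * p n) \<longlonglongrightarrow> \<alpha> \<longrightarrow>
       (\<exists>L. (\<lambda>n. EJ n / (real n * p n ^ m)) \<longlonglongrightarrow> L \<and>
          L \<ge> 1 / real k * (LINT x:A|lborel. p_iso TYPE('d) \<Gamma> (\<rho> * f x) * f x)
             + 1 / real k * exp (- \<alpha> / 2)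
               * (LINT x:A|lborel. p_strict TYPE('d) \<Gamma> (\<rho> * f x) * f x)))
     \<and> ((\<lambda>n. (real n)\<^sup>2 * p n) \<longlonglongrightarrow> 0 \<longrightarrow>
       (\<exists>L. (\<lambda>n. EJ n / (real n * p n ^ m)) \<longlonglongrightarrow> L \<and>
          L \<ge> 1 / real k * (LINT x:A|lborel. p_iso TYPE('d) \<Gamma> (\<rho> * f x) * f x)
             + 1 / real k * (LINT x:A|lborel. p_strict TYPE('d) \<Gamma> (\<rho> * f x) * f x)))"
proof -
  obtain b where b: "\<And>x. norm (f x) \<le> b" using f_bounded by (auto simp: bounded_iff)
  have F: "f x \<le> max 1 b" "1 \<le> max 1 b" for x using b[of x] by auto
  note strict_nonneg = p_strict_integral_nonneg[OF \<Gamma>_graph f_nonneg less_imp_le[OF \<rho>_pos], of A]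
  let ?iso = "LINT x:A|lborel. p_iso TYPE('d) \<Gamma> (\<rho> * f x) * f x"
  let ?strict = "LINT x:A|lborel. p_strict TYPE('d) \<Gamma> (\<rho> * f x) * f x"
  have count_limit: "\<exists>L. (\<lambda>n. EJ n / (real n * p n ^ m)) \<longlonglongrightarrow> L \<and>
      L \<ge> 1 / real k * ?iso + 1 / real k * (1 - q) ^ ((k choose 2) - m) * ?strict" if "p \<longlonglongrightarrow> q" for q
    unfolding EJ_def \<Gamma>_edges[symmetric]
    by (rule expected_count_limit[OF model f_measurable f_nonneg f_density F r_pos p_range that A_open
      A_boundary \<Gamma>_graph \<Gamma>_connected \<Gamma>_verts thermodynamic \<rho>_pos])
  have p_vanishes: "p \<longlonglongrightarrow> 0" if "(\<lambda>n. (real n)\<^sup>2 * p n) \<longlonglongrightarrow> \<alpha>" for \<alpha>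
  proof -
    have "(\<lambda>n. ((real n)\<^sup>2 * p n) * (1 / real n * (1 / real n))) \<longlonglongrightarrow> \<alpha> * (0 * 0)"
      by (intro tendsto_mult that lim_const_over_n)
    moreover have "eventually (\<lambda>n. ((real n)\<^sup>2 * p n) * (1 / real n * (1 / real n)) = p n) sequentially"
      using eventually_gt_at_top[of 0] by eventually_elim (simp add: power2_eq_square)
    ultimately have "p \<longlonglongrightarrow> \<alpha> * (0 * 0)" by (rule Lim_transform_eventually)
    then show ?thesis by simp
  qed
  show ?thesis
  proof (intro conjI allI impI)
    fix q assume "\<forall>n\<ge>1. p n = q"
    then have "p \<longlonglongrightarrow> q"
      by (intro tendsto_eventually) (auto simp: eventually_sequentially intro!: exI[of _ 1])
    from count_limit[OF this]
    show "\<exists>L. (\<lambda>n. EJ n / (real n * p n ^ m)) \<longlonglongrightarrow> L \<and>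
      L \<ge> 1 / real k * ?iso + 1 / real k * (1 - q) ^ ((k choose 2) - m) * ?strict" .
  next
    fix \<alpha> :: real
    assume \<alpha>: "0 < \<alpha>" and lim: "(\<lambda>n. (real n)\<^sup>2 * p n) \<longlonglongrightarrow> \<alpha>"
    note p0 = p_vanishes[OF lim]
    obtain L where L: "(\<lambda>n. EJ n / (real n * p n ^ m)) \<longlonglongrightarrow> L"
        "L \<ge> 1 / real k * ?iso + 1 / real k * (1 - 0) ^ ((k choose 2) - m) * ?strict"
      using count_limit[OF p0] by blast
    have "1 / real k * exp (- \<alpha> / 2) * ?strict \<le> 1 / real k * 1 * ?strict"
      using \<alpha> strict_nonneg by (intro mult_right_mono mult_left_mono) auto
    then show "\<exists>L. (\<lambda>n. EJ n / (real n * p n ^ m)) \<longlonglongrightarrow> L \<and>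
      L \<ge> 1 / real k * ?iso + 1 / real k * exp (- \<alpha> / 2) * ?strict"
      using L by (intro exI[of _ L]) simp
  next
    assume lim: "(\<lambda>n. (real n)\<^sup>2 * p n) \<longlonglongrightarrow> 0"
    from count_limit[OF p_vanishes[OF lim]]
    show "\<exists>L. (\<lambda>n. EJ n / (real n * p n ^ m)) \<longlonglongrightarrow> L \<and>
      L \<ge> 1 / real k * ?iso + 1 / real k * ?strict" by simp
  qed
qed

end
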